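(* Assume that, for each $n\in\{1,2,\dots\}$, $Y\sim\mathrm{N}(X\beta,\Sigma_n(\psi))$ holds with known $\beta=0$ and true parameter $\psi=\psi_n\in\mathbb{P}_n\subseteq\mathbb{R}^{r_n}$. If there exist $\bar a_n$ with $\sup_{v\in\mathbb{S}^{r_n-1}}a_n(v,\psi_n)\leq\bar a_n$ for every $n$ and $\lim_{n\to\infty}\bar a_n=0$, then, for any $v_n\in\mathbb{S}^{r_n-1}$, $v_n^{\mathsf T}W_n^S(\psi_n)\to\mathrm{N}(0,1)$ in distribution as $n\to\infty$. Moreover, if in addition $X$ has full column rank for every $n$, and $\beta=\beta_n\in\mathbb{R}^{p_n}$ is unknown (so that $Y\sim\mathrm{N}(X\beta_n,\Sigma_n(\psi_n))$ and the parameter is $\theta_n=(\beta_n,\psi_n)$), it holds for any $u_n\in\mathbb{S}^{p_n+r_n-1}$ that $u_n^{\mathsf T}W_n^S(\theta_n)\to\mathrm{N}(0,1)$ in distribution as $n\to\infty$.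
   Context: Setting: for each $n$ there are non-stochastic matrices $X\in\mathbb{R}^{n\times p_n}$, $Z\in\mathbb{R}^{n\times q_n}$ (their dependence on $n$ is suppressed), and everything may depend on $n$ in any way consistent with the following model. For $\psi=[\psi_1,\dots,\psi_{r_n}]^{\mathsf T}\in\mathbb{R}^{r_n}$, $\Psi_n(\psi)\in\mathbb{R}^{q_n\times q_n}$ is a symmetric matrix each of whose elements is either known to be zero or equal to one of $\psi_1,\dots,\psi_{r_n-1}$; thus $\Psi_n(\psi)=\sum_{j=1}^{r_n}\psi_jH_j$ where $H_j=\partial\Psi_n/\partial\psi_j$ has entries zero and one, $H_j\ne0$ for $j<r_n$, and $H_{r_n}=0$. For any $v\in\mathbb{R}^{r_n}$, $\Psi_n(v)=\sum_jv_jH_j$ and $\Sigma_n(v)=Z\Psi_n(v)Z^{\mathsf T}+v_{r_n}I_n$. The parameter set for $\psi$ is $\mathbb{P}_n=\{\psi\in\mathbb{R}^{r_n}:\Psi_n(\psi)\geq0,\ \psi_{r_n}>0\}$ ($\geq 0$: positive semi-definite). Score and information (index $n$ suppressed): $A_j(\psi)=\Sigma(\psi)^{-1/2}\{\partial\Sigma(\psi)/\partial\psi_j\}\Sigma(\psi)^{-1/2}$, so $A_j = \Sigma^{-1/2}ZH_jZ^{\mathsf T}\Sigma^{-1/2}$ for $j<r$ and $A_r=\Sigma^{-1}$. With $R=\Sigma(\psi)^{-1/2}(Y-X\beta)$, the score for $\psi$ has elements $\frac12\{R^{\mathsf T}A_jR-\mathrm{tr}(A_j)\}$, $j=1,\dots,r$,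 and the score for $\beta$ is $X^{\mathsf T}\Sigma^{-1/2}R$; $S(\theta)\in\mathbb{R}^{p+r}$ stacks the score for $\beta$ and the score for $\psi$. The Fisher information $\mathcal{I}(\theta)=\mathrm{cov}_\theta\{S(\theta)\}$ is block-diagonal with blocks $X^{\mathsf T}\Sigma^{-1}X$ (for $\beta$) and $\mathcal{I}(\psi)$ with $\mathcal{I}_{ij}(\psi)=\mathrm{tr}(A_iA_j)/2$. $W^S(\theta)=\mathcal{I}(\theta)^{-1/2}S(\theta)$ when $\mathcal{I}(\theta)$ is invertible (symmetric square root). When $\beta=0$ is known, $\psi$ is the only parameter and $W^S(\psi)=\mathcal{I}(\psi)^{-1/2}S(\psi)$ with $S(\psi)$ the score for $\psi$ evaluated at $\beta=0$. $W^S_n$ denotes these quantities for given $n$. Convergence in distribution is under the true parameters indexed by $n$. Notation: $\|\cdot\|$ is the Euclidean norm of vectors and the spectral norm of matrices, $\|\cdot\|_F$ the Frobenius norm; $\mathbb{S}^{d-1}$ is the unit sphere in $\mathbb{R}^d$. $A(v,\psi)=\sum_jv_jA_j(\psi)=\Sigma(\psi)^{-1/2}\Sigma(v)\Sigma(\psi)^{-1/2}$; $a(v,\psi)=\|A(v,\psi)\|/\|A(v,\psi)\|_F$ if $\|A(v,\psi)\|_F>0$ and $a(v,\psi)=1$ otherwise; $a_n$ denotes $a$ for given $n$. *)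

theory Defs
  imports
    "HOL-Probability.Probability"
    "Jordan_Normal_Form.Gauss_Jordan_Elimination"
    "Jordan_Normal_Form.DL_Rank"
begin

unbundle no vec_syntax
unbundle no inner_syntax
hide_const (open) Finite_Cartesian_Product.vec Finite_Cartesian_Product.mat
  Finite_Cartesian_Product.row Finite_Cartesian_Product.column

text \<open>Dimensions vary with the sample size, so vectors and matrices are those of
  \<^theory>\<open>Jordan_Normal_Form.Matrix\<close>. Indices start at 0: the error variance, written
  \<open>\<psi>\<^sub>r\<close> on paper, is the entry \<open>r - 1\<close> of a vector of dimension \<open>r\<close>.\<close>

definition vnorm :: "real vec \<Rightarrow> real" where
  "vnorm v = sqrt (v \<bullet> v)"

definition unit_sphere :: "nat \<Rightarrow> real vec set" where
  "unit_sphere d = {v \<in> carrier_vec d. vnorm v = 1}"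

definition mtrace :: "real mat \<Rightarrow> real" where
  "mtrace A = (\<Sum>i<dim_row A. A $$ (i, i))"

definition frobenius_norm :: "real mat \<Rightarrow> real" where
  "frobenius_norm A = sqrt (\<Sum>i<dim_row A. \<Sum>k<dim_col A. (A $$ (i, k))\<^sup>2)"

definition spectral_norm :: "real mat \<Rightarrow> real" where
  "spectral_norm A = (SUP x\<in>unit_sphere (dim_col A). vnorm (A *\<^sub>v x))"

definition psd :: "real mat \<Rightarrow> bool" where
  "psd A \<longleftrightarrow> dim_row A = dim_col A \<and> A\<^sup>T = A \<and> (\<forall>x\<in>carrier_vec (dim_col A). 0 \<le> x \<bullet> (A *\<^sub>v x))"

text \<open>The symmetric square root, meaningful for positive semi-definite arguments.\<close>

definition msqrt :: "real mat \<Rightarrow> real mat" where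
  "msqrt A = (THE B. psd B \<and> B * B = A)"

text \<open>\<open>A\<^sup>-\<^sup>1\<^sup>/\<^sup>2\<close>, meaningful for positive definite arguments.\<close>

definition inv_msqrt :: "real mat \<Rightarrow> real mat" where
  "inv_msqrt A = msqrt (the (mat_inverse A))"

definition partial_mat :: "(real vec \<Rightarrow> real mat) \<Rightarrow> nat \<Rightarrow> real vec \<Rightarrow> real mat" where
  "partial_mat F j v = mat (dim_row (F v)) (dim_col (F v))
     (\<lambda>(i, k). deriv (\<lambda>t. F (update_vec v j t) $$ (i, k)) (v $ j))"

definition borel_vec :: "nat \<Rightarrow> real vec measure" where
  "borel_vec d = vimage_algebra (carrier_vec d) (\<lambda>v. \<lambda>i\<in>{..<d}. v $ i) (\<Pi>\<^sub>M i\<in>{..<d}. borel)"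

text \<open>\<open>N(\<mu>, S)\<close> is the law of \<open>\<mu> + S\<^sup>1\<^sup>/\<^sup>2 g\<close>, where \<open>g\<close> has independent standard normal entries.\<close>

definition mvnormal :: "real vec \<Rightarrow> real mat \<Rightarrow> real vec measure" where
  "mvnormal \<mu> S = (let d = dim_vec \<mu> in
     distr (\<Pi>\<^sub>M i\<in>{..<d}. std_normal_distribution) (borel_vec d) (\<lambda>g. \<mu> + msqrt S *\<^sub>v vec d g))"

definition normal_vector :: "'a measure \<Rightarrow> ('a \<Rightarrow> real vec) \<Rightarrow> real vec \<Rightarrow> real mat \<Rightarrow> bool" where
  "normal_vector M Y \<mu> S \<longleftrightarrow> prob_space M \<and> Y \<in> M \<rightarrow>\<^sub>M borel_vec (dim_vec \<mu>) \<and>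
     distr M (borel_vec (dim_vec \<mu>)) Y = mvnormal \<mu> S"

definition cov_mat :: "real vec measure \<Rightarrow> nat \<Rightarrow> (real vec \<Rightarrow> real vec) \<Rightarrow> real mat" where
  "cov_mat P d f = mat d d (\<lambda>(i, j).
     \<integral>y. (f y $ i - (\<integral>x. f x $ i \<partial>P)) * (f y $ j - (\<integral>x. f x $ j \<partial>P)) \<partial>P)"

text \<open>\<open>\<Psi>\<close> is symmetric, and each of its entries is either identically zero or identically one of
  \<open>\<psi>\<^sub>1, \<dots>, \<psi>\<^sub>r\<^sub>-\<^sub>1\<close>; each of these parameters does occur, that is, \<open>H\<^sub>j = \<partial>\<Psi>/\<partial>\<psi>\<^sub>j \<noteq> 0\<close> for \<open>j < r\<close>.\<close>

definition covariance_pattern :: "nat \<Rightarrow> nat \<Rightarrow> (real vec \<Rightarrow> real mat) \<Rightarrow> bool" where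
  "covariance_pattern q r \<Psi> \<longleftrightarrow> 1 \<le> r \<and>
     (\<forall>v\<in>carrier_vec r. \<Psi> v \<in> carrier_mat q q \<and> (\<Psi> v)\<^sup>T = \<Psi> v) \<and>
     (\<forall>i<q. \<forall>k<q. (\<forall>v\<in>carrier_vec r. \<Psi> v $$ (i, k) = 0) \<or>
        (\<exists>j<r - 1. \<forall>v\<in>carrier_vec r. \<Psi> v $$ (i, k) = v $ j)) \<and>
     (\<forall>j<r - 1. \<forall>v\<in>carrier_vec r. partial_mat \<Psi> j v \<noteq> 0\<^sub>m q q)"

definition parameter_set :: "nat \<Rightarrow> (real vec \<Rightarrow> real mat) \<Rightarrow> real vec set" where
  "parameter_set r \<Psi> = {\<psi> \<in> carrier_vec r. psd (\<Psi> \<psi>) \<and> 0 < \<psi> $ (r - 1)}"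

definition Sigma_mat :: "real mat \<Rightarrow> (real vec \<Rightarrow> real mat) \<Rightarrow> real vec \<Rightarrow> real mat" where
  "Sigma_mat Z \<Psi> v = Z * \<Psi> v * Z\<^sup>T + v $ (dim_vec v - 1) \<cdot>\<^sub>m 1\<^sub>m (dim_row Z)"

definition A_mat :: "real mat \<Rightarrow> (real vec \<Rightarrow> real mat) \<Rightarrow> real vec \<Rightarrow> nat \<Rightarrow> real mat" where
  "A_mat Z \<Psi> \<psi> j =
     inv_msqrt (Sigma_mat Z \<Psi> \<psi>) * partial_mat (Sigma_mat Z \<Psi>) j \<psi> * inv_msqrt (Sigma_mat Z \<Psi> \<psi>)"

text \<open>\<open>A(v, \<psi>) = \<Sum>\<^sub>j v\<^sub>j A\<^sub>j(\<psi>)\<close>, summed entrywise because the type of matrices of all sizes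
  is not an additive monoid.\<close>

definition A_comb :: "real mat \<Rightarrow> (real vec \<Rightarrow> real mat) \<Rightarrow> real vec \<Rightarrow> real vec \<Rightarrow> real mat" where
  "A_comb Z \<Psi> v \<psi> = mat (dim_row Z) (dim_row Z)
     (\<lambda>(i, k). \<Sum>j<dim_vec v. v $ j * A_mat Z \<Psi> \<psi> j $$ (i, k))"

definition a_ratio :: "real mat \<Rightarrow> (real vec \<Rightarrow> real mat) \<Rightarrow> real vec \<Rightarrow> real vec \<Rightarrow> real" where
  "a_ratio Z \<Psi> v \<psi> =
     (if 0 < frobenius_norm (A_comb Z \<Psi> v \<psi>)
      then spectral_norm (A_comb Z \<Psi> v \<psi>) / frobenius_norm (A_comb Z \<Psi> v \<psi>) else 1)"

definition std_resid ::
  "real mat \<Rightarrow> real mat \<Rightarrow> (real vec \<Rightarrow> real mat) \<Rightarrow> real vec \<Rightarrow> real vec \<Rightarrow> real vec \<Rightarrow> real vec" where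
  "std_resid X Z \<Psi> \<beta> \<psi> y = inv_msqrt (Sigma_mat Z \<Psi> \<psi>) *\<^sub>v (y - X *\<^sub>v \<beta>)"

text \<open>The gradients of the normal log-likelihood in \<open>\<psi>\<close> and in \<open>\<beta>\<close>, written in terms of the
  standardized residual \<open>R = \<Sigma>\<^sup>-\<^sup>1\<^sup>/\<^sup>2 (y - X \<beta>)\<close>.\<close>

definition score_psi ::
  "real mat \<Rightarrow> real mat \<Rightarrow> (real vec \<Rightarrow> real mat) \<Rightarrow> real vec \<Rightarrow> real vec \<Rightarrow> real vec \<Rightarrow> real vec" where
  "score_psi X Z \<Psi> \<beta> \<psi> y = (let R = std_resid X Z \<Psi> \<beta> \<psi> y in
     vec (dim_vec \<psi>) (\<lambda>j. (R \<bullet> (A_mat Z \<Psi> \<psi> j *\<^sub>v R) - mtrace (A_mat Z \<Psi> \<psi> j)) / 2))"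

definition score_beta ::
  "real mat \<Rightarrow> real mat \<Rightarrow> (real vec \<Rightarrow> real mat) \<Rightarrow> real vec \<Rightarrow> real vec \<Rightarrow> real vec \<Rightarrow> real vec" where
  "score_beta X Z \<Psi> \<beta> \<psi> y =
     X\<^sup>T *\<^sub>v (inv_msqrt (Sigma_mat Z \<Psi> \<psi>) *\<^sub>v std_resid X Z \<Psi> \<beta> \<psi> y)"

definition score ::
  "real mat \<Rightarrow> real mat \<Rightarrow> (real vec \<Rightarrow> real mat) \<Rightarrow> real vec \<Rightarrow> real vec \<Rightarrow> real vec \<Rightarrow> real vec" where
  "score X Z \<Psi> \<beta> \<psi> y = score_beta X Z \<Psi> \<beta> \<psi> y @\<^sub>v score_psi X Z \<Psi> \<beta> \<psi> y"

text \<open>The Fisher information is the covariance of the score under the model. For the variance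
  parameters this is the matrix with entries \<open>tr(A\<^sub>i A\<^sub>j) / 2\<close>, and for \<open>(\<beta>, \<psi>)\<close> it is
  block-diagonal with further block \<open>X\<^sup>T \<Sigma>\<^sup>-\<^sup>1 X\<close>.\<close>

definition fisher_info ::
  "real mat \<Rightarrow> real mat \<Rightarrow> (real vec \<Rightarrow> real mat) \<Rightarrow> real vec \<Rightarrow> real vec \<Rightarrow> real mat" where
  "fisher_info X Z \<Psi> \<beta> \<psi> = cov_mat (mvnormal (X *\<^sub>v \<beta>) (Sigma_mat Z \<Psi> \<psi>))
     (dim_vec \<beta> + dim_vec \<psi>) (score X Z \<Psi> \<beta> \<psi>)"

definition fisher_info_psi ::
  "real mat \<Rightarrow> real mat \<Rightarrow> (real vec \<Rightarrow> real mat) \<Rightarrow> real vec \<Rightarrow> real vec \<Rightarrow> real mat" where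
  "fisher_info_psi X Z \<Psi> \<beta> \<psi> = cov_mat (mvnormal (X *\<^sub>v \<beta>) (Sigma_mat Z \<Psi> \<psi>))
     (dim_vec \<psi>) (score_psi X Z \<Psi> \<beta> \<psi>)"

text \<open>The standardized scores \<open>W\<^sup>S\<close>, meaningful if the information matrix is invertible:
  for unknown \<open>\<beta>\<close>, and for \<open>\<beta>\<close> known to be zero.\<close>

definition std_score ::
  "real mat \<Rightarrow> real mat \<Rightarrow> (real vec \<Rightarrow> real mat) \<Rightarrow> real vec \<Rightarrow> real vec \<Rightarrow> real vec \<Rightarrow> real vec" where
  "std_score X Z \<Psi> \<beta> \<psi> y = inv_msqrt (fisher_info X Z \<Psi> \<beta> \<psi>) *\<^sub>v score X Z \<Psi> \<beta> \<psi> y"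

definition std_score_psi ::
  "real mat \<Rightarrow> real mat \<Rightarrow> (real vec \<Rightarrow> real mat) \<Rightarrow> real vec \<Rightarrow> real vec \<Rightarrow> real vec" where
  "std_score_psi X Z \<Psi> \<psi> y = (let \<beta> = 0\<^sub>v (dim_col X) in
     inv_msqrt (fisher_info_psi X Z \<Psi> \<beta> \<psi>) *\<^sub>v score_psi X Z \<Psi> \<beta> \<psi> y)"

end

theory Submission
  imports Defs
begin

text \<open>The idea is to regard every direction of the standardized score as a single function of a
  standard normal vector. If \<open>Y = X \<beta> + \<Sigma>\<^sup>1\<^sup>/\<^sup>2 g\<close>, the standardized residual is \<open>g\<close> itself, the score
  for \<open>\<beta>\<close> is linear in \<open>g\<close>, and the scores for \<open>\<psi>\<close> are centred quadratic forms in \<open>g\<close>. With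
  \<open>w = I(\<theta>)\<^sup>-\<^sup>1\<^sup>/\<^sup>2 u\<close>, the variable \<open>u \<bullet> W\<close> is the score in the direction \<open>w\<close>, hence
  \<open>T = c \<bullet> g + (g \<bullet> B g - tr B) / 2\<close>, where \<open>B = A(w\<^sub>2, \<psi>)\<close> for the part \<open>w\<^sub>2\<close> of \<open>w\<close> that belongs
  to \<open>\<psi>\<close>. Its variance \<open>|c|\<^sup>2 + |B|\<^sub>F\<^sup>2 / 2\<close> equals \<open>w \<bullet> I(\<theta>) w = 1\<close>. So \<open>|B|\<^sub>F \<le> sqrt 2\<close>, and the
  hypothesis on the ratio of norms makes the spectral norm of \<open>B\<close> at most \<open>sqrt 2\<close> times the bound
  \<open>abar\<close>, which tends to 0.

  It remains to see that such a \<open>T\<close> is nearly normal when the spectral norm of \<open>B\<close> is small. Gaussian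
  integration by parts (\<open>stein_gauss\<close>) shows that the characteristic function of \<open>T\<close> nearly solves
  the differential equation \<open>\<phi>' s = - s \<phi> s\<close>. The error is the fluctuation of a second
  linear-quadratic statistic, whose variance is controlled by the spectral norm of \<open>B\<close>. This yields
  an explicit bound (\<open>char_lin_quad_close_to_normal\<close>) without diagonalizing \<open>B\<close>; the linear part
  of \<open>T\<close> is exactly normal and may sit in a single coordinate. Levy's continuity theorem concludes.

  Two facts from matrix theory are used. The roots in the definitions of the model are
  meaningful because a positive definite matrix has exactly one positive semi-definite square root
  (\<open>psd_square_root_exists\<close>, by a binomial series, and \<open>psd_square_root_unique\<close>). The information
  matrix for \<open>\<psi>\<close> is positive definite as soon as the supremum of the ratios is below 1
  (\<open>A_comb_bounds\<close>), thus for all large \<open>n\<close>; for \<open>(\<beta>, \<psi>)\<close> the full column rank of \<open>X\<close> takes care of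
  the directions in \<open>\<beta>\<close>.\<close>

section \<open>Gaussian integration by parts\<close>

lemma std_normal_density_polynomial_decay:
  "((\<lambda>y. std_normal_density y * (1 + \<bar>y\<bar>) ^ m) \<longlongrightarrow> 0) at_top"
proof -
  have "((\<lambda>y::real. (1 + y) ^ m / exp (1 + y)) \<longlongrightarrow> 0) at_top"
    by (rule filterlim_compose[OF tendsto_power_div_exp_0, of "\<lambda>y. 1 + y"])
       (intro filterlim_tendsto_add_at_top[OF tendsto_const] filterlim_ident)
  then have lim: "((\<lambda>y::real. exp 1 * ((1 + y) ^ m / exp (1 + y))) \<longlongrightarrow> 0) at_top"
    by (intro tendsto_mult_right_zero)
  show ?thesis
  proof (rule real_tendsto_sandwich[OF _ _ tendsto_const lim])
    show "\<forall>\<^sub>F y in at_top. std_normal_density y * (1 + \<bar>y\<bar>) ^ m \<le> exp 1 * ((1 + y) ^ m / exp (1 + y))"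
    proof (rule eventually_mono[OF eventually_ge_at_top[of 2]])
      fix y :: real assume y: "2 \<le> y"
      have "2 * y \<le> y * y" using y by (intro mult_right_mono) auto
      then have e: "exp (- y\<^sup>2 / 2) \<le> exp (- y)" by (simp add: power2_eq_square)
      have "1 / sqrt (2 * pi) \<le> 1 / 1"
        using pi_ge_two by (intro divide_left_mono) auto
      then have "std_normal_density y \<le> 1 * exp (- y)"
        unfolding std_normal_density_def using e by (intro mult_mono) auto
      then have "std_normal_density y * (1 + y) ^ m \<le> exp (- y) * (1 + y) ^ m"
        using y by (intro mult_right_mono) auto
      then show "std_normal_density y * (1 + \<bar>y\<bar>) ^ m \<le> exp 1 * ((1 + y) ^ m / exp (1 + y))"
        using y by (simp add: exp_add exp_minus field_simps)
    qed
  qed simp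
qed

lemma std_normal_density_deriv:
  "(std_normal_density has_real_derivative - y * std_normal_density y) (at y)"
  unfolding std_normal_density_def
  by (auto intro!: derivative_eq_intros simp: power2_eq_square field_simps)

lemma integrable_std_normal_polynomial_growth:
  fixes f :: "real \<Rightarrow> 'b::euclidean_space"
  assumes "f \<in> borel_measurable borel" and bound: "\<And>y. norm (f y) \<le> K * (1 + \<bar>y\<bar>) ^ m"
  shows "integrable std_normal_distribution f"
proof (rule Bochner_Integration.integrable_bound[where f = "\<lambda>y. K * (1 + \<bar>y\<bar>) ^ m"])
  have 1: "integrable std_normal_distribution (\<lambda>y. \<bar>y\<bar> ^ k)" for k
    by (subst integrable_density) (auto simp: integrable_std_normal_moment_abs)
  have "(1 + \<bar>y\<bar>) ^ m = (\<Sum>k\<le>m. of_nat (m choose k) * \<bar>y\<bar> ^ k)" for y :: real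
    using binomial_ring[of "\<bar>y\<bar>" 1 m] by (simp add: add.commute)
  then show "integrable std_normal_distribution (\<lambda>y. K * (1 + \<bar>y\<bar>) ^ m)"
    using 1 by simp
  show "AE x in std_normal_distribution. norm (f x) \<le> norm (K * (1 + \<bar>x\<bar>) ^ m)"
    using bound by (auto intro: order_trans[OF _ abs_ge_self])
qed (use assms in simp)

text \<open>Stein's identity on the line. The density \<open>\<phi>\<close> satisfies \<open>\<phi>' y = - y \<phi> y\<close>, so the
  difference of the two integrands times \<open>\<phi>\<close> is the derivative of \<open>\<phi> f\<close>, which vanishes at both
  ends because \<open>f\<close> grows at most polynomially.\<close>

lemma stein_real:
  fixes f f' :: "real \<Rightarrow> 'b::euclidean_space"
  assumes f: "\<And>y. (f has_vector_derivative f' y) (at y)"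
    and cont: "\<And>y. isCont f' y"
    and bound: "\<And>y. norm (f y) \<le> K * (1 + \<bar>y\<bar>) ^ m"
    and bound': "\<And>y. norm (f' y) \<le> K' * (1 + \<bar>y\<bar>) ^ m'"
  shows "(\<integral>y. y *\<^sub>R f y \<partial>std_normal_distribution) = (\<integral>y. f' y \<partial>std_normal_distribution)"
proof -
  let ?\<phi> = std_normal_density
  have fc: "continuous_on UNIV f"
    by (meson continuous_at_imp_continuous_on f has_vector_derivative_continuous)
  have f'c: "continuous_on UNIV f'" using cont by (simp add: continuous_at_imp_continuous_on)
  have [measurable]: "f \<in> borel_measurable borel" "f' \<in> borel_measurable borel"
    using fc f'c by (auto intro: borel_measurable_continuous_onI)
  have i1: "integrable std_normal_distribution f'"
    by (rule integrable_std_normal_polynomial_growth[OF _ bound']) simp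
  have i2: "integrable std_normal_distribution (\<lambda>y. y *\<^sub>R f y)"
  proof (rule integrable_std_normal_polynomial_growth)
    fix y
    have "\<bar>y\<bar> * norm (f y) \<le> (1 + \<bar>y\<bar>) * (K * (1 + \<bar>y\<bar>) ^ m)"
      using bound by (intro mult_mono) auto
    then show "norm (y *\<^sub>R f y) \<le> K * (1 + \<bar>y\<bar>) ^ Suc m" by (simp add: ac_simps)
  qed simp
  have j1: "integrable lborel (\<lambda>y. ?\<phi> y *\<^sub>R f' y)"
    using i1 by (subst (asm) integrable_density) auto
  have j2: "integrable lborel (\<lambda>y. ?\<phi> y *\<^sub>R (y *\<^sub>R f y))"
    using i2 by (subst (asm) integrable_density) auto
  let ?F = "\<lambda>y. ?\<phi> y *\<^sub>R f y"
  let ?D = "\<lambda>y. ?\<phi> y *\<^sub>R f' y - ?\<phi> y *\<^sub>R (y *\<^sub>R f y)"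
  have lim: "(?F \<longlongrightarrow> 0) at_top"
  proof (rule tendsto_norm_zero_cancel, rule real_tendsto_sandwich[OF _ _ tendsto_const])
    show "((\<lambda>y. K * (?\<phi> y * (1 + \<bar>y\<bar>) ^ m)) \<longlongrightarrow> 0) at_top"
      by (intro tendsto_mult_right_zero std_normal_density_polynomial_decay)
    show "\<forall>\<^sub>F y in at_top. norm (?F y) \<le> K * (?\<phi> y * (1 + \<bar>y\<bar>) ^ m)"
    proof (intro always_eventually allI)
      fix y
      show "norm (?F y) \<le> K * (?\<phi> y * (1 + \<bar>y\<bar>) ^ m)"
        using mult_left_mono[OF bound[of y], of "?\<phi> y"] by (simp add: ac_simps)
    qed
  qed simp
  have lim': "(?F \<longlongrightarrow> 0) at_bot"
    unfolding filterlim_at_bot_mirror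
  proof (rule tendsto_norm_zero_cancel, rule real_tendsto_sandwich[OF _ _ tendsto_const])
    show "((\<lambda>y. K * (?\<phi> y * (1 + \<bar>y\<bar>) ^ m)) \<longlongrightarrow> 0) at_top"
      by (intro tendsto_mult_right_zero std_normal_density_polynomial_decay)
    show "\<forall>\<^sub>F y in at_top. norm (?F (- y)) \<le> K * (?\<phi> y * (1 + \<bar>y\<bar>) ^ m)"
    proof (intro always_eventually allI)
      fix y
      show "norm (?F (- y)) \<le> K * (?\<phi> y * (1 + \<bar>y\<bar>) ^ m)"
        using mult_left_mono[OF bound[of "- y"], of "?\<phi> y"]
        by (simp add: ac_simps std_normal_density_def)
    qed
  qed simp
  have "(LBINT x=-\<infinity>..\<infinity>. ?D x) = 0 - 0"
  proof (rule interval_integral_FTC_integrable)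
    fix x
    have "(?F has_vector_derivative ?\<phi> x *\<^sub>R f' x + (- x * ?\<phi> x) *\<^sub>R f x) (at x)"
      by (rule has_vector_derivative_scaleR[OF std_normal_density_deriv f])
    then show "(?F has_vector_derivative ?D x) (at x)" by (simp add: mult.commute)
    have "isCont ?\<phi> x" using std_normal_density_deriv DERIV_isCont by blast
    then show "isCont ?D x"
      using cont[of x] fc by (intro continuous_intros) (auto simp: continuous_on_eq_continuous_at)
  next
    show "set_integrable lborel (einterval (- \<infinity>) \<infinity>) ?D"
      using j1 j2 by (simp add: set_integrable_def)
    show "((?F \<circ> real_of_ereal) \<longlongrightarrow> 0) (at_right (- \<infinity>))"
      using lim' by (simp add: ereal_tendsto_simps)
    show "((?F \<circ> real_of_ereal) \<longlongrightarrow> 0) (at_left \<infinity>)"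
      using lim by (simp add: ereal_tendsto_simps)
  qed simp
  then have "(\<integral>y. ?D y \<partial>lborel) = 0"
    by (simp add: interval_lebesgue_integral_def set_lebesgue_integral_def)
  then have "(\<integral>y. ?\<phi> y *\<^sub>R f' y \<partial>lborel) = (\<integral>y. ?\<phi> y *\<^sub>R (y *\<^sub>R f y) \<partial>lborel)"
    using j1 j2 by simp
  then show ?thesis by (subst (1 2) integral_density) auto
qed

definition gauss :: "nat \<Rightarrow> (nat \<Rightarrow> real) measure" where
  "gauss d = (\<Pi>\<^sub>M i\<in>{..<d}. std_normal_distribution)"

text \<open>Measurable functions of polynomial growth, the class in which all expectations below live.
  Measuring the growth by a product over the coordinates makes the bound separate in each of
  them: with the other coordinates frozen it is a polynomial bound in one variable, and by
  independence it is integrable.\<close>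

definition tame :: "nat \<Rightarrow> ((nat \<Rightarrow> real) \<Rightarrow> 'b::euclidean_space) \<Rightarrow> bool" where
  "tame d F \<longleftrightarrow> F \<in> borel_measurable (gauss d) \<and>
     (\<exists>K m. \<forall>x. norm (F x) \<le> K * (\<Prod>i<d. 1 + \<bar>x i\<bar>) ^ m)"

lemma product_prob_space_std_normal: "product_prob_space (\<lambda>i. std_normal_distribution)"
  by (intro product_prob_spaceI prob_space_normal_density) simp

lemma prob_space_gauss: "prob_space (gauss d)"
  unfolding gauss_def by (intro prob_space_PiM prob_space_normal_density) simp

lemma measurable_gauss_component [measurable]:
  "i < d \<Longrightarrow> (\<lambda>x. x i) \<in> borel_measurable (gauss d)"
proof -
  assume "i < d"
  then have "(\<lambda>x. x i) \<in> gauss d \<rightarrow>\<^sub>M std_normal_distribution"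
    unfolding gauss_def by (intro measurable_component_singleton) auto
  then show ?thesis by simp
qed

lemma one_le_growth: "1 \<le> (\<Prod>i<d. 1 + \<bar>x i :: real\<bar>)"
  by (rule prod_ge_1) auto

lemma tameE:
  assumes "tame d F"
  obtains K m where "F \<in> borel_measurable (gauss d)" "0 \<le> K"
    "\<And>x. norm (F x) \<le> K * (\<Prod>i<d. 1 + \<bar>x i\<bar>) ^ m"
proof -
  obtain K m where K: "\<And>x. norm (F x) \<le> K * (\<Prod>i<d. 1 + \<bar>x i\<bar>) ^ m"
    using assms unfolding tame_def by blast
  have "0 \<le> K" using order_trans[OF norm_ge_zero K[of "\<lambda>_. 0"]] by simp
  with K assms show thesis by (intro that) (auto simp: tame_def)
qed

lemma tame_bounded:
  assumes "F \<in> borel_measurable (gauss d)" "\<And>x. norm (F x) \<le> K"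
  shows "tame d F"
  unfolding tame_def using assms by (intro conjI exI[of _ K] exI[of _ 0]) auto

lemma tame_const [intro!]: "tame d (\<lambda>_. c)"
  by (rule tame_bounded[of _ _ "norm c"]) auto

lemma tame_component [intro]:
  assumes "i < d" shows "tame d (\<lambda>x. x i)"
  unfolding tame_def
proof (intro conjI exI allI)
  fix x :: "nat \<Rightarrow> real"
  have "\<bar>x i\<bar> \<le> 1 + \<bar>x i\<bar>" by simp
  also have "\<dots> \<le> (1 + \<bar>x i\<bar>) * (\<Prod>j\<in>{..<d} - {i}. 1 + \<bar>x j\<bar>)"
    by (intro mult_le_cancel_left1[THEN iffD2]) (auto intro!: prod_ge_1)
  also have "\<dots> = (\<Prod>i<d. 1 + \<bar>x i\<bar>)"
    using assms by (subst prod.remove[of "{..<d}" i]) auto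
  finally show "norm (x i) \<le> 1 * (\<Prod>i<d. 1 + \<bar>x i\<bar>) ^ 1" by simp
qed (use assms in measurable)

lemma tame_add [intro!]:
  assumes "tame d F" "tame d G"
  shows "tame d (\<lambda>x. F x + G x)"
proof -
  obtain K m where F: "F \<in> borel_measurable (gauss d)" "0 \<le> K"
    "\<And>x. norm (F x) \<le> K * (\<Prod>i<d. 1 + \<bar>x i\<bar>) ^ m" using assms(1) by (rule tameE) blast
  obtain K' m' where G: "G \<in> borel_measurable (gauss d)" "0 \<le> K'"
    "\<And>x. norm (G x) \<le> K' * (\<Prod>i<d. 1 + \<bar>x i\<bar>) ^ m'" using assms(2) by (rule tameE) blast
  have "norm (F x + G x) \<le> (K + K') * (\<Prod>i<d. 1 + \<bar>x i\<bar>) ^ (m + m')" for x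
  proof -
    let ?p = "\<Prod>i<d. 1 + \<bar>x i\<bar>"
    have "norm (F x + G x) \<le> K * ?p ^ m + K' * ?p ^ m'"
      using F(3)[of x] G(3)[of x] norm_triangle_ineq[of "F x" "G x"] by linarith
    also have "\<dots> \<le> K * ?p ^ (m + m') + K' * ?p ^ (m + m')"
      using F(2) G(2) one_le_growth[where x=x and d=d]
      by (intro add_mono mult_left_mono power_increasing) auto
    finally show ?thesis by (simp add: distrib_right)
  qed
  then show ?thesis unfolding tame_def using F(1) G(1) by auto
qed

lemma tame_scaleR [intro!]:
  assumes "tame d f" "tame d G"
  shows "tame d (\<lambda>x. f x *\<^sub>R G x)"
proof -
  obtain K m where F: "f \<in> borel_measurable (gauss d)" "0 \<le> K"
    "\<And>x. norm (f x) \<le> K * (\<Prod>i<d. 1 + \<bar>x i\<bar>) ^ m" using assms(1) by (rule tameE) blast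
  obtain K' m' where G: "G \<in> borel_measurable (gauss d)" "0 \<le> K'"
    "\<And>x. norm (G x) \<le> K' * (\<Prod>i<d. 1 + \<bar>x i\<bar>) ^ m'" using assms(2) by (rule tameE) blast
  have "norm (f x *\<^sub>R G x) \<le> (K * K') * (\<Prod>i<d. 1 + \<bar>x i\<bar>) ^ (m + m')" for x
    using mult_mono[OF F(3)[of x] G(3)[of x]] one_le_growth[where x=x and d=d] F(2)
    by (auto simp: power_add ac_simps)
  then show ?thesis unfolding tame_def using F(1) G(1) by auto
qed

lemma tame_mult [intro!]:
  fixes f g :: "(nat \<Rightarrow> real) \<Rightarrow> real"
  shows "tame d f \<Longrightarrow> tame d g \<Longrightarrow> tame d (\<lambda>x. f x * g x)"
  using tame_scaleR[of d f g] by simp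

lemma tame_diff [intro!]:
  "tame d F \<Longrightarrow> tame d G \<Longrightarrow> tame d (\<lambda>x. F x - G x)"
  using tame_add[OF _ tame_scaleR[OF tame_const[of d "-1"]], of F G] by simp

lemma tame_sum [intro!]:
  assumes "\<And>i. i \<in> I \<Longrightarrow> tame d (F i)" shows "tame d (\<lambda>x. \<Sum>i\<in>I. F i x)"
proof (cases "finite I")
  case True
  then show ?thesis using assms by (induction rule: finite_induct) auto
qed auto

lemma integrable_tame:
  assumes "tame d F" shows "integrable (gauss d) F"
proof -
  obtain K m where F: "F \<in> borel_measurable (gauss d)" "0 \<le> K"
    "\<And>x. norm (F x) \<le> K * (\<Prod>i<d. 1 + \<bar>x i\<bar>) ^ m" using assms by (rule tameE) blast
  interpret product_prob_space "\<lambda>i::nat. std_normal_distribution" UNIV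
    by (rule product_prob_space_std_normal)
  have *: "integrable std_normal_distribution (\<lambda>y. (1 + \<bar>y\<bar>) ^ m)"
    by (rule integrable_std_normal_polynomial_growth[of _ 1 m]) auto
  have "integrable (gauss d) (\<lambda>x. K * (\<Prod>i<d. (1 + \<bar>x i\<bar>) ^ m))"
    unfolding gauss_def by (intro integrable_mult_right product_integrable_prod *) auto
  then show ?thesis
    by (rule Bochner_Integration.integrable_bound)
       (use F in \<open>auto simp: prod_power_distrib intro!: AE_I2 intro: order_trans[OF _ abs_ge_self]\<close>)
qed

text \<open>Integrating first over the coordinate \<open>x k\<close>, with the others frozen, reduces this to the
  identity on the line.\<close>

lemma stein_gauss:
  fixes F G :: "(nat \<Rightarrow> real) \<Rightarrow> 'b::euclidean_space"
  assumes k: "k < d" and F: "tame d F" and G: "tame d G"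
    and deriv: "\<And>x y. ((\<lambda>y. F (x(k := y))) has_vector_derivative G (x(k := y))) (at y)"
    and cont: "\<And>x y. isCont (\<lambda>y. G (x(k := y))) y"
  shows "(\<integral>x. x k *\<^sub>R F x \<partial>gauss d) = (\<integral>x. G x \<partial>gauss d)"
proof -
  interpret product_prob_space "\<lambda>i::nat. std_normal_distribution" UNIV
    by (rule product_prob_space_std_normal)
  let ?I = "{..<d} - {k}"
  have I: "{..<d} = insert k ?I" using k by auto
  obtain K m where F': "0 \<le> K"
    "\<And>x. norm (F x) \<le> K * (\<Prod>i<d. 1 + \<bar>x i\<bar>) ^ m" using F by (rule tameE) blast
  obtain K' m' where G': "0 \<le> K'"
    "\<And>x. norm (G x) \<le> K' * (\<Prod>i<d. 1 + \<bar>x i\<bar>) ^ m'" using G by (rule tameE) blast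
  have prod: "(\<Prod>i<d. 1 + \<bar>(x(k := y)) i\<bar>) = (\<Prod>i\<in>?I. 1 + \<bar>x i\<bar>) * (1 + \<bar>y\<bar>)"
    for x and y :: real
    by (subst I, subst prod.insert) (auto intro!: prod.cong simp: mult.commute)
  have split: "(\<integral>x. H x \<partial>gauss d) =
      (\<integral>x. \<integral>y. H (x(k := y)) \<partial>std_normal_distribution \<partial>(\<Pi>\<^sub>M i\<in>?I. std_normal_distribution))"
    if "tame d H" for H :: "(nat \<Rightarrow> real) \<Rightarrow> 'b"
    using product_integral_insert[of ?I k H] integrable_tame[OF that]
    unfolding gauss_def I[symmetric] by auto
  have "(\<integral>y. (x(k := y)) k *\<^sub>R F (x(k := y)) \<partial>std_normal_distribution) =
      (\<integral>y. G (x(k := y)) \<partial>std_normal_distribution)" for x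
    using stein_real[OF deriv[where x=x] cont[where x=x], of "K * (\<Prod>i\<in>?I. 1 + \<bar>x i\<bar>) ^ m" m
        "K' * (\<Prod>i\<in>?I. 1 + \<bar>x i\<bar>) ^ m'" m'] F'(2)[of "x(k := y)" for y] G'(2)[of "x(k := y)" for y]
    unfolding prod by (simp add: power_mult_distrib ac_simps)
  then show ?thesis
    using k F G by (subst (1 2) split) auto
qed

section \<open>Linear-quadratic statistics of a Gaussian vector\<close>

text \<open>Linear-quadratic statistics, centred by the trace. Seen as a function of the standardized
  residual, every linear combination of scores has this form, with \<open>c\<close> coming from the
  regression coefficients and \<open>B\<close> from the variance parameters.\<close>

definition lin_quad :: "nat \<Rightarrow> (nat \<Rightarrow> real) \<Rightarrow> (nat \<Rightarrow> nat \<Rightarrow> real) \<Rightarrow> (nat \<Rightarrow> real) \<Rightarrow> real" where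
  "lin_quad d c B x =
     (\<Sum>i<d. c i * x i) + ((\<Sum>i<d. \<Sum>j<d. B i j * x i * x j) - (\<Sum>i<d. B i i)) / 2"

lemma has_real_derivative_component:
  "((\<lambda>y. (x(k := y)) i) has_real_derivative of_bool (i = k)) (at (y::real))"
  by (cases "i = k") auto

lemma isCont_component: "isCont (\<lambda>y. (x(k := y)) i) (y::real)"
  using DERIV_isCont[OF has_real_derivative_component[of x k i y]] .

lemma tame_lin_quad [intro!]: "tame d (lin_quad d c B)"
proof -
  have "tame d (\<lambda>x. (\<Sum>i<d. c i * x i) + 1 / 2 * ((\<Sum>i<d. \<Sum>j<d. B i j * x i * x j) - (\<Sum>i<d. B i i)))"
    by (intro tame_add tame_mult tame_sum tame_diff tame_const tame_component) auto
  then show ?thesis by (simp add: lin_quad_def[abs_def])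
qed

lemma lin_quad_deriv:
  assumes k: "k < d" and sym: "\<And>i j. i < d \<Longrightarrow> j < d \<Longrightarrow> B i j = B j i"
  shows "((\<lambda>y. lin_quad d c B (x(k := y))) has_real_derivative
     c k + (\<Sum>j<d. B k j * (x(k := y)) j)) (at y)"
proof -
  let ?x = "x(k := y)"
  have "((\<lambda>y. lin_quad d c B (x(k := y))) has_real_derivative
     (\<Sum>i<d. c i * of_bool (i = k)) +
     (\<Sum>i<d. \<Sum>j<d. B i j * of_bool (i = k) * ?x j + B i j * ?x i * of_bool (j = k)) / 2) (at y)"
    unfolding lin_quad_def
    by (rule derivative_eq_intros has_real_derivative_component refl
          | simp add: algebra_simps del: fun_upd_apply)+
  moreover have "(\<Sum>i<d. c i * of_bool (i = k)) = c k"
    using k by (simp add: of_bool_def if_distrib[of "\<lambda>z. _ * z"] sum.delta cong: if_cong)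
  moreover have "(\<Sum>i<d. \<Sum>j<d. B i j * of_bool (i = k) * ?x j) = (\<Sum>j<d. B k j * ?x j)"
    using k by (subst sum.swap)
      (simp add: of_bool_def if_distrib[of "\<lambda>z. _ * z"] if_distrib[of "\<lambda>z. z * _"] sum.delta
        del: fun_upd_apply cong: if_cong)
  moreover have "(\<Sum>i<d. \<Sum>j<d. B i j * ?x i * of_bool (j = k)) = (\<Sum>j<d. B k j * ?x j)"
    using k sym by (simp add: of_bool_def if_distrib[of "\<lambda>z. _ * z"] sum.delta
        del: fun_upd_apply cong: if_cong)
  ultimately show ?thesis by (simp add: sum.distrib del: fun_upd_apply)
qed

lemma tame_grad [intro!]: "k < d \<Longrightarrow> tame d (\<lambda>x. c k + (\<Sum>j<d. B k j * x j))"
  by (intro tame_add tame_mult tame_sum tame_const tame_component) auto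

lemma tame_half_grad [intro!]: "k < d \<Longrightarrow> tame d (\<lambda>x. c k + (\<Sum>j<d. B k j * x j) / 2)"
  using tame_grad[of k d c "\<lambda>k j. B k j / 2"] by (simp add: sum_divide_distrib)

text \<open>The statistic is \<open>\<Sum>k. x k * a\<^sub>k x - tr B / 2\<close> with \<open>a\<^sub>k x = c k + (B x)\<^sub>k / 2\<close>. Integrating
  each summand by parts, the derivative of \<open>a\<^sub>k\<close> yields \<open>B k k / 2\<close>, and these terms cancel the
  centring.\<close>

lemma lin_quad_stein:
  fixes F :: "(nat \<Rightarrow> real) \<Rightarrow> 'b::euclidean_space"
  assumes F: "tame d F" and G: "\<And>k. k < d \<Longrightarrow> tame d (G k)"
    and deriv: "\<And>k x y. k < d \<Longrightarrow> ((\<lambda>y. F (x(k := y))) has_vector_derivative G k (x(k := y))) (at y)"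
    and cont: "\<And>k x y. k < d \<Longrightarrow> isCont (\<lambda>y. G k (x(k := y))) y"
  shows "(\<integral>x. lin_quad d c B x *\<^sub>R F x \<partial>gauss d) =
     (\<integral>x. (\<Sum>k<d. (c k + (\<Sum>j<d. B k j * x j) / 2) *\<^sub>R G k x) \<partial>gauss d)"
proof -
  let ?a = "\<lambda>k x. c k + (\<Sum>j<d. B k j * x j) / 2"
  have 1: "(\<integral>x. x k *\<^sub>R (?a k x *\<^sub>R F x) \<partial>gauss d) =
      (\<integral>x. (?a k x *\<^sub>R G k x + (B k k / 2) *\<^sub>R F x) \<partial>gauss d)" if k: "k < d" for k
  proof (rule stein_gauss[OF k])
    fix x y
    have "((\<lambda>y. ?a k (x(k := y))) has_real_derivative (\<Sum>j<d. B k j * of_bool (j = k)) / 2) (at y)"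
      by (rule derivative_eq_intros has_real_derivative_component refl
          | simp add: algebra_simps del: fun_upd_apply)+
    then have a: "((\<lambda>y. ?a k (x(k := y))) has_real_derivative B k k / 2) (at y)"
      using k by (simp add: of_bool_def if_distrib[of "\<lambda>z. _ * z"] sum.delta cong: if_cong)
    show "((\<lambda>y. ?a k (x(k := y)) *\<^sub>R F (x(k := y))) has_vector_derivative
       ?a k (x(k := y)) *\<^sub>R G k (x(k := y)) + (B k k / 2) *\<^sub>R F (x(k := y))) (at y)"
      by (rule has_vector_derivative_scaleR[OF a deriv[OF k]])
    have "isCont (\<lambda>y. F (x(k := y))) y"
      using deriv[OF k] has_vector_derivative_continuous by blast
    then show "isCont (\<lambda>y. ?a k (x(k := y)) *\<^sub>R G k (x(k := y)) + (B k k / 2) *\<^sub>R F (x(k := y))) y"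
      using DERIV_isCont[OF a] cont[OF k]
      by (intro continuous_intros isCont_component) auto
  qed (use F G k in auto)
  have "lin_quad d c B x *\<^sub>R F x =
     (\<Sum>k<d. x k *\<^sub>R (?a k x *\<^sub>R F x) - (B k k / 2) *\<^sub>R F x)" for x
  proof -
    have "lin_quad d c B x = (\<Sum>k<d. x k * ?a k x - B k k / 2)"
      unfolding lin_quad_def
      by (simp add: sum.distrib sum_subtractf distrib_left sum_distrib_left sum_divide_distrib
        diff_divide_distrib ac_simps)
    then show ?thesis by (simp add: scaleR_sum_left scaleR_diff_left)
  qed
  then have "(\<integral>x. lin_quad d c B x *\<^sub>R F x \<partial>gauss d) =
     (\<integral>x. (\<Sum>k<d. x k *\<^sub>R (?a k x *\<^sub>R F x) - (B k k / 2) *\<^sub>R F x) \<partial>gauss d)" by simp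
  also have "\<dots> = (\<Sum>k<d. (\<integral>x. x k *\<^sub>R (?a k x *\<^sub>R F x) \<partial>gauss d) - (\<integral>x. (B k k / 2) *\<^sub>R F x \<partial>gauss d))"
    using F by (subst Bochner_Integration.integral_sum)
      (auto intro!: integrable_tame sum.cong Bochner_Integration.integral_diff
        Bochner_Integration.integrable_diff simp del: integral_scaleR_right)
  also have "\<dots> = (\<Sum>k<d. (\<integral>x. ?a k x *\<^sub>R G k x \<partial>gauss d))"
  proof (intro sum.cong refl)
    fix k assume "k \<in> {..<d}"
    then have k: "k < d" by simp
    show "(\<integral>x. x k *\<^sub>R (?a k x *\<^sub>R F x) \<partial>gauss d) - (\<integral>x. (B k k / 2) *\<^sub>R F x \<partial>gauss d) =
      (\<integral>x. ?a k x *\<^sub>R G k x \<partial>gauss d)"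
      unfolding 1[OF k] using F G k
      by (subst Bochner_Integration.integral_add)
         (auto intro!: integrable_tame simp del: integral_scaleR_right)
  qed
  also have "\<dots> = (\<integral>x. (\<Sum>k<d. ?a k x *\<^sub>R G k x) \<partial>gauss d)"
    using G by (subst Bochner_Integration.integral_sum) (auto intro!: integrable_tame)
  finally show ?thesis .
qed

lemma gauss_mean_component: "j < d \<Longrightarrow> (\<integral>x. x j \<partial>gauss d) = 0"
  using stein_gauss[of j d "\<lambda>_. 1::real" "\<lambda>_. 0"] by auto

lemma gauss_cov_component:
  assumes "i < d" "j < d" shows "(\<integral>x. x i * x j \<partial>gauss d) = of_bool (j = i)"
proof -
  interpret prob_space "gauss d" by (rule prob_space_gauss)
  have "(\<integral>x. x i *\<^sub>R x j \<partial>gauss d) = (\<integral>x. of_bool (j = i) \<partial>gauss d)"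
  proof (rule stein_gauss)
    show "((\<lambda>y. (x(i := y)) j) has_vector_derivative of_bool (j = i)) (at y)" for x :: "nat \<Rightarrow> real" and y
      using has_real_derivative_component[of x i j y]
      by (simp only: has_real_derivative_iff_has_vector_derivative)
  qed (use assms in auto)
  then show ?thesis by (simp add: prob_space)
qed

lemma lin_quad_mean: "(\<integral>x. lin_quad d c B x \<partial>gauss d) = 0"
  using lin_quad_stein[of d "\<lambda>_. 1::real" "\<lambda>_ _. 0" c B] by auto

text \<open>Apply the previous identity to the statistic itself, whose gradient is \<open>c + B x\<close>: only
  second moments of the coordinates remain, although the statistic squared has degree four.\<close>

lemma lin_quad_second_moment:
  assumes sym: "\<And>i j. i < d \<Longrightarrow> j < d \<Longrightarrow> B i j = B j i"
  shows "(\<integral>x. (lin_quad d c B x)\<^sup>2 \<partial>gauss d) = (\<Sum>i<d. (c i)\<^sup>2) + (\<Sum>i<d. \<Sum>j<d. (B i j)\<^sup>2) / 2"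
proof -
  interpret prob_space "gauss d" by (rule prob_space_gauss)
  let ?a = "\<lambda>k x. c k + (\<Sum>j<d. B k j * x j) / 2"
  let ?g = "\<lambda>k x. c k + (\<Sum>j<d. B k j * x j)"
  have *: "(\<integral>x. ?a k x * ?g k x \<partial>gauss d) = (c k)\<^sup>2 + (\<Sum>j<d. (B k j)\<^sup>2) / 2" if k: "k < d" for k
  proof -
    have "?a k x * ?g k x = (c k)\<^sup>2 + (\<Sum>j<d. 3 / 2 * c k * B k j * x j) +
        (\<Sum>i<d. \<Sum>j<d. B k i * B k j / 2 * (x i * x j))" for x
    proof -
      have "(u + s / 2) * (u + s) = u\<^sup>2 + 3 / 2 * u * s + s * s / 2" for u s :: real
        by (simp add: power2_eq_square field_simps)
      then have "?a k x * ?g k x = (c k)\<^sup>2 + 3 / 2 * c k * (\<Sum>j<d. B k j * x j) +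
        (\<Sum>i<d. B k i * x i) * (\<Sum>j<d. B k j * x j) / 2" .
      then show ?thesis unfolding sum_product by (simp add: sum_distrib_left sum_divide_distrib ac_simps)
    qed
    then have "(\<integral>x. ?a k x * ?g k x \<partial>gauss d) = (\<integral>x. (c k)\<^sup>2 + (\<Sum>j<d. 3 / 2 * c k * B k j * x j) +
        (\<Sum>i<d. \<Sum>j<d. B k i * B k j / 2 * (x i * x j)) \<partial>gauss d)" by simp
    also have "\<dots> = (c k)\<^sup>2 + (\<Sum>j<d. 3 / 2 * c k * B k j * (\<integral>x. x j \<partial>gauss d)) +
        (\<Sum>i<d. \<Sum>j<d. B k i * B k j / 2 * (\<integral>x. x i * x j \<partial>gauss d))"
    proof -
      let ?p = "\<lambda>j x. 3 / 2 * c k * B k j * x j" and ?q = "\<lambda>i j x. B k i * B k j / 2 * (x i * x j)"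
      have i1: "integrable (gauss d) (?p j)" if "j < d" for j
        using that by (intro integrable_tame tame_mult tame_const tame_component)
      have i2: "integrable (gauss d) (?q i j)" if "i < d" "j < d" for i j
        using that by (intro integrable_tame tame_mult tame_const tame_component)
      have p: "(\<integral>x. (\<Sum>j<d. ?p j x) \<partial>gauss d) = (\<Sum>j<d. \<integral>x. ?p j x \<partial>gauss d)"
        using i1 by (intro Bochner_Integration.integral_sum) auto
      have q: "(\<integral>x. (\<Sum>i<d. \<Sum>j<d. ?q i j x) \<partial>gauss d) = (\<Sum>i<d. \<Sum>j<d. \<integral>x. ?q i j x \<partial>gauss d)"
        using i2 by (subst Bochner_Integration.integral_sum)
          (auto intro!: Bochner_Integration.integrable_sum Bochner_Integration.integral_sum sum.cong
            simp del: integral_mult_right_zero integrable_mult_right_iff)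
      have "integrable (gauss d) (\<lambda>x. \<Sum>j<d. ?p j x)" "integrable (gauss d) (\<lambda>x. \<Sum>i<d. \<Sum>j<d. ?q i j x)"
        by (intro integrable_tame tame_sum tame_mult tame_const tame_component; simp)+
      then have "(\<integral>x. (c k)\<^sup>2 + (\<Sum>j<d. ?p j x) + (\<Sum>i<d. \<Sum>j<d. ?q i j x) \<partial>gauss d) =
          (c k)\<^sup>2 + (\<integral>x. (\<Sum>j<d. ?p j x) \<partial>gauss d) + (\<integral>x. (\<Sum>i<d. \<Sum>j<d. ?q i j x) \<partial>gauss d)"
        by (simp add: prob_space)
      then show ?thesis unfolding p q integral_mult_right_zero .
    qed
    also have "\<dots> = (c k)\<^sup>2 + (\<Sum>i<d. \<Sum>j<d. B k i * B k j / 2 * of_bool (j = i))"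
      by (simp add: gauss_mean_component gauss_cov_component)
    also have "\<dots> = (c k)\<^sup>2 + (\<Sum>j<d. (B k j)\<^sup>2) / 2"
      by (simp add: of_bool_def if_distrib[of "\<lambda>z. _ * z"] sum.delta power2_eq_square
          sum_divide_distrib cong: if_cong)
    finally show ?thesis .
  qed
  have "(\<integral>x. lin_quad d c B x *\<^sub>R lin_quad d c B x \<partial>gauss d) = (\<integral>x. (\<Sum>k<d. ?a k x *\<^sub>R ?g k x) \<partial>gauss d)"
  proof (rule lin_quad_stein)
    fix k x y assume k: "k < d"
    show "((\<lambda>y. lin_quad d c B (x(k := y))) has_vector_derivative ?g k (x(k := y))) (at y)"
      using lin_quad_deriv[OF k sym] by (simp add: has_real_derivative_iff_has_vector_derivative)
    show "isCont (\<lambda>y. ?g k (x(k := y))) y"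
      by (intro continuous_intros isCont_component)
  qed auto
  also have "\<dots> = (\<Sum>k<d. \<integral>x. ?a k x * ?g k x \<partial>gauss d)"
    unfolding real_scaleR_def by (intro Bochner_Integration.integral_sum integrable_tame tame_mult) auto
  also have "\<dots> = (\<Sum>i<d. (c i)\<^sup>2) + (\<Sum>i<d. \<Sum>j<d. (B i j)\<^sup>2) / 2"
    using * by (simp add: sum.distrib sum_divide_distrib)
  finally show ?thesis by (simp add: power2_eq_square)
qed

lemma norm_integral_tame_le:
  assumes "tame d F" "tame d g" "\<And>x. norm (F x) \<le> g x"
  shows "norm (\<integral>x. F x \<partial>gauss d) \<le> (\<integral>x. g x \<partial>gauss d)"
  using assms
  by (intro order_trans[OF integral_norm_bound] integral_mono integrable_norm integrable_tame)

lemma has_vector_derivative_quadratic_remainder: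
  fixes f :: "real \<Rightarrow> 'a::real_normed_vector"
  assumes "\<And>s. norm (f s - f t - (s - t) *\<^sub>R D) \<le> C * (s - t)\<^sup>2"
  shows "(f has_vector_derivative D) (at t)"
  unfolding has_vector_derivative_def has_derivative_at
proof (intro conjI bounded_linear_scaleR_left)
  show "(\<lambda>h. norm (f (t + h) - f t - h *\<^sub>R D) / norm h) \<midarrow>0\<rightarrow> 0"
  proof (rule real_tendsto_sandwich[OF _ _ tendsto_const])
    show "\<forall>\<^sub>F h in at 0. norm (f (t + h) - f t - h *\<^sub>R D) / norm h \<le> C * \<bar>h\<bar>"
    proof (intro eventually_at_topological[THEN iffD2] exI[of _ UNIV] conjI ballI impI)
      fix h :: real assume "h \<noteq> 0"
      moreover have "\<bar>h\<bar> * \<bar>h\<bar> = h\<^sup>2" by (simp add: power2_eq_square flip: abs_mult)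
      ultimately show "norm (f (t + h) - f t - h *\<^sub>R D) / norm h \<le> C * \<bar>h\<bar>"
        using assms[of "t + h"] by (simp add: divide_simps ac_simps)
    qed auto
    show "((\<lambda>h. C * \<bar>h\<bar>) \<longlongrightarrow> 0) (at 0)"
      by (auto intro!: tendsto_eq_intros)
  qed simp
qed

text \<open>A quantitative central limit theorem. If \<open>T\<close> is the statistic and \<open>\<phi>\<close> its characteristic
  function, integration by parts gives \<open>\<phi>' s = - s E[Q exp (\<i> s T)]\<close>, where
  \<open>Q x = (c + B x / 2) \<bullet> (c + B x)\<close> has mean equal to the variance of \<open>T\<close>, here 1. Were \<open>Q\<close>
  constant, this would be the differential equation of the normal characteristic function. Now
  \<open>Q - 1\<close> is again a linear-quadratic statistic, with coefficients \<open>3/2 B c\<close> and \<open>B\<^sup>2\<close>, so that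
  its standard deviation is at most \<open>3/2 \<epsilon>\<close>, and the equation is nearly satisfied.\<close>

theorem char_lin_quad_close_to_normal:
  fixes \<epsilon> :: real
  assumes sym: "\<And>i j. i < d \<Longrightarrow> j < d \<Longrightarrow> B i j = B j i"
    and var: "(\<Sum>i<d. (c i)\<^sup>2) + (\<Sum>i<d. \<Sum>j<d. (B i j)\<^sup>2) / 2 = 1"
    and op: "\<And>x. (\<Sum>i<d. (\<Sum>j<d. B i j * x j)\<^sup>2) \<le> \<epsilon>\<^sup>2 * (\<Sum>j<d. (x j)\<^sup>2)"
    and \<epsilon>: "0 \<le> \<epsilon>"
  shows "cmod (char (distr (gauss d) borel (lin_quad d c B)) t - exp (- t\<^sup>2 / 2)) \<le> 3 / 2 * \<epsilon> * t\<^sup>2"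
proof -
  interpret prob_space "gauss d" by (rule prob_space_gauss)
  let ?T = "lin_quad d c B"
  let ?a = "\<lambda>k x. c k + (\<Sum>j<d. B k j * x j) / 2"
  let ?g = "\<lambda>k x. c k + (\<Sum>j<d. B k j * x j)"
  define Q where "Q x = (\<Sum>k<d. ?a k x * ?g k x)" for x
  define e where "e s x = iexp (s * ?T x)" for s x
  define \<phi> where "\<phi> s = (\<integral>x. e s x \<partial>gauss d)" for s
  have T_meas [measurable]: "?T \<in> borel_measurable (gauss d)"
    using tame_lin_quad tame_def by blast
  have e_tame [intro!]: "tame d (e s)" for s
    unfolding e_def by (rule tame_bounded[of _ _ 1]) auto
  have Q_tame [intro!]: "tame d Q"
    unfolding Q_def[abs_def] by auto

  have e_deriv: "((\<lambda>y. e s (x(k := y))) has_vector_derivative (\<i> * of_real (s * ?g k (x(k := y))) * e s (x(k := y)))) (at y)"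
    if k: "k < d" for k s x y
  proof -
    have "((\<lambda>y. \<i> * of_real (s * ?T (x(k := y)))) has_vector_derivative \<i> * of_real (s * ?g k (x(k := y)))) (at y)"
      using lin_quad_deriv[OF k sym, where x=x and c=c and y=y]
      by (intro has_vector_derivative_mult_right has_vector_derivative_of_real DERIV_cmult)
    then show ?thesis unfolding e_def
      using field_vector_diff_chain_at[OF _ DERIV_exp] by (fastforce simp: o_def)
  qed

  have stein: "(\<integral>x. ?T x *\<^sub>R e s x \<partial>gauss d) = (\<i> * of_real s) * (\<integral>x. Q x *\<^sub>R e s x \<partial>gauss d)" for s
  proof -
    have "(\<integral>x. ?T x *\<^sub>R e s x \<partial>gauss d) =
       (\<integral>x. (\<Sum>k<d. ?a k x *\<^sub>R (\<i> * of_real (s * ?g k x) * e s x)) \<partial>gauss d)"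
    proof (rule lin_quad_stein)
      fix k assume k: "k < d"
      have "tame d (\<lambda>x. (s * ?g k x) *\<^sub>R (\<i> * e s x))"
        using k by (intro tame_scaleR tame_mult tame_grad tame_const tame_bounded[of "\<lambda>x. \<i> * e s x" d 1])
           (auto simp: e_def norm_mult)
      then show "tame d (\<lambda>x. \<i> * of_real (s * ?g k x) * e s x)"
        by (simp add: scaleR_conv_of_real ac_simps)
      show "isCont (\<lambda>y. \<i> * of_real (s * ?g k (x(k := y))) * e s (x(k := y))) y" for x y
        using has_vector_derivative_continuous[OF e_deriv[OF k, of s x y]]
        by (intro continuous_intros isCont_component)
      show "((\<lambda>y. e s (x(k := y))) has_vector_derivative
          \<i> * of_real (s * ?g k (x(k := y))) * e s (x(k := y))) (at y)" for x y
        by (rule e_deriv[OF k])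
    qed (rule e_tame)
    also have "\<dots> = (\<integral>x. (\<i> * of_real s) * (Q x *\<^sub>R e s x) \<partial>gauss d)"
      by (intro Bochner_Integration.integral_cong refl)
         (simp add: Q_def scaleR_conv_of_real sum_distrib_left sum_distrib_right ac_simps)
    finally show ?thesis unfolding integral_mult_right_zero .
  qed

  define c' where "c' i = 3 / 2 * (\<Sum>j<d. B i j * c j)" for i
  define B' where "B' i j = (\<Sum>k<d. B i k * B k j)" for i j
  have Q_eq: "Q x - 1 = lin_quad d c' B' x" for x
  proof -
    have "Q x = (\<Sum>k<d. (c k)\<^sup>2) + 3 / 2 * (\<Sum>k<d. c k * (\<Sum>j<d. B k j * x j))
       + (\<Sum>k<d. (\<Sum>j<d. B k j * x j)\<^sup>2) / 2"
    proof -
      have "(u + s / 2) * (u + s) = u\<^sup>2 + 3 / 2 * (u * s) + s\<^sup>2 / 2" for u s :: real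
        by (simp add: power2_eq_square field_simps)
      note expand = this
      show ?thesis unfolding Q_def expand
        by (simp only: sum.distrib sum_distrib_left[symmetric] sum_divide_distrib[symmetric])
    qed
    moreover have "(\<Sum>k<d. c k * (\<Sum>j<d. B k j * x j)) = (\<Sum>i<d. (\<Sum>j<d. B i j * c j) * x i)"
    proof -
      have "(\<Sum>k<d. c k * (\<Sum>j<d. B k j * x j)) = (\<Sum>k<d. \<Sum>j<d. B j k * c k * x j)"
        unfolding sum_distrib_left by (intro sum.cong refl) (simp add: sym)
      then show ?thesis by (subst (asm) sum.swap) (simp add: sum_distrib_right)
    qed
    moreover have "(\<Sum>k<d. (\<Sum>j<d. B k j * x j)\<^sup>2) = (\<Sum>i<d. \<Sum>j<d. B' i j * x i * x j)"
    proof -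
      have "(\<Sum>k<d. (\<Sum>j<d. B k j * x j)\<^sup>2) = (\<Sum>k<d. \<Sum>i<d. \<Sum>j<d. B i k * B k j * x i * x j)"
        unfolding power2_eq_square sum_product by (intro sum.cong refl) (simp add: sym)
      also have "\<dots> = (\<Sum>i<d. \<Sum>j<d. \<Sum>k<d. B i k * B k j * x i * x j)"
        by (subst sum.swap) (intro sum.cong refl sum.swap)
      finally show ?thesis by (simp add: B'_def sum_distrib_right)
    qed
    moreover have "(\<Sum>i<d. c' i * x i) = 3 / 2 * (\<Sum>i<d. (\<Sum>j<d. B i j * c j) * x i)"
      unfolding c'_def by (simp only: sum_distrib_left[symmetric] mult.assoc)
    moreover have "(\<Sum>i<d. \<Sum>j<d. (B i j)\<^sup>2) = (\<Sum>i<d. B' i i)"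
      unfolding B'_def power2_eq_square by (intro sum.cong refl) (simp add: sym)
    ultimately show ?thesis
      using var unfolding lin_quad_def by argo
  qed

  have B'_sym: "B' i j = B' j i" if "i < d" "j < d" for i j
    unfolding B'_def using that by (intro sum.cong refl) (simp add: sym)
  have Q_var: "(\<integral>x. (Q x - 1)\<^sup>2 \<partial>gauss d) \<le> (3 / 2 * \<epsilon>)\<^sup>2"
  proof -
    have "(\<Sum>i<d. (c' i)\<^sup>2) = 9 / 4 * (\<Sum>i<d. (\<Sum>j<d. B i j * c j)\<^sup>2)"
      by (simp add: c'_def power_mult_distrib power_divide flip: sum_distrib_left sum_divide_distrib)
    also have "\<dots> \<le> 9 / 4 * (\<epsilon>\<^sup>2 * (\<Sum>j<d. (c j)\<^sup>2))" by (intro mult_left_mono op) auto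
    finally have 1: "(\<Sum>i<d. (c' i)\<^sup>2) \<le> 9 / 4 * (\<epsilon>\<^sup>2 * (\<Sum>j<d. (c j)\<^sup>2))" .
    have "(\<Sum>i<d. \<Sum>j<d. (B' i j)\<^sup>2) = (\<Sum>j<d. \<Sum>i<d. (\<Sum>k<d. B i k * B k j)\<^sup>2)"
      unfolding B'_def by (rule sum.swap)
    also have "\<dots> \<le> (\<Sum>j<d. \<epsilon>\<^sup>2 * (\<Sum>k<d. (B k j)\<^sup>2))" by (intro sum_mono op)
    also have "\<dots> = \<epsilon>\<^sup>2 * (\<Sum>i<d. \<Sum>j<d. (B i j)\<^sup>2)"
      unfolding sum_distrib_left by (rule sum.swap)
    finally have 2: "(\<Sum>i<d. \<Sum>j<d. (B' i j)\<^sup>2) \<le> \<epsilon>\<^sup>2 * (\<Sum>i<d. \<Sum>j<d. (B i j)\<^sup>2)" .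
    have 3: "0 \<le> \<epsilon>\<^sup>2 * (\<Sum>i<d. \<Sum>j<d. (B i j)\<^sup>2)" by (intro mult_nonneg_nonneg sum_nonneg) auto
    have "(\<integral>x. (Q x - 1)\<^sup>2 \<partial>gauss d) = (\<Sum>i<d. (c' i)\<^sup>2) + (\<Sum>i<d. \<Sum>j<d. (B' i j)\<^sup>2) / 2"
      unfolding Q_eq by (rule lin_quad_second_moment[OF B'_sym])
    also have "\<dots> \<le> 9 / 4 * \<epsilon>\<^sup>2 * ((\<Sum>i<d. (c i)\<^sup>2) + (\<Sum>i<d. \<Sum>j<d. (B i j)\<^sup>2) / 2)"
      using 1 2 3 by (simp add: algebra_simps)
    also have "\<dots> = (3 / 2 * \<epsilon>)\<^sup>2" unfolding var by (simp add: power2_eq_square)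
    finally show ?thesis .
  qed
  have Q_tame1: "tame d (\<lambda>x. Q x - 1)" "tame d (\<lambda>x. \<bar>Q x - 1\<bar>)" "tame d (\<lambda>x. (Q x - 1)\<^sup>2)"
  proof -
    show *: "tame d (\<lambda>x. Q x - 1)" by auto
    then show "tame d (\<lambda>x. \<bar>Q x - 1\<bar>)" by (auto simp: tame_def)
    show "tame d (\<lambda>x. (Q x - 1)\<^sup>2)" unfolding power2_eq_square by (intro tame_mult *)
  qed
  \<comment> \<open>The mean absolute deviation is at most the standard deviation.\<close>
  have Q_dev: "(\<integral>x. \<bar>Q x - 1\<bar> \<partial>gauss d) \<le> 3 / 2 * \<epsilon>"
  proof (rule power2_le_imp_le)
    have "variance (\<lambda>x. \<bar>Q x - 1\<bar>) = (\<integral>x. \<bar>Q x - 1\<bar>\<^sup>2 \<partial>gauss d) - (\<integral>x. \<bar>Q x - 1\<bar> \<partial>gauss d)\<^sup>2"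
      using Q_tame1 by (intro variance_eq integrable_tame) auto
    moreover have "0 \<le> variance (\<lambda>x. \<bar>Q x - 1\<bar>)" by (rule variance_positive)
    ultimately show "(\<integral>x. \<bar>Q x - 1\<bar> \<partial>gauss d)\<^sup>2 \<le> (3 / 2 * \<epsilon>)\<^sup>2" using Q_var by simp
  qed (use \<epsilon> in simp)

  have \<phi>_deriv: "(\<phi> has_vector_derivative (- s *\<^sub>R (\<integral>x. Q x *\<^sub>R e s x \<partial>gauss d))) (at s)" for s
  proof (rule has_vector_derivative_quadratic_remainder)
    fix u
    have T2: "tame d (\<lambda>x. (?T x)\<^sup>2)" unfolding power2_eq_square by auto
    have Te: "tame d (\<lambda>x. \<i> * (?T x *\<^sub>R e s x))"
    proof -
      have "tame d (\<lambda>x. ?T x *\<^sub>R (\<i> * e s x))"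
        by (intro tame_scaleR tame_lin_quad tame_bounded[of "\<lambda>x. \<i> * e s x" d 1]) (auto simp: e_def norm_mult)
      then show ?thesis by simp
    qed
    have "- s *\<^sub>R (\<integral>x. Q x *\<^sub>R e s x \<partial>gauss d) = \<i> * (\<integral>x. ?T x *\<^sub>R e s x \<partial>gauss d)"
      unfolding stein by (simp add: scaleR_conv_of_real flip: mult.assoc)
    then have "\<phi> u - \<phi> s - (u - s) *\<^sub>R (- s *\<^sub>R (\<integral>x. Q x *\<^sub>R e s x \<partial>gauss d)) =
      (\<integral>x. e u x - e s x - (u - s) *\<^sub>R (\<i> * (?T x *\<^sub>R e s x)) \<partial>gauss d)"
      unfolding \<phi>_def using Te
      by (simp add: integrable_tame e_tame Bochner_Integration.integrable_diff
          del: mult_scaleR_right)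
    also have "norm \<dots> \<le> (\<integral>x. (u - s)\<^sup>2 / 2 * (?T x)\<^sup>2 \<partial>gauss d)"
    proof (rule norm_integral_tame_le)
      show "tame d (\<lambda>x. (u - s)\<^sup>2 / 2 * (?T x)\<^sup>2)"
        using T2 by (intro tame_mult tame_const)
      show "tame d (\<lambda>x. e u x - e s x - (u - s) *\<^sub>R (\<i> * (?T x *\<^sub>R e s x)))"
        using Te by (intro tame_diff tame_scaleR tame_const e_tame)
      fix x
      let ?h = "(u - s) * ?T x"
      have "e u x = e s x * iexp ?h"
        unfolding e_def by (simp add: algebra_simps flip: exp_add)
      then have "e u x - e s x - (u - s) *\<^sub>R (\<i> * (?T x *\<^sub>R e s x)) =
        e s x * (iexp ?h - (\<Sum>k\<le>1. (\<i> * ?h) ^ k / fact k))"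
        by (simp add: scaleR_conv_of_real algebra_simps)
      then have "norm (e u x - e s x - (u - s) *\<^sub>R (\<i> * (?T x *\<^sub>R e s x))) =
         cmod (iexp ?h - (\<Sum>k\<le>1. (\<i> * ?h) ^ k / fact k))"
        by (simp add: norm_mult e_def)
      also have "\<dots> \<le> \<bar>?h\<bar> ^ 2 / 2" using iexp_approx1[of ?h 1] by (simp add: numeral_2_eq_2)
      finally show "norm (e u x - e s x - (u - s) *\<^sub>R (\<i> * (?T x *\<^sub>R e s x))) \<le> (u - s)\<^sup>2 / 2 * (?T x)\<^sup>2"
        by (simp add: power_mult_distrib)
    qed
    finally show "norm (\<phi> u - \<phi> s - (u - s) *\<^sub>R (- s *\<^sub>R (\<integral>x. Q x *\<^sub>R e s x \<partial>gauss d))) \<le>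
       ((\<integral>x. (?T x)\<^sup>2 \<partial>gauss d) / 2) * (u - s)\<^sup>2" by (simp add: mult.commute)
  qed

  \<comment> \<open>The quotient of \<open>\<phi>\<close> by the normal characteristic function; it has to stay near 1.\<close>
  define \<chi> where "\<chi> s = exp (s\<^sup>2 / 2) *\<^sub>R \<phi> s" for s
  have \<chi>_deriv: "(\<chi> has_vector_derivative
      (- s * exp (s\<^sup>2 / 2)) *\<^sub>R (\<integral>x. (Q x - 1) *\<^sub>R e s x \<partial>gauss d)) (at s)" for s
  proof -
    have "((\<lambda>s. exp (s\<^sup>2 / 2)) has_real_derivative s * exp (s\<^sup>2 / 2)) (at s)"
      by (auto intro!: derivative_eq_intros)
    then have "(\<chi> has_vector_derivative
       exp (s\<^sup>2 / 2) *\<^sub>R (- s *\<^sub>R (\<integral>x. Q x *\<^sub>R e s x \<partial>gauss d)) + (s * exp (s\<^sup>2 / 2)) *\<^sub>R \<phi> s) (at s)"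
      unfolding \<chi>_def[abs_def] by (rule has_vector_derivative_scaleR[OF _ \<phi>_deriv])
    moreover have "(\<integral>x. (Q x - 1) *\<^sub>R e s x \<partial>gauss d) = (\<integral>x. Q x *\<^sub>R e s x \<partial>gauss d) - \<phi> s"
      unfolding \<phi>_def scaleR_diff_left scaleR_one
      by (intro Bochner_Integration.integral_diff integrable_tame) auto
    ultimately show ?thesis by (simp add: scaleR_diff_right ac_simps)
  qed
  have "norm (\<chi> t - \<chi> 0) \<le> (\<bar>t\<bar> * exp (t\<^sup>2 / 2) * (3 / 2 * \<epsilon>)) * norm (t - 0)"
  proof (rule differentiable_bound[of "{- \<bar>t\<bar>..\<bar>t\<bar>}"])
    fix s assume s: "s \<in> {- \<bar>t\<bar>..\<bar>t\<bar>}"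
    then have st: "\<bar>s\<bar> \<le> \<bar>t\<bar>" by auto
    then have "s\<^sup>2 \<le> t\<^sup>2" by (rule abs_le_square_iff[THEN iffD1])
    then have ex: "exp (s\<^sup>2 / 2) \<le> exp (t\<^sup>2 / 2)" by simp
    have "norm (\<integral>x. (Q x - 1) *\<^sub>R e s x \<partial>gauss d) \<le> (\<integral>x. \<bar>Q x - 1\<bar> \<partial>gauss d)"
      using Q_tame1 by (intro norm_integral_tame_le tame_scaleR e_tame) (auto simp: e_def)
    also have "\<dots> \<le> 3 / 2 * \<epsilon>" by (rule Q_dev)
    finally have le: "norm (\<integral>x. (Q x - 1) *\<^sub>R e s x \<partial>gauss d) \<le> 3 / 2 * \<epsilon>" .
    have "\<bar>- s * exp (s\<^sup>2 / 2)\<bar> \<le> \<bar>t\<bar> * exp (t\<^sup>2 / 2)"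
      unfolding abs_mult abs_minus_cancel abs_exp_cancel using st ex by (intro mult_mono) auto
    then have le': "norm ((- s * exp (s\<^sup>2 / 2)) *\<^sub>R (\<integral>x. (Q x - 1) *\<^sub>R e s x \<partial>gauss d))
        \<le> \<bar>t\<bar> * exp (t\<^sup>2 / 2) * (3 / 2 * \<epsilon>)"
      unfolding norm_scaleR by (intro mult_mono le) auto
    show "onorm (\<lambda>h. h *\<^sub>R ((- s * exp (s\<^sup>2 / 2)) *\<^sub>R (\<integral>x. (Q x - 1) *\<^sub>R e s x \<partial>gauss d)))
        \<le> \<bar>t\<bar> * exp (t\<^sup>2 / 2) * (3 / 2 * \<epsilon>)"
    proof (rule onorm_le)
      fix h :: real
      show "norm (h *\<^sub>R ((- s * exp (s\<^sup>2 / 2)) *\<^sub>R (\<integral>x. (Q x - 1) *\<^sub>R e s x \<partial>gauss d)))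
        \<le> \<bar>t\<bar> * exp (t\<^sup>2 / 2) * (3 / 2 * \<epsilon>) * norm h"
        using mult_right_mono[OF le' abs_ge_zero[of h]]
        by (subst norm_scaleR, subst mult.commute) (simp only: real_norm_def)
    qed
    show "(\<chi> has_derivative (\<lambda>h. h *\<^sub>R ((- s * exp (s\<^sup>2 / 2)) *\<^sub>R (\<integral>x. (Q x - 1) *\<^sub>R e s x \<partial>gauss d))))
       (at s within {- \<bar>t\<bar>..\<bar>t\<bar>})"
      using has_vector_derivative_at_within[OF \<chi>_deriv] unfolding has_vector_derivative_def .
  qed auto
  moreover have "\<chi> 0 = 1" by (simp add: \<chi>_def \<phi>_def e_def prob_space)
  moreover have "(\<bar>t\<bar> * exp (t\<^sup>2 / 2) * (3 / 2 * \<epsilon>)) * norm (t - 0) = exp (t\<^sup>2 / 2) * (3 / 2 * \<epsilon> * t\<^sup>2)"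
  proof -
    have "\<bar>t\<bar> * \<bar>t\<bar> = t\<^sup>2" by (simp add: power2_eq_square)
    then show ?thesis by (simp add: mult.left_commute[of "\<bar>t\<bar>"] mult.assoc)
  qed
  ultimately have \<chi>: "norm (\<chi> t - 1) \<le> exp (t\<^sup>2 / 2) * (3 / 2 * \<epsilon> * t\<^sup>2)" by (simp only:)
  have "char (distr (gauss d) borel ?T) t = \<phi> t"
    unfolding char_def \<phi>_def e_def by (subst integral_distr) auto
  then have "char (distr (gauss d) borel ?T) t - exp (- t\<^sup>2 / 2) = exp (- t\<^sup>2 / 2) *\<^sub>R (\<chi> t - 1)"
    unfolding \<chi>_def by (simp add: algebra_simps exp_minus scaleR_conv_of_real exp_of_real[symmetric])
  then have "cmod (char (distr (gauss d) borel ?T) t - exp (- t\<^sup>2 / 2)) = exp (- t\<^sup>2 / 2) * norm (\<chi> t - 1)"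
    by simp
  also have "\<dots> \<le> exp (- t\<^sup>2 / 2) * (exp (t\<^sup>2 / 2) * (3 / 2 * \<epsilon> * t\<^sup>2))"
    by (rule mult_left_mono[OF \<chi>]) simp
  also have "\<dots> = 3 / 2 * \<epsilon> * t\<^sup>2"
    by (simp add: exp_minus)
  finally show ?thesis .
qed

section \<open>Square roots of positive definite matrices\<close>

definition pos_def :: "nat \<Rightarrow> real mat \<Rightarrow> bool" where
  "pos_def n A \<longleftrightarrow> A \<in> carrier_mat n n \<and> A\<^sup>T = A \<and>
     (\<forall>x\<in>carrier_vec n. x \<noteq> 0\<^sub>v n \<longrightarrow> 0 < x \<bullet> (A *\<^sub>v x))"

lemma symmetric_scalar_prod:
  fixes A :: "real mat"
  assumes "A \<in> carrier_mat n n" "A\<^sup>T = A" "x \<in> carrier_vec n" "y \<in> carrier_vec n"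
  shows "(A *\<^sub>v x) \<bullet> y = x \<bullet> (A *\<^sub>v y)"
  using transpose_vec_mult_scalar[of A n n y x] assms by simp

lemma symmetric_mat_entry:
  assumes "A \<in> carrier_mat n n" "A\<^sup>T = A" "i < n" "k < n"
  shows "A $$ (k, i) = A $$ (i, k)"
proof -
  have "A\<^sup>T $$ (i, k) = A $$ (k, i)" using assms(1,3,4) by simp
  then show ?thesis unfolding assms(2) by (rule sym)
qed

lemma unit_vec_form_entry:
  assumes "(A :: real mat) \<in> carrier_mat n m" "i < n" "j < m"
  shows "unit_vec n i \<bullet> (A *\<^sub>v unit_vec m j) = A $$ (i, j)"
  using assms by (subst scalar_prod_left_unit[of _ n]) auto

lemma real_scalar_prod_self_nonneg: "0 \<le> (x :: real vec) \<bullet> x"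
  by (simp add: scalar_prod_def sum_nonneg)

lemma real_scalar_prod_self_eq_0:
  assumes "(x :: real vec) \<in> carrier_vec n" "x \<bullet> x = 0" shows "x = 0\<^sub>v n"
  using assms by (intro eq_vecI) (auto simp: scalar_prod_def sum_nonneg_eq_0_iff)

lemma real_scalar_prod_Cauchy_Schwarz:
  assumes "(x :: real vec) \<in> carrier_vec n" "y \<in> carrier_vec n"
  shows "(x \<bullet> y)\<^sup>2 \<le> (x \<bullet> x) * (y \<bullet> y)"
  using assms Cauchy_Schwarz_ineq_sum[of "\<lambda>i. x $ i" "\<lambda>i. y $ i" "{0..<n}"]
  by (simp add: scalar_prod_def power2_eq_square)

lemma frobenius_norm_nonneg: "0 \<le> frobenius_norm A"
  by (simp add: frobenius_norm_def sum_nonneg)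

lemma mult_mat_vec_bounded:
  assumes A: "A \<in> carrier_mat n m" and x: "(x :: real vec) \<in> carrier_vec m"
  shows "(A *\<^sub>v x) \<bullet> (A *\<^sub>v x) \<le> (frobenius_norm A)\<^sup>2 * (x \<bullet> x)"
proof -
  have "(A *\<^sub>v x) \<bullet> (A *\<^sub>v x) = (\<Sum>i<n. (row A i \<bullet> x)\<^sup>2)"
    using A by (simp add: scalar_prod_def[of "A *\<^sub>v x"] power2_eq_square lessThan_atLeast0)
  also have "\<dots> \<le> (\<Sum>i<n. (row A i \<bullet> row A i) * (x \<bullet> x))"
    using A x by (intro sum_mono real_scalar_prod_Cauchy_Schwarz[of _ m]) auto
  also have "\<dots> = (\<Sum>i<n. row A i \<bullet> row A i) * (x \<bullet> x)" by (simp add: sum_distrib_right)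
  also have "(\<Sum>i<n. row A i \<bullet> row A i) = (frobenius_norm A)\<^sup>2"
    using A by (simp add: frobenius_norm_def sum_nonneg scalar_prod_def power2_eq_square lessThan_atLeast0)
  finally show ?thesis .
qed

text \<open>Evaluate the form at \<open>x - A x / K\<close>; since it is nonnegative there, the mixed term is
  dominated.\<close>

lemma norm_le_psd_form:
  assumes A: "A \<in> carrier_mat n n" "psd A" and x: "x \<in> carrier_vec n" and K: "0 < K"
    and bound: "\<And>y. y \<in> carrier_vec n \<Longrightarrow> (A *\<^sub>v y) \<bullet> (A *\<^sub>v y) \<le> K\<^sup>2 * (y \<bullet> y)"
  shows "(A *\<^sub>v x) \<bullet> (A *\<^sub>v x) \<le> K * (x \<bullet> (A *\<^sub>v x))"
proof -
  let ?y = "A *\<^sub>v x"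
  have sym: "A\<^sup>T = A" and nn: "\<And>z. z \<in> carrier_vec n \<Longrightarrow> 0 \<le> z \<bullet> (A *\<^sub>v z)"
    using A unfolding psd_def by auto
  have y: "?y \<in> carrier_vec n" "A *\<^sub>v ?y \<in> carrier_vec n" using A x by auto
  have "(?y \<bullet> (A *\<^sub>v ?y))\<^sup>2 \<le> (?y \<bullet> ?y) * (K\<^sup>2 * (?y \<bullet> ?y))"
    using order_trans[OF real_scalar_prod_Cauchy_Schwarz[OF y]
        mult_left_mono[OF bound[OF y(1)] real_scalar_prod_self_nonneg]] .
  also have "\<dots> = (K * (?y \<bullet> ?y))\<^sup>2" by (simp add: power2_eq_square)
  finally have yAy: "?y \<bullet> (A *\<^sub>v ?y) \<le> K * (?y \<bullet> ?y)"
    by (rule power2_le_imp_le) (use K real_scalar_prod_self_nonneg[of ?y] in simp)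
  let ?z = "x - (1 / K) \<cdot>\<^sub>v ?y"
  have "?z \<bullet> (A *\<^sub>v ?z) = x \<bullet> ?y - 2 / K * (?y \<bullet> ?y) + (1 / K)\<^sup>2 * (?y \<bullet> (A *\<^sub>v ?y))"
  proof -
    have "A *\<^sub>v ?z = ?y - (1 / K) \<cdot>\<^sub>v (A *\<^sub>v ?y)"
      using A x y by (simp add: mult_minus_distrib_mat_vec mult_mat_vec)
    moreover have "x \<bullet> (A *\<^sub>v ?y) = ?y \<bullet> ?y" using symmetric_scalar_prod[OF A(1) sym x y(1)] by simp
    ultimately show ?thesis
      using x y by (simp add: minus_scalar_prod_distrib scalar_prod_minus_distrib power2_eq_square field_simps)
  qed
  moreover have "0 \<le> ?z \<bullet> (A *\<^sub>v ?z)" using x y by (intro nn) auto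
  moreover have "(1 / K)\<^sup>2 * (?y \<bullet> (A *\<^sub>v ?y)) \<le> (1 / K)\<^sup>2 * (K * (?y \<bullet> ?y))"
    using yAy by (intro mult_left_mono) auto
  moreover have "(1 / K)\<^sup>2 * (K * (?y \<bullet> ?y)) = (?y \<bullet> ?y) / K" "2 / K * (?y \<bullet> ?y) = 2 * ((?y \<bullet> ?y) / K)"
    using K by (simp_all add: power2_eq_square)
  ultimately have "(?y \<bullet> ?y) / K \<le> x \<bullet> ?y" by linarith
  then show ?thesis using K by (simp add: pos_divide_le_eq mult.commute)
qed

lemma pd_imp_psd: "pos_def n A \<Longrightarrow> psd A"
  unfolding pos_def_def psd_def
proof (intro conjI ballI)
  fix x :: "real vec"
  assume "A \<in> carrier_mat n n \<and> A\<^sup>T = A \<and> (\<forall>x\<in>carrier_vec n. x \<noteq> 0\<^sub>v n \<longrightarrow> 0 < x \<bullet> (A *\<^sub>v x))"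
    and "x \<in> carrier_vec (dim_col A)"
  then show "0 \<le> x \<bullet> (A *\<^sub>v x)" by (cases "x = 0\<^sub>v n") (auto simp: less_imp_le)
qed auto

lemma psd_square_root_pd:
  assumes A: "pos_def n A" and B: "psd B" and BB: "B * B = A"
  shows "pos_def n B"
proof -
  have Ac: "A \<in> carrier_mat n n" using A by (auto simp: pos_def_def)
  have Bc: "B \<in> carrier_mat n n"
    using arg_cong[OF BB, of dim_row] carrier_matD[OF Ac] B by (intro carrier_matI) (simp_all add: psd_def)
  have "0 < x \<bullet> (B *\<^sub>v x)" if x: "x \<in> carrier_vec n" "x \<noteq> 0\<^sub>v n" for x
  proof (rule ccontr)
    assume "\<not> 0 < x \<bullet> (B *\<^sub>v x)"
    moreover have "0 \<le> x \<bullet> (B *\<^sub>v x)" using B Bc x by (auto simp: psd_def)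
    ultimately have z: "x \<bullet> (B *\<^sub>v x) = 0" by simp
    have "(B *\<^sub>v x) \<bullet> (B *\<^sub>v x) \<le> (1 + frobenius_norm B) * (x \<bullet> (B *\<^sub>v x))"
    proof (rule norm_le_psd_form[OF Bc B x(1)])
      have f: "0 \<le> frobenius_norm B" by (rule frobenius_norm_nonneg)
      then show "0 < 1 + frobenius_norm B" by simp
      have le: "(frobenius_norm B)\<^sup>2 \<le> (1 + frobenius_norm B)\<^sup>2" using f by (intro power_mono) auto
      show "(B *\<^sub>v y) \<bullet> (B *\<^sub>v y) \<le> (1 + frobenius_norm B)\<^sup>2 * (y \<bullet> y)" if "y \<in> carrier_vec n" for y
        using order_trans[OF mult_mat_vec_bounded[OF Bc that] mult_right_mono[OF le real_scalar_prod_self_nonneg]] .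
    qed
    then have "B *\<^sub>v x = 0\<^sub>v n"
      using z real_scalar_prod_self_nonneg[of "B *\<^sub>v x"] Bc x by (intro real_scalar_prod_self_eq_0) auto
    moreover have "B *\<^sub>v 0\<^sub>v n = 0\<^sub>v n" using Bc by (intro eq_vecI) auto
    ultimately have "A *\<^sub>v x = 0\<^sub>v n" using assoc_mult_mat_vec[OF Bc Bc x(1)] by (simp add: BB)
    moreover have "0 < x \<bullet> (A *\<^sub>v x)" using A x by (auto simp: pos_def_def)
    ultimately show False using x by simp
  qed
  then show ?thesis using Bc B unfolding pos_def_def psd_def by auto
qed

lemma mtrace_mult_commute:
  assumes "A \<in> carrier_mat n m" "B \<in> carrier_mat m n"
  shows "mtrace (A * B) = mtrace (B * A)"
proof -
  have "mtrace (A * B) = (\<Sum>i<n. \<Sum>j<m. A $$ (i, j) * B $$ (j, i))"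
    using assms by (simp add: mtrace_def scalar_prod_def lessThan_atLeast0)
  also have "\<dots> = (\<Sum>j<m. \<Sum>i<n. B $$ (j, i) * A $$ (i, j))"
    by (subst sum.swap) (simp add: mult.commute)
  also have "\<dots> = mtrace (B * A)"
    using assms by (simp add: mtrace_def scalar_prod_def lessThan_atLeast0)
  finally show ?thesis .
qed

text \<open>With \<open>D = B - C\<close>, equality of the squares reads \<open>B D + D C = 0\<close>. Multiplying by \<open>D\<close> and taking
  traces gives \<open>tr (D B D) + tr (D C D) = 0\<close>. Both traces are nonnegative, so both vanish, and
  positive definiteness of \<open>B\<close> forces \<open>D = 0\<close>.\<close>

lemma psd_square_root_unique:
  assumes A: "pos_def n A" and B: "psd B" "B * B = A" and C: "psd C" "C * C = A"
  shows "B = C"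
proof -
  have Bp: "pos_def n B" and Cp: "pos_def n C" using psd_square_root_pd[OF A] B C by auto
  have Ac: "A \<in> carrier_mat n n" using A by (simp add: pos_def_def)
  have Bc: "B \<in> carrier_mat n n" and Cc: "C \<in> carrier_mat n n"
    and Bs: "B\<^sup>T = B" and Cs: "C\<^sup>T = C" using Bp Cp by (auto simp: pos_def_def)
  define D where "D = B - C"
  have Dc: "D \<in> carrier_mat n n" and Ds: "D\<^sup>T = D"
    using Bc Cc Bs Cs by (auto simp: D_def transpose_minus)
  have tr: "mtrace (D * (E * D)) = (\<Sum>i<n. (D *\<^sub>v unit_vec n i) \<bullet> (E *\<^sub>v (D *\<^sub>v unit_vec n i)))"
    if E: "E \<in> carrier_mat n n" for E
  proof -
    have "(D * (E * D)) $$ (i, i) = (D *\<^sub>v unit_vec n i) \<bullet> (E *\<^sub>v (D *\<^sub>v unit_vec n i))" if i: "i < n" for i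
    proof -
      have "(D * (E * D)) $$ (i, i) = unit_vec n i \<bullet> ((D * (E * D)) *\<^sub>v unit_vec n i)"
        using i Dc E by (intro unit_vec_form_entry[symmetric]) auto
      also have "\<dots> = unit_vec n i \<bullet> (D *\<^sub>v (E *\<^sub>v (D *\<^sub>v unit_vec n i)))"
        using assoc_mult_mat_vec[of D n n "E * D" n "unit_vec n i"]
          assoc_mult_mat_vec[of E n n D n "unit_vec n i"] Dc E by simp
      also have "\<dots> = (D *\<^sub>v unit_vec n i) \<bullet> (E *\<^sub>v (D *\<^sub>v unit_vec n i))"
        using Dc E by (intro symmetric_scalar_prod[symmetric] Ds) auto
      finally show ?thesis .
    qed
    then show ?thesis using Dc by (simp add: mtrace_def)
  qed
  have nn: "0 \<le> x \<bullet> (B *\<^sub>v x)" "0 \<le> x \<bullet> (C *\<^sub>v x)" if "x \<in> carrier_vec n" for x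
    using that B C Bc Cc by (auto simp: psd_def)
  have "B * D + D * C = 0\<^sub>m n n"
    unfolding D_def mult_minus_distrib_mat[OF Bc Bc Cc] minus_mult_distrib_mat[OF Bc Cc Cc] B(2) C(2)
    using Bc Cc Ac by (intro eq_matI) simp_all
  then have "D * (B * D) + D * (D * C) = 0\<^sub>m n n"
    using mult_add_distrib_mat[of D n n "B * D" n "D * C"] Bc Cc Dc by simp
  then have "mtrace (D * (B * D)) + mtrace (D * (D * C)) = 0"
  proof -
    assume "D * (B * D) + D * (D * C) = 0\<^sub>m n n"
    then have "mtrace (D * (B * D) + D * (D * C)) = 0" by (simp add: mtrace_def)
    then show ?thesis using Bc Cc Dc by (simp add: mtrace_def sum.distrib)
  qed
  moreover have "mtrace (D * (D * C)) = mtrace (D * (C * D))"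
    using mtrace_mult_commute[OF Dc mult_carrier_mat[OF Dc Cc]]
    unfolding assoc_mult_mat[OF Dc Cc Dc] .
  ultimately have sum0: "mtrace (D * (B * D)) + mtrace (D * (C * D)) = 0" by simp
  have "(\<Sum>i<n. (D *\<^sub>v unit_vec n i) \<bullet> (B *\<^sub>v (D *\<^sub>v unit_vec n i))) = 0"
  proof -
    have "0 \<le> mtrace (D * (B * D))" "0 \<le> mtrace (D * (C * D))"
      unfolding tr[OF Bc] tr[OF Cc] using Dc by (auto intro!: sum_nonneg nn)
    then show ?thesis using sum0 unfolding tr[OF Bc] by linarith
  qed
  then have z: "(D *\<^sub>v unit_vec n i) \<bullet> (B *\<^sub>v (D *\<^sub>v unit_vec n i)) = 0" if "i < n" for i
    using that Dc by (subst (asm) sum_nonneg_eq_0_iff) (auto intro!: nn)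
  have "D *\<^sub>v unit_vec n i = 0\<^sub>v n" if "i < n" for i
  proof (rule ccontr)
    assume "D *\<^sub>v unit_vec n i \<noteq> 0\<^sub>v n"
    then have "0 < (D *\<^sub>v unit_vec n i) \<bullet> (B *\<^sub>v (D *\<^sub>v unit_vec n i))"
      using Bp Dc by (auto simp: pos_def_def)
    then show False using z[OF that] by simp
  qed
  then have "D $$ (j, i) = 0" if "i < n" "j < n" for i j
  proof -
    have "(D *\<^sub>v unit_vec n i) $ j = 0" using \<open>\<And>i. i < n \<Longrightarrow> D *\<^sub>v unit_vec n i = 0\<^sub>v n\<close> that by simp
    then show ?thesis using Dc that by simp
  qed
  then show "B = C" using Bc Cc by (intro eq_matI) (auto simp: D_def)
qed

lemma pd_inverse:
  assumes A: "pos_def n A"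
  obtains M where "mat_inverse A = Some M" "A * M = 1\<^sub>m n" "M * A = 1\<^sub>m n" "pos_def n M"
proof -
  have Ac: "A \<in> carrier_mat n n" and As: "A\<^sup>T = A"
    and Apos: "\<And>x. x \<in> carrier_vec n \<Longrightarrow> x \<noteq> 0\<^sub>v n \<Longrightarrow> 0 < x \<bullet> (A *\<^sub>v x)"
    using A by (auto simp: pos_def_def)
  have "det A \<noteq> 0"
  proof
    assume "det A = 0"
    then obtain v where v: "v \<in> carrier_vec n" "v \<noteq> 0\<^sub>v n" "A *\<^sub>v v = 0\<^sub>v n"
      using det_0_iff_vec_prod_zero_field[OF Ac] by blast
    then show False using Apos[OF v(1,2)] by simp
  qed
  then have "A \<in> Units (ring_mat TYPE(real) n ())" by (rule det_non_zero_imp_unit[OF Ac])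
  then obtain M where M: "mat_inverse A = Some M" using mat_inverse(1)[OF Ac, of "()"] by (cases "mat_inverse A") auto
  then have AM: "A * M = 1\<^sub>m n" and MA: "M * A = 1\<^sub>m n" and Mc: "M \<in> carrier_mat n n"
    using mat_inverse(2)[OF Ac] by auto
  have Ms: "M\<^sup>T = M"
  proof -
    have "M\<^sup>T * A = 1\<^sub>m n" using transpose_mult[OF Ac Mc] AM As by simp
    have "M\<^sup>T = M\<^sup>T * (A * M)" using Mc AM by simp
    also have "\<dots> = M\<^sup>T * A * M" using assoc_mult_mat[of "M\<^sup>T" n n A n M n] Ac Mc by simp
    also have "\<dots> = M" using \<open>M\<^sup>T * A = 1\<^sub>m n\<close> Mc by simp
    finally show ?thesis .
  qed
  have "0 < x \<bullet> (M *\<^sub>v x)" if x: "x \<in> carrier_vec n" "x \<noteq> 0\<^sub>v n" for x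
  proof -
    have AMx: "A *\<^sub>v (M *\<^sub>v x) = x" using assoc_mult_mat_vec[OF Ac Mc x(1)] AM x by simp
    have "A *\<^sub>v 0\<^sub>v n = 0\<^sub>v n" using Ac by (intro eq_vecI) auto
    then have "M *\<^sub>v x \<noteq> 0\<^sub>v n" using AMx x by auto
    then have "0 < (M *\<^sub>v x) \<bullet> x" using Apos[of "M *\<^sub>v x"] Mc x AMx by simp
    then show ?thesis using symmetric_scalar_prod[OF Mc Ms x(1) x(1)] by simp
  qed
  then have "pos_def n M" using Mc Ms by (auto simp: pos_def_def)
  with M AM MA show thesis by (rule that)
qed

text \<open>\<open>I - A / K\<close> is a strict contraction once \<open>K\<close> exceeds the norm of \<open>A\<close>: the quadratic form of \<open>A\<close>
  dominates \<open>|A x|\<^sup>2 / K\<close>, and \<open>|A x|\<close> is bounded below through the inverse of \<open>A\<close>.\<close>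

lemma pd_contraction:
  assumes A: "pos_def n A"
  obtains K \<rho> where "0 < K" "0 \<le> \<rho>" "\<rho> < 1"
    "\<And>x. x \<in> carrier_vec n \<Longrightarrow>
      (x - (1 / K) \<cdot>\<^sub>v (A *\<^sub>v x)) \<bullet> (x - (1 / K) \<cdot>\<^sub>v (A *\<^sub>v x)) \<le> \<rho>\<^sup>2 * (x \<bullet> x)"
proof -
  have Ac: "A \<in> carrier_mat n n" using A by (auto simp: pos_def_def)
  obtain M where M: "M * A = 1\<^sub>m n" "pos_def n M" using pd_inverse[OF A] by metis
  have Mc: "M \<in> carrier_mat n n" using M by (auto simp: pos_def_def)
  define K where "K = 1 + frobenius_norm A"
  \<comment> \<open>Adding 1 to the norms keeps both constants positive, also for the empty matrix.\<close>
  define m where "m = 1 + frobenius_norm M"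
  have K: "1 \<le> K" and m: "1 \<le> m" by (auto simp: K_def m_def frobenius_norm_nonneg)
  have leK: "(frobenius_norm A)\<^sup>2 \<le> K\<^sup>2" and lem: "(frobenius_norm M)\<^sup>2 \<le> m\<^sup>2"
    by (auto simp: K_def m_def frobenius_norm_nonneg intro!: power_mono)
  have bK: "(A *\<^sub>v y) \<bullet> (A *\<^sub>v y) \<le> K\<^sup>2 * (y \<bullet> y)" if "y \<in> carrier_vec n" for y
    using order_trans[OF mult_mat_vec_bounded[OF Ac that] mult_right_mono[OF leK real_scalar_prod_self_nonneg]] .
  have bm: "(M *\<^sub>v y) \<bullet> (M *\<^sub>v y) \<le> m\<^sup>2 * (y \<bullet> y)" if "y \<in> carrier_vec n" for y
    using order_trans[OF mult_mat_vec_bounded[OF Mc that] mult_right_mono[OF lem real_scalar_prod_self_nonneg]] .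
  define \<rho> where "\<rho> = sqrt (1 - 1 / (K\<^sup>2 * m\<^sup>2))"
  have "1 \<le> K\<^sup>2 * m\<^sup>2" using K m by (metis mult_1 mult_mono one_le_power zero_le_one zero_le_power2)
  then have km: "0 < 1 / (K\<^sup>2 * m\<^sup>2)" "1 / (K\<^sup>2 * m\<^sup>2) \<le> 1" by auto
  have \<rho>2: "\<rho>\<^sup>2 = 1 - 1 / (K\<^sup>2 * m\<^sup>2)" using km by (simp add: \<rho>_def)
  show thesis
  proof (rule that[of K \<rho>])
    show "0 < K" using K by simp
    show "0 \<le> \<rho>" "\<rho> < 1" using km by (auto simp: \<rho>_def)
    fix x :: "real vec" assume x: "x \<in> carrier_vec n"
    let ?y = "A *\<^sub>v x"
    have y: "?y \<in> carrier_vec n" using Ac x by simp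
    have "?y \<bullet> ?y \<le> K * (x \<bullet> ?y)"
      using K by (intro norm_le_psd_form[OF Ac pd_imp_psd[OF A] x _ bK]) auto
    then have 1: "(?y \<bullet> ?y) / K\<^sup>2 \<le> (x \<bullet> ?y) / K"
      using K by (simp add: field_simps power2_eq_square)
    have "M *\<^sub>v ?y = x" using assoc_mult_mat_vec[OF Mc Ac x] M x by simp
    then have "x \<bullet> x \<le> m\<^sup>2 * (?y \<bullet> ?y)" using bm[OF y] by simp
    then have 2: "(x \<bullet> x) / (K\<^sup>2 * m\<^sup>2) \<le> (?y \<bullet> ?y) / K\<^sup>2"
      using K m by (simp add: field_simps)
    have "(x - (1 / K) \<cdot>\<^sub>v ?y) \<bullet> (x - (1 / K) \<cdot>\<^sub>v ?y) = x \<bullet> x - 2 * ((x \<bullet> ?y) / K) + (?y \<bullet> ?y) / K\<^sup>2"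
      using x y by (simp add: minus_scalar_prod_distrib[of _ n] scalar_prod_minus_distrib[of _ n]
          comm_scalar_prod[OF y x] power2_eq_square diff_divide_distrib)
    also have "\<dots> \<le> x \<bullet> x - (x \<bullet> x) / (K\<^sup>2 * m\<^sup>2)" using 1 2 by linarith
    also have "\<dots> = \<rho>\<^sup>2 * (x \<bullet> x)" unfolding \<rho>2 by (simp add: algebra_simps)
    finally show "(x - (1 / K) \<cdot>\<^sub>v ?y) \<bullet> (x - (1 / K) \<cdot>\<^sub>v ?y) \<le> \<rho>\<^sup>2 * (x \<bullet> x)" .
  qed
qed

lemma pow_mat_entry_bound:
  assumes Y: "(Y :: real mat) \<in> carrier_mat n n" and \<rho>: "0 \<le> \<rho>"
    and contr: "\<And>x. x \<in> carrier_vec n \<Longrightarrow> (Y *\<^sub>v x) \<bullet> (Y *\<^sub>v x) \<le> \<rho>\<^sup>2 * (x \<bullet> x)"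
    and i: "i < n" and j: "j < n"
  shows "\<bar>(Y ^\<^sub>m k) $$ (i, j)\<bar> \<le> \<rho> ^ k"
proof -
  have *: "((Y ^\<^sub>m k) *\<^sub>v x) \<bullet> ((Y ^\<^sub>m k) *\<^sub>v x) \<le> (\<rho>\<^sup>2) ^ k * (x \<bullet> x)" if "x \<in> carrier_vec n" for x
    using that
  proof (induction k arbitrary: x)
    case 0
    then show ?case using Y by simp
  next
    case (Suc k)
    have Yx: "Y *\<^sub>v x \<in> carrier_vec n" using Y Suc.prems by simp
    have "(Y ^\<^sub>m Suc k) *\<^sub>v x = (Y ^\<^sub>m k) *\<^sub>v (Y *\<^sub>v x)"
      using assoc_mult_mat_vec[OF pow_carrier_mat[OF Y] Y Suc.prems] by simp
    then have "((Y ^\<^sub>m Suc k) *\<^sub>v x) \<bullet> ((Y ^\<^sub>m Suc k) *\<^sub>v x) \<le> (\<rho>\<^sup>2) ^ k * ((Y *\<^sub>v x) \<bullet> (Y *\<^sub>v x))"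
      using Suc.IH[OF Yx] by simp
    also have "\<dots> \<le> (\<rho>\<^sup>2) ^ k * (\<rho>\<^sup>2 * (x \<bullet> x))"
      using contr[OF Suc.prems] by (intro mult_left_mono) auto
    finally show ?case by (simp add: mult.assoc mult.left_commute)
  qed
  let ?u = "unit_vec n j :: real vec"
  let ?v = "(Y ^\<^sub>m k) *\<^sub>v ?u"
  have v: "?v \<in> carrier_vec n" using pow_carrier_mat[OF Y] by (intro mult_mat_vec_carrier) auto
  have "((Y ^\<^sub>m k) $$ (i, j))\<^sup>2 = (unit_vec n i \<bullet> ?v)\<^sup>2"
    using unit_vec_form_entry[OF pow_carrier_mat[OF Y] i j] by simp
  also have "\<dots> \<le> (unit_vec n i \<bullet> unit_vec n i) * (?v \<bullet> ?v)"
    by (rule real_scalar_prod_Cauchy_Schwarz[OF _ v]) simp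
  also have "\<dots> \<le> (\<rho>\<^sup>2) ^ k" using *[of ?u] i j by simp
  also have "\<dots> = (\<rho> ^ k)\<^sup>2" by (simp add: power_mult[symmetric] mult.commute)
  finally show ?thesis using \<rho> by (simp add: abs_le_square_iff power2_abs abs_le_square_iff[of _ "\<rho> ^ k", symmetric])
qed

text \<open>The binomial series for \<open>(I - Y)\<^sup>a\<close>, summed entrywise.\<close>

definition binomial_mat :: "real mat \<Rightarrow> real \<Rightarrow> real mat" where
  "binomial_mat Y a = mat (dim_row Y) (dim_row Y)
     (\<lambda>(i, j). \<Sum>k. (a gchoose k) * (- 1) ^ k * (Y ^\<^sub>m k) $$ (i, j))"

lemma binomial_mat_summable:
  assumes Y: "(Y :: real mat) \<in> carrier_mat n n" and \<rho>: "0 \<le> \<rho>" "\<rho> < 1"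
    and contr: "\<And>x. x \<in> carrier_vec n \<Longrightarrow> (Y *\<^sub>v x) \<bullet> (Y *\<^sub>v x) \<le> \<rho>\<^sup>2 * (x \<bullet> x)"
    and i: "i < n" and j: "j < n"
  shows "summable (\<lambda>k. \<bar>(a gchoose k) * (- 1) ^ k * (Y ^\<^sub>m k) $$ (i, j)\<bar>)"
proof (rule summable_comparison_test')
  have "summable (\<lambda>k. norm ((a gchoose k) * \<rho> ^ k))"
    using \<rho> by (intro abs_summable_in_conv_radius) (simp add: conv_radius_gchoose)
  then show "summable (\<lambda>k. \<bar>a gchoose k\<bar> * \<rho> ^ k)" using \<rho> by (simp add: abs_mult)
  show "norm \<bar>(a gchoose k) * (- 1) ^ k * (Y ^\<^sub>m k) $$ (i, j)\<bar> \<le> \<bar>a gchoose k\<bar> * \<rho> ^ k" for k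
    using mult_left_mono[OF pow_mat_entry_bound[OF Y \<rho>(1) contr i j, of k], of "\<bar>a gchoose k\<bar>"]
    by (simp add: abs_mult power_abs)
qed

lemma pow_mat_add:
  assumes Y: "(Y :: real mat) \<in> carrier_mat n n"
  shows "Y ^\<^sub>m a * Y ^\<^sub>m b = Y ^\<^sub>m (a + b)"
proof (induction b)
  case 0
  then show ?case using pow_carrier_mat[OF Y, of a] Y by simp
next
  case (Suc b)
  have "Y ^\<^sub>m a * Y ^\<^sub>m Suc b = Y ^\<^sub>m a * Y ^\<^sub>m b * Y"
    using assoc_mult_mat[OF pow_carrier_mat[OF Y, of a] pow_carrier_mat[OF Y, of b] Y] by simp
  then show ?case by (simp add: Suc)
qed

text \<open>The Cauchy product of the two series is governed by Vandermonde's identity for generalized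
  binomial coefficients.\<close>

lemma binomial_mat_mult:
  assumes Y: "(Y :: real mat) \<in> carrier_mat n n" and \<rho>: "0 \<le> \<rho>" "\<rho> < 1"
    and contr: "\<And>x. x \<in> carrier_vec n \<Longrightarrow> (Y *\<^sub>v x) \<bullet> (Y *\<^sub>v x) \<le> \<rho>\<^sup>2 * (x \<bullet> x)"
  shows "binomial_mat Y a * binomial_mat Y b = binomial_mat Y (a + b)"
proof (rule eq_matI)
  fix i j assume "i < dim_row (binomial_mat Y (a + b))" "j < dim_col (binomial_mat Y (a + b))"
  then have i: "i < n" and j: "j < n" using Y by (auto simp: binomial_mat_def)
  note summ = binomial_mat_summable[OF Y \<rho> contr]
  let ?f = "\<lambda>a i j k. (a gchoose k) * (- 1) ^ k * (Y ^\<^sub>m k) $$ (i, j)"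
  have "(binomial_mat Y a * binomial_mat Y b) $$ (i, j) =
      (\<Sum>l<n. (\<Sum>k. ?f a i l k) * (\<Sum>k. ?f b l j k))"
    using Y i j by (simp add: binomial_mat_def scalar_prod_def lessThan_atLeast0)
  also have "\<dots> = (\<Sum>l<n. \<Sum>k. \<Sum>m\<le>k. ?f a i l m * ?f b l j (k - m))"
    using summ i j by (intro sum.cong refl Cauchy_product) auto
  also have "\<dots> = (\<Sum>k. \<Sum>l<n. \<Sum>m\<le>k. ?f a i l m * ?f b l j (k - m))"
    using summ i j by (intro suminf_sum[symmetric] summable_Cauchy_product) auto
  also have "\<dots> = (\<Sum>k. ?f (a + b) i j k)"
  proof (intro suminf_cong)
    fix k
    have "(\<Sum>l<n. \<Sum>m\<le>k. ?f a i l m * ?f b l j (k - m)) =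
      (\<Sum>m\<le>k. \<Sum>l<n. (a gchoose m) * (b gchoose (k - m)) * (- 1) ^ k * ((Y ^\<^sub>m m) $$ (i, l) * (Y ^\<^sub>m (k - m)) $$ (l, j)))"
      by (subst sum.swap) (auto intro!: sum.cong simp flip: power_add)
    also have "\<dots> = (\<Sum>m\<le>k. (a gchoose m) * (b gchoose (k - m)) * (- 1) ^ k * (Y ^\<^sub>m k) $$ (i, j))"
    proof (intro sum.cong refl)
      fix m assume m: "m \<in> {..k}"
      have "(\<Sum>l<n. (Y ^\<^sub>m m) $$ (i, l) * (Y ^\<^sub>m (k - m)) $$ (l, j)) = (Y ^\<^sub>m m * Y ^\<^sub>m (k - m)) $$ (i, j)"
        using i j Y pow_carrier_mat[OF Y] by (simp add: scalar_prod_def lessThan_atLeast0)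
      also have "Y ^\<^sub>m m * Y ^\<^sub>m (k - m) = Y ^\<^sub>m k" using m pow_mat_add[OF Y] by simp
      finally show "(\<Sum>l<n. (a gchoose m) * (b gchoose (k - m)) * (- 1) ^ k * ((Y ^\<^sub>m m) $$ (i, l) * (Y ^\<^sub>m (k - m)) $$ (l, j)))
         = (a gchoose m) * (b gchoose (k - m)) * (- 1) ^ k * (Y ^\<^sub>m k) $$ (i, j)"
        by (simp flip: sum_distrib_left)
    qed
    also have "\<dots> = ?f (a + b) i j k"
      using gbinomial_Vandermonde[of a b k] by (simp add: atLeast0AtMost flip: sum_distrib_right)
    finally show "(\<Sum>l<n. \<Sum>m\<le>k. ?f a i l m * ?f b l j (k - m)) = ?f (a + b) i j k" .
  qed
  also have "\<dots> = binomial_mat Y (a + b) $$ (i, j)" using Y i j by (simp add: binomial_mat_def)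
  finally show "(binomial_mat Y a * binomial_mat Y b) $$ (i, j) = binomial_mat Y (a + b) $$ (i, j)" .
qed (simp_all add: binomial_mat_def)

lemma binomial_mat_1:
  assumes Y: "(Y :: real mat) \<in> carrier_mat n n"
  shows "binomial_mat Y 1 = 1\<^sub>m n - Y"
proof (rule eq_matI)
  fix i j assume "i < dim_row (1\<^sub>m n - Y)" "j < dim_col (1\<^sub>m n - Y)"
  then have i: "i < n" and j: "j < n" using Y by auto
  have "(1 :: real) gchoose k = 0" if "k \<notin> {0, 1}" for k
    using binomial_gbinomial[of 1 k, where 'a = real] that by (simp add: binomial_eq_0)
  then have "(\<Sum>k. ((1 :: real) gchoose k) * (- 1) ^ k * (Y ^\<^sub>m k) $$ (i, j)) =
     (\<Sum>k\<in>{0, 1}. ((1 :: real) gchoose k) * (- 1) ^ k * (Y ^\<^sub>m k) $$ (i, j))"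
    by (intro suminf_finite) auto
  then show "binomial_mat Y 1 $$ (i, j) = (1\<^sub>m n - Y) $$ (i, j)"
    using Y i j by (simp add: binomial_mat_def)
qed (use Y in \<open>simp_all add: binomial_mat_def\<close>)

lemma pow_mat_symmetric:
  assumes Y: "(Y :: real mat) \<in> carrier_mat n n" "Y\<^sup>T = Y" shows "(Y ^\<^sub>m k)\<^sup>T = Y ^\<^sub>m k"
proof (induction k)
  case (Suc k)
  have "(Y ^\<^sub>m Suc k)\<^sup>T = Y ^\<^sub>m 1 * Y ^\<^sub>m k"
    using transpose_mult[OF pow_carrier_mat[OF Y(1)] Y(1)] Suc Y by simp
  then show ?case using pow_mat_add[OF Y(1), of 1 k] by simp
qed simp

lemma binomial_mat_symmetric:
  assumes Y: "(Y :: real mat) \<in> carrier_mat n n" "Y\<^sup>T = Y"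
  shows "(binomial_mat Y a)\<^sup>T = binomial_mat Y a"
proof (rule eq_matI)
  fix i j assume "i < dim_row (binomial_mat Y a)" "j < dim_col (binomial_mat Y a)"
  then have i: "i < n" and j: "j < n" using Y by (auto simp: binomial_mat_def)
  have "(Y ^\<^sub>m k) $$ (j, i) = (Y ^\<^sub>m k) $$ (i, j)" for k
    by (rule symmetric_mat_entry[OF pow_carrier_mat[OF Y(1)] pow_mat_symmetric[OF Y] i j])
  then show "(binomial_mat Y a)\<^sup>T $$ (i, j) = binomial_mat Y a $$ (i, j)"
    using i j Y by (simp add: binomial_mat_def)
qed (simp_all add: binomial_mat_def)

lemma psd_symmetric_square:
  assumes C: "(C :: real mat) \<in> carrier_mat n n" "C\<^sup>T = C" shows "psd (C * C)"
  unfolding psd_def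
proof (intro conjI ballI)
  show "(C * C)\<^sup>T = C * C" using transpose_mult[OF C(1) C(1)] C by simp
  fix x :: "real vec" assume "x \<in> carrier_vec (dim_col (C * C))"
  then have x: "x \<in> carrier_vec n" using C by simp
  have "x \<bullet> ((C * C) *\<^sub>v x) = (C *\<^sub>v x) \<bullet> (C *\<^sub>v x)"
    using assoc_mult_mat_vec[OF C(1) C(1) x] symmetric_scalar_prod[OF C x, of "C *\<^sub>v x"] C x by simp
  then show "0 \<le> x \<bullet> ((C * C) *\<^sub>v x)" using real_scalar_prod_self_nonneg by simp
qed (use C in auto)

text \<open>Write \<open>A = K (I - Y)\<close> with a contraction \<open>Y\<close>. The exponent \<open>1/2\<close> gives a root of \<open>I - Y\<close>, and the
  exponent \<open>1/4\<close> exhibits that root as the square of a symmetric matrix, hence as positive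
  semi-definite.\<close>

lemma psd_square_root_exists:
  assumes A: "pos_def n A"
  shows "\<exists>B. psd B \<and> B * B = A"
proof -
  have Ac: "A \<in> carrier_mat n n" and As: "A\<^sup>T = A" using A by (auto simp: pos_def_def)
  obtain K \<rho> where K: "0 < K" and \<rho>: "0 \<le> \<rho>" "\<rho> < 1" and contr:
    "\<And>x. x \<in> carrier_vec n \<Longrightarrow>
      (x - (1 / K) \<cdot>\<^sub>v (A *\<^sub>v x)) \<bullet> (x - (1 / K) \<cdot>\<^sub>v (A *\<^sub>v x)) \<le> \<rho>\<^sup>2 * (x \<bullet> x)"
    using pd_contraction[OF A] by blast
  define Y where "Y = 1\<^sub>m n - (1 / K) \<cdot>\<^sub>m A"
  have Y: "Y \<in> carrier_mat n n" "Y\<^sup>T = Y"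
  proof -
    show "Y \<in> carrier_mat n n" using Ac by (auto simp: Y_def)
    show "Y\<^sup>T = Y"
    proof (rule eq_matI)
      fix i j assume ij: "i < dim_row Y" "j < dim_col Y"
      then have ij: "i < n" "j < n" using Ac by (auto simp: Y_def)
      then have "A $$ (j, i) = A $$ (i, j)" by (rule symmetric_mat_entry[OF Ac As])
      then show "Y\<^sup>T $$ (i, j) = Y $$ (i, j)" using ij Ac by (simp add: Y_def)
    qed (use Ac in \<open>simp_all add: Y_def\<close>)
  qed
  have Yx: "Y *\<^sub>v x = x - (1 / K) \<cdot>\<^sub>v (A *\<^sub>v x)" if x: "x \<in> carrier_vec n" for x
  proof -
    have "((1 / K) \<cdot>\<^sub>m A) *\<^sub>v x = (1 / K) \<cdot>\<^sub>v (A *\<^sub>v x)" using x Ac by (intro eq_vecI) auto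
    then show ?thesis
      unfolding Y_def using minus_mult_distrib_mat_vec[of "1\<^sub>m n" n n "(1 / K) \<cdot>\<^sub>m A" x] x Ac by simp
  qed
  have Yc: "(Y *\<^sub>v x) \<bullet> (Y *\<^sub>v x) \<le> \<rho>\<^sup>2 * (x \<bullet> x)" if "x \<in> carrier_vec n" for x
    using contr[OF that] by (simp add: Yx[OF that])
  have mult: "binomial_mat Y a * binomial_mat Y b = binomial_mat Y (a + b)" for a b
    by (rule binomial_mat_mult[OF Y(1) \<rho> Yc])
  define S where "S = binomial_mat Y (1 / 2)"
  have Sc: "S \<in> carrier_mat n n" using Y by (auto simp: S_def binomial_mat_def)
  have "S * S = 1\<^sub>m n - Y" unfolding S_def mult by (simp add: binomial_mat_1[OF Y(1)])
  also have "\<dots> = (1 / K) \<cdot>\<^sub>m A" using Ac by (intro eq_matI) (auto simp: Y_def)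
  finally have SS: "S * S = (1 / K) \<cdot>\<^sub>m A" .
  have "psd (binomial_mat Y (1 / 4) * binomial_mat Y (1 / 4))"
    using Y by (intro psd_symmetric_square[of _ n] binomial_mat_symmetric) (auto simp: binomial_mat_def)
  then have "psd S" unfolding S_def mult by simp
  then have "psd (sqrt K \<cdot>\<^sub>m S)"
    unfolding psd_def
  proof (intro conjI ballI; elim conjE)
    assume S: "S\<^sup>T = S" "\<forall>x\<in>carrier_vec (dim_col S). 0 \<le> x \<bullet> (S *\<^sub>v x)"
    have "(sqrt K \<cdot>\<^sub>m S)\<^sup>T = sqrt K \<cdot>\<^sub>m S\<^sup>T" by (intro eq_matI) auto
    then show "(sqrt K \<cdot>\<^sub>m S)\<^sup>T = sqrt K \<cdot>\<^sub>m S" using S(1) by simp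
    fix x :: "real vec" assume "x \<in> carrier_vec (dim_col (sqrt K \<cdot>\<^sub>m S))"
    then have x: "x \<in> carrier_vec n" using Sc by simp
    have "(sqrt K \<cdot>\<^sub>m S) *\<^sub>v x = sqrt K \<cdot>\<^sub>v (S *\<^sub>v x)" using Sc x by (intro eq_vecI) auto
    then show "0 \<le> x \<bullet> ((sqrt K \<cdot>\<^sub>m S) *\<^sub>v x)" using S(2) Sc x K by simp
  qed simp
  moreover have "(sqrt K \<cdot>\<^sub>m S) * (sqrt K \<cdot>\<^sub>m S) = A"
  proof -
    have "(sqrt K \<cdot>\<^sub>m S) * (sqrt K \<cdot>\<^sub>m S) = sqrt K \<cdot>\<^sub>m (sqrt K \<cdot>\<^sub>m (S * S))"
      unfolding mult_smult_distrib[OF smult_carrier_mat[OF Sc] Sc] mult_smult_assoc_mat[OF Sc Sc] ..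
    also have "\<dots> = A"
    proof -
      have "sqrt K * (sqrt K * a) / K = a" for a :: real
        using K by (simp add: mult.assoc[symmetric])
      then show ?thesis unfolding SS using Ac by (intro eq_matI) auto
    qed
    finally show ?thesis .
  qed
  ultimately show ?thesis by blast
qed

lemma msqrt_pd:
  assumes A: "pos_def n A"
  shows "pos_def n (msqrt A)" "msqrt A * msqrt A = A"
proof -
  have "psd (msqrt A) \<and> msqrt A * msqrt A = A"
    unfolding msqrt_def
    by (rule theI') (use psd_square_root_exists[OF A] psd_square_root_unique[OF A] in blast)
  then show "pos_def n (msqrt A)" "msqrt A * msqrt A = A" using psd_square_root_pd[OF A] by auto
qed

text \<open>The inverse of \<open>A\<^sup>1\<^sup>/\<^sup>2\<close> is a positive definite root of \<open>A\<^sup>-\<^sup>1\<close>, so by uniqueness it is \<open>A\<^sup>-\<^sup>1\<^sup>/\<^sup>2\<close>.\<close>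

lemma inv_msqrt_pd:
  assumes A: "pos_def n A"
  shows "pos_def n (inv_msqrt A)" "inv_msqrt A * msqrt A = 1\<^sub>m n" "msqrt A * inv_msqrt A = 1\<^sub>m n"
proof -
  have Ac: "A \<in> carrier_mat n n" using A by (auto simp: pos_def_def)
  obtain M where M: "mat_inverse A = Some M" "A * M = 1\<^sub>m n" "pos_def n M" using pd_inverse[OF A] by metis
  then have Mc: "M \<in> carrier_mat n n" by (auto simp: pos_def_def)
  let ?L = "msqrt A"
  have Lc: "?L \<in> carrier_mat n n" using msqrt_pd[OF A] by (auto simp: pos_def_def)
  obtain L' where L': "?L * L' = 1\<^sub>m n" "L' * ?L = 1\<^sub>m n" "pos_def n L'"
    using pd_inverse[OF msqrt_pd(1)[OF A]] by metis
  then have L'c: "L' \<in> carrier_mat n n" by (auto simp: pos_def_def)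
  have "L' * L' * A = L' * (L' * (?L * ?L))"
    using msqrt_pd(2)[OF A] assoc_mult_mat[OF L'c L'c Ac] by simp
  also have "L' * (?L * ?L) = ?L" using assoc_mult_mat[OF L'c Lc Lc] L'(2) Lc by simp
  finally have "L' * L' * A = 1\<^sub>m n" using L' by simp
  then have "L' * L' * A * M = M" using Mc by simp
  then have "L' * L' = M"
    using assoc_mult_mat[OF mult_carrier_mat[OF L'c L'c] Ac Mc] M(2) right_mult_one_mat[OF mult_carrier_mat[OF L'c L'c]] by simp
  then have "msqrt M = L'"
    using psd_square_root_unique[OF M(3)] msqrt_pd[OF M(3)] L'(3) pd_imp_psd by metis
  then have "inv_msqrt A = L'" using M(1) by (simp add: inv_msqrt_def)
  then show "pos_def n (inv_msqrt A)" "inv_msqrt A * msqrt A = 1\<^sub>m n" "msqrt A * inv_msqrt A = 1\<^sub>m n"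
    using L' by auto
qed

section \<open>Standardized linear-quadratic scores\<close>

lemma space_borel_vec [simp]: "space (borel_vec d) = carrier_vec d"
  by (simp add: borel_vec_def)

lemma measurable_vec_index [measurable]:
  assumes "i < d" shows "(\<lambda>v. v $ i) \<in> borel_measurable (borel_vec d)"
proof -
  let ?f = "\<lambda>v. \<lambda>i\<in>{..<d}. v $ i :: real"
  have "?f \<in> borel_vec d \<rightarrow>\<^sub>M (\<Pi>\<^sub>M i\<in>{..<d}. borel)"
    unfolding borel_vec_def by (rule measurable_vimage_algebra1) (auto simp: space_PiM)
  then have "(\<lambda>v. ?f v i) \<in> borel_measurable (borel_vec d)"
    by (rule measurable_compose) (use assms in \<open>auto intro: measurable_component_singleton\<close>)
  then show ?thesis using assms by simp
qed

lemma measurable_borel_vecI: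
  assumes "\<And>x. x \<in> space M \<Longrightarrow> h x \<in> carrier_vec d"
    and "\<And>i. i < d \<Longrightarrow> (\<lambda>x. h x $ i) \<in> borel_measurable M"
  shows "h \<in> M \<rightarrow>\<^sub>M borel_vec d"
  unfolding borel_vec_def
  by (rule measurable_vimage_algebra2) (use assms in \<open>auto intro!: measurable_restrict\<close>)

lemma mult_mat_vec_index_sum:
  assumes "A \<in> carrier_mat n m" "x \<in> carrier_vec m" "i < n"
  shows "(A *\<^sub>v x) $ i = (\<Sum>j<m. A $$ (i, j) * x $ j)"
  using assms by (simp add: scalar_prod_def lessThan_atLeast0)

lemma scalar_prod_sum:
  "y \<in> carrier_vec n \<Longrightarrow> x \<bullet> y = (\<Sum>i<n. x $ i * y $ i)"
  by (simp add: scalar_prod_def lessThan_atLeast0)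

lemma mvnormal_standardize_measurable:
  assumes \<mu>: "\<mu> \<in> carrier_vec d" and L: "msqrt S \<in> carrier_mat d d"
  shows "(\<lambda>g. \<mu> + msqrt S *\<^sub>v vec d g) \<in> gauss d \<rightarrow>\<^sub>M borel_vec d"
proof (rule measurable_borel_vecI)
  show "\<mu> + msqrt S *\<^sub>v vec d g \<in> carrier_vec d" for g using \<mu> L by simp
  fix i assume i: "i < d"
  have "(\<mu> + msqrt S *\<^sub>v vec d g) $ i = \<mu> $ i + (\<Sum>j<d. msqrt S $$ (i, j) * g j)" for g
    using i \<mu> L mult_mat_vec_index_sum[OF L, of "vec d g" i] by simp
  then show "(\<lambda>g. (\<mu> + msqrt S *\<^sub>v vec d g) $ i) \<in> borel_measurable (gauss d)" by simp
qed

lemma mvnormal_alt: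
  assumes "\<mu> \<in> carrier_vec d"
  shows "mvnormal \<mu> S = distr (gauss d) (borel_vec d) (\<lambda>g. \<mu> + msqrt S *\<^sub>v vec d g)"
  using assms by (simp add: mvnormal_def gauss_def Let_def)

lemma lin_quad_linear_combination:
  "(\<Sum>a<m. w a * lin_quad d (c a) (B a) g) =
   lin_quad d (\<lambda>i. \<Sum>a<m. w a * c a i) (\<lambda>i j. \<Sum>a<m. w a * B a i j) g"
proof -
  have "(\<Sum>a<m. w a * (\<Sum>i<d. c a i * g i)) = (\<Sum>i<d. (\<Sum>a<m. w a * c a i) * g i)"
    unfolding sum_distrib_left sum_distrib_right by (subst sum.swap) (simp add: mult.assoc)
  moreover have "(\<Sum>a<m. w a * (\<Sum>i<d. B a i i)) = (\<Sum>i<d. \<Sum>a<m. w a * B a i i)"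
    unfolding sum_distrib_left by (rule sum.swap)
  moreover have "(\<Sum>a<m. w a * (\<Sum>i<d. \<Sum>j<d. B a i j * g i * g j)) =
      (\<Sum>i<d. \<Sum>j<d. (\<Sum>a<m. w a * B a i j) * g i * g j)"
  proof -
    have "(\<Sum>a<m. w a * (\<Sum>i<d. \<Sum>j<d. B a i j * g i * g j)) =
      (\<Sum>i<d. \<Sum>a<m. \<Sum>j<d. w a * (B a i j * g i * g j))"
      unfolding sum_distrib_left by (rule sum.swap)
    also have "\<dots> = (\<Sum>i<d. \<Sum>j<d. \<Sum>a<m. w a * (B a i j * g i * g j))"
      by (intro sum.cong refl sum.swap)
    finally show ?thesis by (simp add: sum_distrib_right mult.assoc)
  qed
  moreover have "(\<Sum>a<m. w a * lin_quad d (c a) (B a) g) =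
      (\<Sum>a<m. w a * (\<Sum>i<d. c a i * g i)) +
      ((\<Sum>a<m. w a * (\<Sum>i<d. \<Sum>j<d. B a i j * g i * g j)) - (\<Sum>a<m. w a * (\<Sum>i<d. B a i i))) / 2"
  proof -
    have expand: "u * (p + (q - r) / 2) = u * p + (u * q - u * r) / 2" for u p q r :: real
      by (simp add: field_simps)
    show ?thesis
      unfolding lin_quad_def expand by (simp only: sum.distrib sum_subtractf flip: sum_divide_distrib)
  qed
  ultimately show ?thesis unfolding lin_quad_def by simp
qed

text \<open>A score vector \<open>f y\<close> with \<open>m\<close> entries, each of which is a linear-quadratic statistic of the
  standard normal vector \<open>g\<close> when \<open>y = \<mu> + S\<^sup>1\<^sup>/\<^sup>2 g\<close>. Both the score for the variance parameters
  alone and the joint score are of this kind.\<close>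

locale lin_quad_score =
  fixes d m :: nat and \<mu> :: "real vec" and S :: "real mat" and f :: "real vec \<Rightarrow> real vec"
    and c :: "nat \<Rightarrow> nat \<Rightarrow> real" and B :: "nat \<Rightarrow> nat \<Rightarrow> nat \<Rightarrow> real"
  assumes mu: "\<mu> \<in> carrier_vec d" and L: "msqrt S \<in> carrier_mat d d"
    and f_carrier: "\<And>y. f y \<in> carrier_vec m"
    and f_meas: "\<And>a. a < m \<Longrightarrow> (\<lambda>y. f y $ a) \<in> borel_measurable (borel_vec d)"
    and f_lin_quad: "\<And>a g. a < m \<Longrightarrow> f (\<mu> + msqrt S *\<^sub>v vec d g) $ a = lin_quad d (c a) (B a) g"
    and B_sym: "\<And>a i j. a < m \<Longrightarrow> i < d \<Longrightarrow> j < d \<Longrightarrow> B a i j = B a j i"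
begin

definition c_comb :: "real vec \<Rightarrow> nat \<Rightarrow> real" where
  "c_comb w i = (\<Sum>a<m. w $ a * c a i)"

definition B_comb :: "real vec \<Rightarrow> nat \<Rightarrow> nat \<Rightarrow> real" where
  "B_comb w i j = (\<Sum>a<m. w $ a * B a i j)"

definition info :: "real mat" where
  "info = cov_mat (mvnormal \<mu> S) m f"

lemma B_comb_sym: "i < d \<Longrightarrow> j < d \<Longrightarrow> B_comb w i j = B_comb w j i"
  unfolding B_comb_def by (intro sum.cong refl) (simp add: B_sym)

lemma score_direction:
  "(\<Sum>a<m. w $ a * lin_quad d (c a) (B a) g) = lin_quad d (c_comb w) (B_comb w) g"
  unfolding lin_quad_linear_combination c_comb_def[abs_def] B_comb_def[abs_def] ..

lemma info_entry:
  assumes "a < m" "b < m"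
  shows "info $$ (a, b) = (\<integral>g. lin_quad d (c a) (B a) g * lin_quad d (c b) (B b) g \<partial>gauss d)"
proof -
  note h = mvnormal_standardize_measurable[OF mu L]
  note [measurable] = f_meas[OF assms(1)] f_meas[OF assms(2)]
  have mean: "(\<integral>x. f x $ e \<partial>mvnormal \<mu> S) = 0" if "e < m" for e
    using that f_meas[OF that] unfolding mvnormal_alt[OF mu]
    by (subst integral_distr[OF h]) (simp_all add: f_lin_quad lin_quad_mean)
  have "info $$ (a, b) = (\<integral>y. f y $ a * f y $ b \<partial>mvnormal \<mu> S)"
    using assms by (simp add: info_def cov_mat_def mean)
  also have "\<dots> = (\<integral>g. lin_quad d (c a) (B a) g * lin_quad d (c b) (B b) g \<partial>gauss d)"
    unfolding mvnormal_alt[OF mu]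
    using assms by (subst integral_distr[OF h]) (simp_all add: f_lin_quad)
  finally show ?thesis .
qed

lemma info_carrier: "info \<in> carrier_mat m m"
  by (simp add: info_def cov_mat_def)

text \<open>The information in the direction \<open>w\<close> is the variance of the score in that direction, which is
  a single linear-quadratic statistic.\<close>

lemma info_form:
  assumes w: "w \<in> carrier_vec m"
  shows "w \<bullet> (info *\<^sub>v w) = (\<Sum>i<d. (c_comb w i)\<^sup>2) + (\<Sum>i<d. \<Sum>j<d. (B_comb w i j)\<^sup>2) / 2"
proof -
  let ?T = "\<lambda>a. lin_quad d (c a) (B a)"
  have t: "tame d (\<lambda>g. w $ a * ?T a g * (w $ b * ?T b g))" for a b by auto
  have "w \<bullet> (info *\<^sub>v w) = (\<Sum>a<m. \<Sum>b<m. w $ a * (info $$ (a, b) * w $ b))"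
    using mult_mat_vec_carrier[OF info_carrier w]
    by (simp add: scalar_prod_sum mult_mat_vec_index_sum[OF info_carrier w] sum_distrib_left)
  also have "\<dots> = (\<Sum>a<m. \<Sum>b<m. \<integral>g. w $ a * ?T a g * (w $ b * ?T b g) \<partial>gauss d)"
  proof (intro sum.cong refl)
    fix a b assume "a \<in> {..<m}" "b \<in> {..<m}"
    then have "w $ a * (info $$ (a, b) * w $ b) = (w $ a * w $ b) * (\<integral>g. ?T a g * ?T b g \<partial>gauss d)"
      by (simp add: info_entry)
    also have "\<dots> = (\<integral>g. (w $ a * w $ b) * (?T a g * ?T b g) \<partial>gauss d)" by simp
    finally show "w $ a * (info $$ (a, b) * w $ b) = (\<integral>g. w $ a * ?T a g * (w $ b * ?T b g) \<partial>gauss d)"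
      by (simp only: mult_ac)
  qed
  also have "\<dots> = (\<Sum>a<m. \<integral>g. (\<Sum>b<m. w $ a * ?T a g * (w $ b * ?T b g)) \<partial>gauss d)"
    by (intro sum.cong refl Bochner_Integration.integral_sum[symmetric] integrable_tame t)
  also have "\<dots> = (\<integral>g. (\<Sum>a<m. \<Sum>b<m. w $ a * ?T a g * (w $ b * ?T b g)) \<partial>gauss d)"
    by (intro Bochner_Integration.integral_sum[symmetric] integrable_tame tame_sum t)
  also have "\<dots> = (\<integral>g. (lin_quad d (c_comb w) (B_comb w) g)\<^sup>2 \<partial>gauss d)"
    unfolding score_direction[symmetric] power2_eq_square sum_product ..
  also have "\<dots> = (\<Sum>i<d. (c_comb w i)\<^sup>2) + (\<Sum>i<d. \<Sum>j<d. (B_comb w i j)\<^sup>2) / 2"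
    by (rule lin_quad_second_moment[OF B_comb_sym])
  finally show ?thesis .
qed

lemma info_pd:
  assumes "\<And>w. w \<in> carrier_vec m \<Longrightarrow> w \<noteq> 0\<^sub>v m \<Longrightarrow>
    0 < (\<Sum>i<d. (c_comb w i)\<^sup>2) + (\<Sum>i<d. \<Sum>j<d. (B_comb w i j)\<^sup>2) / 2"
  shows "pos_def m info"
proof -
  have "info\<^sup>T = info"
    by (rule eq_matI) (use info_carrier in \<open>simp_all add: info_entry mult.commute\<close>)
  then show ?thesis unfolding pos_def_def using info_carrier assms by (simp add: info_form)
qed

text \<open>The standardized score in the direction \<open>u\<close> is the score itself in the direction
  \<open>w = J\<^sup>-\<^sup>1\<^sup>/\<^sup>2 u\<close>, where \<open>J\<close> is the information, and its variance is \<open>w \<bullet> J w = u \<bullet> u = 1\<close>.\<close>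

lemma standardized_direction:
  assumes pd: "pos_def m info" and u: "u \<in> unit_sphere m"
  defines "w \<equiv> inv_msqrt info *\<^sub>v u"
  shows "w \<in> carrier_vec m" "x \<in> carrier_vec m \<Longrightarrow> u \<bullet> (inv_msqrt info *\<^sub>v x) = w \<bullet> x"
    "(\<Sum>i<d. (c_comb w i)\<^sup>2) + (\<Sum>i<d. \<Sum>j<d. (B_comb w i j)\<^sup>2) / 2 = 1"
proof -
  let ?K = "inv_msqrt info" and ?L = "msqrt info"
  have K: "?K \<in> carrier_mat m m" "?K\<^sup>T = ?K" and L: "?L \<in> carrier_mat m m"
    using inv_msqrt_pd(1)[OF pd] msqrt_pd(1)[OF pd] by (auto simp: pos_def_def)
  have uc: "u \<in> carrier_vec m" and u1: "u \<bullet> u = 1"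
    using u real_scalar_prod_self_nonneg[of u] by (auto simp: unit_sphere_def vnorm_def)
  show wc: "w \<in> carrier_vec m" using K uc by (simp add: w_def)
  show *: "u \<bullet> (?K *\<^sub>v x) = w \<bullet> x" if "x \<in> carrier_vec m" for x
    unfolding w_def by (rule symmetric_scalar_prod[OF K uc that, symmetric])
  have LK: "?L *\<^sub>v (?K *\<^sub>v u) = u" "?K *\<^sub>v (?L *\<^sub>v u) = u"
    using assoc_mult_mat_vec[OF L K(1) uc] assoc_mult_mat_vec[OF K(1) L uc] inv_msqrt_pd(2,3)[OF pd] uc by simp_all
  have "info *\<^sub>v w = ?L *\<^sub>v u"
    using assoc_mult_mat_vec[OF L L wc] msqrt_pd(2)[OF pd] LK(1) by (simp add: w_def)
  then have "w \<bullet> (info *\<^sub>v w) = u \<bullet> u"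
    using *[of "?L *\<^sub>v u"] L uc LK(2) by simp
  then show "(\<Sum>i<d. (c_comb w i)\<^sup>2) + (\<Sum>i<d. \<Sum>j<d. (B_comb w i j)\<^sup>2) / 2 = 1"
    using info_form[OF wc] u1 by simp
qed

text \<open>The bound on the operator norm is required relative to the Frobenius norm. As the variance
  in the standardized direction is 1, half the squared Frobenius norm is at most 1, which is
  where the factor \<open>sqrt 2\<close> comes from.\<close>

lemma standardized_score_close_to_normal:
  assumes pos: "\<And>w. w \<in> carrier_vec m \<Longrightarrow> w \<noteq> 0\<^sub>v m \<Longrightarrow>
      0 < (\<Sum>i<d. (c_comb w i)\<^sup>2) + (\<Sum>i<d. \<Sum>j<d. (B_comb w i j)\<^sup>2) / 2"
    and op: "\<And>w x. w \<in> carrier_vec m \<Longrightarrow>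
      (\<Sum>i<d. (\<Sum>j<d. B_comb w i j * x j)\<^sup>2) \<le>
      \<epsilon>\<^sup>2 * (\<Sum>i<d. \<Sum>j<d. (B_comb w i j)\<^sup>2) * (\<Sum>j<d. (x j)\<^sup>2)"
    and \<epsilon>: "0 \<le> \<epsilon>"
    and Y: "normal_vector M Y \<mu> S" and u: "u \<in> unit_sphere m"
  shows "real_distribution (distr M borel (\<lambda>\<omega>. u \<bullet> (inv_msqrt info *\<^sub>v f (Y \<omega>))))"
    and "cmod (char (distr M borel (\<lambda>\<omega>. u \<bullet> (inv_msqrt info *\<^sub>v f (Y \<omega>)))) t - exp (- t\<^sup>2 / 2))
      \<le> 3 / 2 * (sqrt 2 * \<epsilon>) * t\<^sup>2"
proof -
  define w where "w = inv_msqrt info *\<^sub>v u"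
  have pd: "pos_def m info" by (rule info_pd[OF pos])
  note w = standardized_direction[OF pd u, folded w_def]
  let ?T = "\<lambda>y. \<Sum>a<m. w $ a * f y $ a"
  have T: "u \<bullet> (inv_msqrt info *\<^sub>v f y) = ?T y" for y
    using w(2)[OF f_carrier] scalar_prod_sum[OF f_carrier] by simp
  have T_meas: "?T \<in> borel_measurable (borel_vec d)"
    using f_meas by (intro borel_measurable_sum borel_measurable_times) auto
  have dim: "dim_vec \<mu> = d" using mu by simp
  have Ym: "Y \<in> M \<rightarrow>\<^sub>M borel_vec d" and Yd: "distr M (borel_vec d) Y = mvnormal \<mu> S"
    and M: "prob_space M"
    using Y by (auto simp: normal_vector_def dim)
  have TY: "(\<lambda>\<omega>. ?T (Y \<omega>)) \<in> borel_measurable M" by (rule measurable_compose[OF Ym T_meas])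
  have "distr M borel (\<lambda>\<omega>. ?T (Y \<omega>)) = distr (mvnormal \<mu> S) borel ?T"
    unfolding Yd[symmetric] using distr_distr[OF T_meas Ym] by (simp add: o_def)
  also have "\<dots> = distr (gauss d) borel (\<lambda>g. ?T (\<mu> + msqrt S *\<^sub>v vec d g))"
    unfolding mvnormal_alt[OF mu] using distr_distr[OF T_meas mvnormal_standardize_measurable[OF mu L]]
    by (simp add: o_def)
  also have "\<dots> = distr (gauss d) borel (lin_quad d (c_comb w) (B_comb w))"
    by (simp add: f_lin_quad score_direction)
  finally have law: "distr M borel (\<lambda>\<omega>. u \<bullet> (inv_msqrt info *\<^sub>v f (Y \<omega>))) =
      distr (gauss d) borel (lin_quad d (c_comb w) (B_comb w))"
    unfolding T .
  show "real_distribution (distr M borel (\<lambda>\<omega>. u \<bullet> (inv_msqrt info *\<^sub>v f (Y \<omega>))))"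
    unfolding T by (rule prob_space.real_distribution_distr[OF M TY])
  show "cmod (char (distr M borel (\<lambda>\<omega>. u \<bullet> (inv_msqrt info *\<^sub>v f (Y \<omega>)))) t - exp (- t\<^sup>2 / 2))
      \<le> 3 / 2 * (sqrt 2 * \<epsilon>) * t\<^sup>2"
    unfolding law
  proof (rule char_lin_quad_close_to_normal[OF B_comb_sym w(3)])
    fix x
    have "(\<Sum>i<d. \<Sum>j<d. (B_comb w i j)\<^sup>2) \<le> 2"
      using w(3) sum_nonneg[of "{..<d}" "\<lambda>i. (c_comb w i)\<^sup>2"] by simp
    then have "\<epsilon>\<^sup>2 * (\<Sum>i<d. \<Sum>j<d. (B_comb w i j)\<^sup>2) * (\<Sum>j<d. (x j)\<^sup>2) \<le> \<epsilon>\<^sup>2 * 2 * (\<Sum>j<d. (x j)\<^sup>2)"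
      by (intro mult_right_mono mult_left_mono sum_nonneg) auto
    then show "(\<Sum>i<d. (\<Sum>j<d. B_comb w i j * x j)\<^sup>2) \<le> (sqrt 2 * \<epsilon>)\<^sup>2 * (\<Sum>j<d. (x j)\<^sup>2)"
      using op[OF w(1), of x] by (simp add: power_mult_distrib ac_simps)
  qed (use \<epsilon> in auto)
qed

end

section \<open>Spectral norm and rank\<close>

lemma sum_lessThan_add:
  fixes h :: "nat \<Rightarrow> 'a::comm_monoid_add"
  shows "(\<Sum>a<p + r. h a) = (\<Sum>a<p. h a) + (\<Sum>j<r. h (p + j))"
  by (induction r) (simp_all add: add.assoc)

lemma unit_vec_unit_sphere: "i < d \<Longrightarrow> unit_vec d i \<in> unit_sphere d"
  by (simp add: unit_sphere_def vnorm_def)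

lemma vnorm_le_frobenius:
  assumes A: "A \<in> carrier_mat n m" and x: "x \<in> unit_sphere m"
  shows "vnorm (A *\<^sub>v x) \<le> frobenius_norm A"
proof -
  have xc: "x \<in> carrier_vec m" and x1: "x \<bullet> x = 1" using x by (auto simp: unit_sphere_def vnorm_def)
  have "(A *\<^sub>v x) \<bullet> (A *\<^sub>v x) \<le> (frobenius_norm A)\<^sup>2"
    using mult_mat_vec_bounded[OF A xc] x1 by simp
  then show ?thesis unfolding vnorm_def by (rule real_le_lsqrt[OF frobenius_norm_nonneg])
qed

lemma bdd_above_spectral:
  assumes "A \<in> carrier_mat n m"
  shows "bdd_above ((\<lambda>x. vnorm (A *\<^sub>v x)) ` unit_sphere (dim_col A))"
  using vnorm_le_frobenius[OF assms] assms by (auto intro!: bdd_aboveI2)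

lemma spectral_norm_upper:
  assumes A: "A \<in> carrier_mat n m" and x: "x \<in> unit_sphere m"
  shows "vnorm (A *\<^sub>v x) \<le> spectral_norm A"
  unfolding spectral_norm_def by (rule cSUP_upper[OF _ bdd_above_spectral[OF A]]) (use A x in auto)

lemma spectral_norm_nonneg:
  assumes A: "A \<in> carrier_mat n m" and m: "0 < m" shows "0 \<le> spectral_norm A"
proof -
  have "0 \<le> vnorm (A *\<^sub>v unit_vec m 0)" by (simp add: vnorm_def real_scalar_prod_self_nonneg)
  also have "\<dots> \<le> spectral_norm A" by (rule spectral_norm_upper[OF A unit_vec_unit_sphere[OF m]])
  finally show ?thesis .
qed

lemma spectral_norm_le_frobenius:
  assumes A: "A \<in> carrier_mat n m" and m: "0 < m" shows "spectral_norm A \<le> frobenius_norm A"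
  unfolding spectral_norm_def
  by (rule cSUP_least) (use A m vnorm_le_frobenius[OF A] unit_vec_unit_sphere[OF m] in auto)

lemma normalize_vec:
  assumes x: "(x :: real vec) \<in> carrier_vec m" and nz: "x \<noteq> 0\<^sub>v m"
  obtains s y where "0 < s" "y \<in> unit_sphere m" "x = s \<cdot>\<^sub>v y" "s\<^sup>2 = x \<bullet> x"
proof -
  have "x \<bullet> x \<noteq> 0" using real_scalar_prod_self_eq_0[OF x] nz by blast
  then have p: "0 < x \<bullet> x" using real_scalar_prod_self_nonneg[of x] by simp
  let ?s = "sqrt (x \<bullet> x)"
  have s: "0 < ?s" "?s\<^sup>2 = x \<bullet> x" using p by simp_all
  have "vnorm ((1 / ?s) \<cdot>\<^sub>v x) = 1"
    using x p by (simp add: vnorm_def power2_eq_square[symmetric])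
  then have "(1 / ?s) \<cdot>\<^sub>v x \<in> unit_sphere m" using x by (simp add: unit_sphere_def)
  moreover have "x = ?s \<cdot>\<^sub>v ((1 / ?s) \<cdot>\<^sub>v x)" using s x by (intro eq_vecI) auto
  ultimately show thesis using s by (intro that)
qed

lemma spectral_norm_bound:
  assumes A: "A \<in> carrier_mat n m" and x: "x \<in> carrier_vec m"
  shows "(A *\<^sub>v x) \<bullet> (A *\<^sub>v x) \<le> (spectral_norm A)\<^sup>2 * (x \<bullet> x)"
proof (cases "x = 0\<^sub>v m")
  case True
  then have "A *\<^sub>v x = 0\<^sub>v n" using A by (intro eq_vecI) auto
  then show ?thesis using True by simp
next
  case False
  then obtain s y where s: "0 < s" "y \<in> unit_sphere m" "x = s \<cdot>\<^sub>v y" "s\<^sup>2 = x \<bullet> x"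
    using normalize_vec[OF x] by metis
  have yc: "y \<in> carrier_vec m" using s by (simp add: unit_sphere_def)
  have "0 \<le> vnorm (A *\<^sub>v y)" by (simp add: vnorm_def real_scalar_prod_self_nonneg)
  then have "(vnorm (A *\<^sub>v y))\<^sup>2 \<le> (spectral_norm A)\<^sup>2"
    using spectral_norm_upper[OF A s(2)] by (intro power_mono) auto
  then have le: "(A *\<^sub>v y) \<bullet> (A *\<^sub>v y) \<le> (spectral_norm A)\<^sup>2"
    by (simp add: vnorm_def real_scalar_prod_self_nonneg)
  have "A *\<^sub>v x = s \<cdot>\<^sub>v (A *\<^sub>v y)" using A yc s by (simp add: mult_mat_vec)
  then have "(A *\<^sub>v x) \<bullet> (A *\<^sub>v x) = s\<^sup>2 * ((A *\<^sub>v y) \<bullet> (A *\<^sub>v y))"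
    using A yc by (simp add: power2_eq_square)
  also have "\<dots> \<le> s\<^sup>2 * (spectral_norm A)\<^sup>2" using le by (intro mult_left_mono) auto
  finally show ?thesis using s(4) by (simp add: mult.commute)
qed

text \<open>A matrix with repeated columns has a rank below the number of its columns, so the columns
  are distinct and linearly independent.\<close>

lemma full_rank_injective:
  fixes X :: "real mat"
  assumes X: "X \<in> carrier_mat n p" and rank: "vec_space.rank n X = p"
    and v: "v \<in> carrier_vec p" and Xv: "X *\<^sub>v v = 0\<^sub>v n"
  shows "v = 0\<^sub>v p"
proof (rule ccontr)
  assume nz: "v \<noteq> 0\<^sub>v p"
  interpret vec_space "TYPE(real)" n .
  have distinct: "distinct (cols X)"
  proof (rule ccontr)
    assume nd: "\<not> distinct (cols X)"
    obtain T where T: "maximal T (\<lambda>T. T \<subseteq> set (cols X) \<and> lin_indpt T)"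
      using maximal_exists[of "(\<lambda>T. T \<subseteq> set (cols X) \<and> lin_indpt T)" "card (set (cols X))" "{}"]
      by (meson List.finite_set card_mono empty_iff empty_subsetI finite_lin_indpt2 rev_finite_subset)
    then have "card T \<le> card (set (cols X))" by (simp add: card_mono maximal_def)
    moreover have "card (set (cols X)) < p"
      using nd X card_distinct[of "cols X"] card_length[of "cols X"] by (auto simp: le_less)
    ultimately show False using rank_card_indpt[OF X T] rank by simp
  qed
  then have "lin_indpt (set (cols X))" by (rule full_rank_lin_indpt[OF X rank])
  then show False using lin_depI[OF X v nz Xv distinct] by blast
qed

section \<open>The Gaussian covariance model\<close>

locale covariance_model =
  fixes n p q r :: nat and X Z :: "real mat" and \<Psi> :: "real vec \<Rightarrow> real mat" and \<psi> :: "real vec"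
  assumes X: "X \<in> carrier_mat n p" and Z: "Z \<in> carrier_mat n q"
    and pattern: "covariance_pattern q r \<Psi>" and psi: "\<psi> \<in> parameter_set r \<Psi>"
begin

abbreviation "\<Sigma> \<equiv> Sigma_mat Z \<Psi> \<psi>"

lemma psi_carrier: "\<psi> \<in> carrier_vec r" and r_pos: "0 < r"
  using psi pattern by (auto simp: parameter_set_def covariance_pattern_def)

lemma Psi_carrier: "v \<in> carrier_vec r \<Longrightarrow> \<Psi> v \<in> carrier_mat q q"
  and Psi_sym: "v \<in> carrier_vec r \<Longrightarrow> (\<Psi> v)\<^sup>T = \<Psi> v"
  using pattern by (auto simp: covariance_pattern_def)

lemma Sigma_carrier: "v \<in> carrier_vec r \<Longrightarrow> Sigma_mat Z \<Psi> v \<in> carrier_mat n n"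
  using Z Psi_carrier by (auto simp: Sigma_mat_def)

lemma Sigma_sym:
  assumes v: "v \<in> carrier_vec r" shows "(Sigma_mat Z \<Psi> v)\<^sup>T = Sigma_mat Z \<Psi> v"
proof -
  have ZP: "Z * \<Psi> v \<in> carrier_mat n q" using Z Psi_carrier[OF v] by simp
  have "(Z * \<Psi> v * Z\<^sup>T)\<^sup>T = Z * (\<Psi> v * Z\<^sup>T)"
    using transpose_mult[OF ZP, of "Z\<^sup>T" n] transpose_mult[OF Z Psi_carrier[OF v]] Z Psi_sym[OF v] by simp
  also have "\<dots> = Z * \<Psi> v * Z\<^sup>T"
    using assoc_mult_mat[OF Z Psi_carrier[OF v], of "Z\<^sup>T" n] Z by simp
  finally have "(Z * \<Psi> v * Z\<^sup>T)\<^sup>T = Z * \<Psi> v * Z\<^sup>T" .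
  moreover have "(s \<cdot>\<^sub>m (1\<^sub>m n :: real mat))\<^sup>T = s \<cdot>\<^sub>m 1\<^sub>m n" for s by (intro eq_matI) auto
  ultimately show ?thesis
    unfolding Sigma_mat_def using Z ZP by (subst transpose_add[of _ n n]) auto
qed

lemma Sigma_pd: "pos_def n \<Sigma>"
proof -
  let ?P = "\<Psi> \<psi>" and ?s = "\<psi> $ (r - 1)"
  have P: "?P \<in> carrier_mat q q" "psd ?P" and s: "0 < ?s"
    using Psi_carrier[OF psi_carrier] psi by (auto simp: parameter_set_def)
  have "0 < x \<bullet> (\<Sigma> *\<^sub>v x)" if x: "x \<in> carrier_vec n" "x \<noteq> 0\<^sub>v n" for x
  proof -
    let ?z = "Z\<^sup>T *\<^sub>v x"
    have z: "?z \<in> carrier_vec q" using Z x by simp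
    have ZT: "Z\<^sup>T \<in> carrier_mat q n" using Z by simp
    have "(Z * ?P * Z\<^sup>T) *\<^sub>v x = Z *\<^sub>v (?P *\<^sub>v ?z)"
      using assoc_mult_mat_vec[OF mult_carrier_mat[OF Z P(1)] ZT x(1)] assoc_mult_mat_vec[OF Z P(1) z] by simp
    moreover have "(?s \<cdot>\<^sub>m 1\<^sub>m n) *\<^sub>v x = ?s \<cdot>\<^sub>v x" using x by (intro eq_vecI) auto
    ultimately have "\<Sigma> *\<^sub>v x = Z *\<^sub>v (?P *\<^sub>v ?z) + ?s \<cdot>\<^sub>v x"
      unfolding Sigma_mat_def using Z P x psi_carrier
      by (subst add_mult_distrib_mat_vec[of _ n n]) auto
    then have "x \<bullet> (\<Sigma> *\<^sub>v x) = x \<bullet> (Z *\<^sub>v (?P *\<^sub>v ?z)) + ?s * (x \<bullet> x)"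
      using Z P z x by (simp add: scalar_prod_add_distrib[of _ n])
    also have "x \<bullet> (Z *\<^sub>v (?P *\<^sub>v ?z)) = ?z \<bullet> (?P *\<^sub>v ?z)"
      using transpose_vec_mult_scalar[OF Z _ x(1), of "?P *\<^sub>v ?z"] P z by simp
    finally have eq: "x \<bullet> (\<Sigma> *\<^sub>v x) = ?z \<bullet> (?P *\<^sub>v ?z) + ?s * (x \<bullet> x)" .
    have "0 \<le> ?z \<bullet> (?P *\<^sub>v ?z)" using P z by (simp add: psd_def)
    moreover have "0 < x \<bullet> x"
      using real_scalar_prod_self_eq_0[OF x(1)] x(2) real_scalar_prod_self_nonneg[of x] by linarith
    ultimately show ?thesis unfolding eq using s by (simp add: add_nonneg_pos)
  qed
  then show ?thesis
    unfolding pos_def_def using Sigma_carrier[OF psi_carrier] Sigma_sym[OF psi_carrier] by auto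
qed

abbreviation "K \<equiv> inv_msqrt \<Sigma>"
abbreviation "L \<equiv> msqrt \<Sigma>"

lemma K_carrier: "K \<in> carrier_mat n n" and K_sym: "K\<^sup>T = K" and L_carrier: "L \<in> carrier_mat n n"
  using inv_msqrt_pd(1)[OF Sigma_pd] msqrt_pd(1)[OF Sigma_pd] by (auto simp: pos_def_def)

lemma K_injective:
  assumes "x \<in> carrier_vec n" "K *\<^sub>v x = 0\<^sub>v n" shows "x = 0\<^sub>v n"
proof (rule ccontr)
  assume "x \<noteq> 0\<^sub>v n"
  then have "0 < x \<bullet> (K *\<^sub>v x)" using inv_msqrt_pd(1)[OF Sigma_pd] assms by (auto simp: pos_def_def)
  then show False using assms by simp
qed

lemma A_mat_carrier: "A_mat Z \<Psi> \<psi> j \<in> carrier_mat n n"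
  using K_carrier Sigma_carrier[OF psi_carrier] unfolding A_mat_def partial_mat_def by auto

text \<open>The derivative \<open>\<partial>\<Sigma>/\<partial>\<psi>\<^sub>j\<close> inherits symmetry entrywise: transposed entries of \<open>\<Sigma>\<close> agree for every
  value of the parameter, so they have the same derivative.\<close>

lemma A_mat_sym: "(A_mat Z \<Psi> \<psi> j)\<^sup>T = A_mat Z \<Psi> \<psi> j"
proof -
  let ?D = "partial_mat (Sigma_mat Z \<Psi>) j \<psi>"
  have D: "?D \<in> carrier_mat n n" using Sigma_carrier[OF psi_carrier] by (auto simp: partial_mat_def)
  have Ds: "?D\<^sup>T = ?D"
  proof (rule eq_matI)
    fix i k assume "i < dim_row ?D" "k < dim_col ?D"
    then have ik: "i < n" "k < n" using D by auto
    have "Sigma_mat Z \<Psi> (update_vec \<psi> j t) $$ (k, i) = Sigma_mat Z \<Psi> (update_vec \<psi> j t) $$ (i, k)" for t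
    proof -
      have u: "update_vec \<psi> j t \<in> carrier_vec r"
        using carrier_vecD[OF psi_carrier] by (intro carrier_vecI) simp
      show ?thesis by (rule symmetric_mat_entry[OF Sigma_carrier[OF u] Sigma_sym[OF u] ik])
    qed
    then have "?D $$ (k, i) = ?D $$ (i, k)"
      using ik carrier_matD[OF Sigma_carrier[OF psi_carrier]] by (simp add: partial_mat_def)
    then show "?D\<^sup>T $$ (i, k) = ?D $$ (i, k)"
      using ik carrier_matD[OF D] by simp
  qed (use D in auto)
  have "(K * ?D * K)\<^sup>T = K * (?D * K)"
    using transpose_mult[OF mult_carrier_mat[OF K_carrier D] K_carrier] transpose_mult[OF K_carrier D] Ds K_sym
    by simp
  then show ?thesis unfolding A_mat_def using assoc_mult_mat[OF K_carrier D K_carrier] by simp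
qed

text \<open>The standardized residual recovers the standard normal vector that generates the data, since
  \<open>\<Sigma>\<^sup>-\<^sup>1\<^sup>/\<^sup>2 \<Sigma>\<^sup>1\<^sup>/\<^sup>2 = I\<close>.\<close>

lemma std_resid_standardized:
  assumes \<beta>: "\<beta> \<in> carrier_vec p"
  shows "std_resid X Z \<Psi> \<beta> \<psi> (X *\<^sub>v \<beta> + L *\<^sub>v vec n g) = vec n g"
proof -
  have g: "vec n g \<in> carrier_vec n" by simp
  have "X *\<^sub>v \<beta> + L *\<^sub>v vec n g - X *\<^sub>v \<beta> = L *\<^sub>v vec n g"
    using X \<beta> L_carrier by (intro eq_vecI) auto
  then show ?thesis
    unfolding std_resid_def
    using assoc_mult_mat_vec[OF K_carrier L_carrier g] inv_msqrt_pd(2)[OF Sigma_pd] by simp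
qed

lemma score_psi_standardized:
  assumes \<beta>: "\<beta> \<in> carrier_vec p" and j: "j < r"
  shows "score_psi X Z \<Psi> \<beta> \<psi> (X *\<^sub>v \<beta> + L *\<^sub>v vec n g) $ j =
    lin_quad n (\<lambda>_. 0) (\<lambda>i k. A_mat Z \<Psi> \<psi> j $$ (i, k)) g"
proof -
  have "vec n g \<bullet> (A_mat Z \<Psi> \<psi> j *\<^sub>v vec n g) = (\<Sum>i<n. \<Sum>k<n. A_mat Z \<Psi> \<psi> j $$ (i, k) * g i * g k)"
    using A_mat_carrier[of j]
    by (simp add: scalar_prod_sum[of _ n] mult_mat_vec_index_sum[of _ n n] sum_distrib_left ac_simps)
  then show ?thesis
    using j psi_carrier A_mat_carrier[of j]
    by (simp add: score_psi_def Let_def std_resid_standardized[OF \<beta>] lin_quad_def mtrace_def)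
qed

lemma score_beta_standardized:
  assumes \<beta>: "\<beta> \<in> carrier_vec p" and j: "j < p"
  shows "score_beta X Z \<Psi> \<beta> \<psi> (X *\<^sub>v \<beta> + L *\<^sub>v vec n g) $ j =
    lin_quad n (\<lambda>i. (K * X) $$ (i, j)) (\<lambda>_ _. 0) g"
proof -
  have g: "vec n g \<in> carrier_vec n" by simp
  have KX: "K * X \<in> carrier_mat n p" using K_carrier X by simp
  have XT: "X\<^sup>T \<in> carrier_mat p n" using X by simp
  have "X\<^sup>T *\<^sub>v (K *\<^sub>v vec n g) = (K * X)\<^sup>T *\<^sub>v vec n g"
    using transpose_mult[OF K_carrier X] K_sym assoc_mult_mat_vec[OF XT K_carrier g] by simp
  then have "score_beta X Z \<Psi> \<beta> \<psi> (X *\<^sub>v \<beta> + L *\<^sub>v vec n g) $ j = ((K * X)\<^sup>T *\<^sub>v vec n g) $ j"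
    by (simp only: score_beta_def std_resid_standardized[OF \<beta>])
  also have "\<dots> = (\<Sum>i<n. (K * X)\<^sup>T $$ (j, i) * vec n g $ i)"
    using KX j by (intro mult_mat_vec_index_sum[of _ p]) auto
  also have "\<dots> = (\<Sum>i<n. (K * X) $$ (i, j) * g i)"
    using KX j by (intro sum.cong refl) (simp del: index_mult_mat)
  finally show ?thesis by (simp add: lin_quad_def)
qed

lemma std_resid_carrier: "std_resid X Z \<Psi> \<beta> \<psi> y \<in> carrier_vec n"
  unfolding std_resid_def
  by (intro mult_mat_vec_carrier[OF K_carrier] carrier_vecI) (use carrier_matD[OF X] in simp)

lemma std_resid_measurable:
  assumes \<beta>: "\<beta> \<in> carrier_vec p" and i: "i < n"
  shows "(\<lambda>y. std_resid X Z \<Psi> \<beta> \<psi> y $ i) \<in> borel_measurable (borel_vec n)"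
proof -
  have "(\<lambda>y. \<Sum>k<n. K $$ (i, k) * (y $ k - (X *\<^sub>v \<beta>) $ k)) \<in> borel_measurable (borel_vec n)"
    by (intro borel_measurable_sum borel_measurable_times borel_measurable_diff measurable_vec_index
        borel_measurable_const) auto
  moreover have "std_resid X Z \<Psi> \<beta> \<psi> y $ i = (\<Sum>k<n. K $$ (i, k) * (y $ k - (X *\<^sub>v \<beta>) $ k))"
    if y: "y \<in> space (borel_vec n)" for y
  proof -
    have "y - X *\<^sub>v \<beta> \<in> carrier_vec n" using y X \<beta> by auto
    then have "std_resid X Z \<Psi> \<beta> \<psi> y $ i = (\<Sum>k<n. K $$ (i, k) * (y - X *\<^sub>v \<beta>) $ k)"
      unfolding std_resid_def by (rule mult_mat_vec_index_sum[OF K_carrier _ i])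
    then show ?thesis using y X \<beta> by simp
  qed
  ultimately show ?thesis by (subst measurable_cong) auto
qed

lemma score_psi_measurable:
  assumes \<beta>: "\<beta> \<in> carrier_vec p" and j: "j < r"
  shows "(\<lambda>y. score_psi X Z \<Psi> \<beta> \<psi> y $ j) \<in> borel_measurable (borel_vec n)"
proof -
  let ?A = "A_mat Z \<Psi> \<psi> j"
  let ?R = "std_resid X Z \<Psi> \<beta> \<psi>"
  have R: "?R y \<in> carrier_vec n" for y by (rule std_resid_carrier)
  have "?R y \<bullet> (?A *\<^sub>v ?R y) = (\<Sum>i<n. \<Sum>k<n. ?R y $ i * (?A $$ (i, k) * ?R y $ k))" for y
    unfolding scalar_prod_sum[OF mult_mat_vec_carrier[OF A_mat_carrier R]] sum_distrib_left[symmetric]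
    by (intro sum.cong refl) (simp add: mult_mat_vec_index_sum[OF A_mat_carrier R])
  then have "score_psi X Z \<Psi> \<beta> \<psi> y $ j =
      ((\<Sum>i<n. \<Sum>k<n. ?R y $ i * (?A $$ (i, k) * ?R y $ k)) - mtrace ?A) / 2" for y
    using j psi_carrier by (simp add: score_psi_def Let_def)
  moreover have "(\<lambda>y. ((\<Sum>i<n. \<Sum>k<n. ?R y $ i * (?A $$ (i, k) * ?R y $ k)) - mtrace ?A) / 2)
      \<in> borel_measurable (borel_vec n)"
    using std_resid_measurable[OF \<beta>]
    by (intro borel_measurable_divide borel_measurable_diff borel_measurable_sum borel_measurable_times
        borel_measurable_const) auto
  ultimately show ?thesis by (simp only:)
qed

lemma score_beta_measurable:
  assumes \<beta>: "\<beta> \<in> carrier_vec p" and j: "j < p"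
  shows "(\<lambda>y. score_beta X Z \<Psi> \<beta> \<psi> y $ j) \<in> borel_measurable (borel_vec n)"
proof -
  let ?R = "std_resid X Z \<Psi> \<beta> \<psi>"
  have R: "?R y \<in> carrier_vec n" for y by (rule std_resid_carrier)
  have XT: "X\<^sup>T \<in> carrier_mat p n" using X by simp
  have "score_beta X Z \<Psi> \<beta> \<psi> y $ j = (\<Sum>i<n. (X\<^sup>T * K) $$ (j, i) * ?R y $ i)" for y
    using assoc_mult_mat_vec[OF XT K_carrier R]
      mult_mat_vec_index_sum[OF mult_carrier_mat[OF XT K_carrier] R j] by (simp add: score_beta_def)
  moreover have "(\<lambda>y. \<Sum>i<n. (X\<^sup>T * K) $$ (j, i) * ?R y $ i) \<in> borel_measurable (borel_vec n)"
    using std_resid_measurable[OF \<beta>]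
    by (intro borel_measurable_sum borel_measurable_times borel_measurable_const) auto
  ultimately show ?thesis by (simp only:)
qed

lemma A_comb_carrier: "A_comb Z \<Psi> v \<psi> \<in> carrier_mat n n"
  using Z by (simp add: A_comb_def)

lemma frobenius_square:
  "A \<in> carrier_mat n n \<Longrightarrow> (frobenius_norm A)\<^sup>2 = (\<Sum>i<n. \<Sum>k<n. (A $$ (i, k))\<^sup>2)"
  by (simp add: frobenius_norm_def sum_nonneg)

lemma a_ratio_bounds:
  assumes n: "0 < n"
  shows "0 \<le> a_ratio Z \<Psi> v \<psi>" "a_ratio Z \<Psi> v \<psi> \<le> 1"
  using spectral_norm_nonneg[OF A_comb_carrier n] spectral_norm_le_frobenius[OF A_comb_carrier n]
  by (auto simp: a_ratio_def)

text \<open>The ratios are bounded, because the spectral norm never exceeds the Frobenius norm, so their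
  supremum is an upper bound for each of them.\<close>

lemma a_ratio_le_bound:
  assumes n: "0 < n" and sup: "(SUP v\<in>unit_sphere r. a_ratio Z \<Psi> v \<psi>) \<le> \<epsilon>" and v: "v \<in> unit_sphere r"
  shows "a_ratio Z \<Psi> v \<psi> \<le> \<epsilon>"
proof -
  have "a_ratio Z \<Psi> v \<psi> \<le> (SUP v\<in>unit_sphere r. a_ratio Z \<Psi> v \<psi>)"
    by (rule cSUP_upper[OF v]) (use a_ratio_bounds[OF n] in \<open>auto intro!: bdd_aboveI2\<close>)
  then show ?thesis using sup by simp
qed

lemma bound_nonneg:
  assumes n: "0 < n" and sup: "(SUP v\<in>unit_sphere r. a_ratio Z \<Psi> v \<psi>) \<le> \<epsilon>"
  shows "0 \<le> \<epsilon>"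
  using a_ratio_bounds(1)[OF n] a_ratio_le_bound[OF n sup unit_vec_unit_sphere[OF r_pos]]
  by (rule order_trans)

text \<open>The ratio is set to 1 where the Frobenius norm vanishes, so a supremum below 1 excludes that
  \<open>A(w, \<psi>) = 0\<close> for a direction \<open>w \<noteq> 0\<close>. This is what makes the information matrix invertible.
  Unit vectors suffice, since \<open>A(w, \<psi>)\<close> is linear in \<open>w\<close>.\<close>

lemma A_comb_bounds:
  assumes n: "0 < n" and sup: "(SUP v\<in>unit_sphere r. a_ratio Z \<Psi> v \<psi>) \<le> \<epsilon>" and \<epsilon>: "\<epsilon> < 1"
    and w: "w \<in> carrier_vec r" and nz: "w \<noteq> 0\<^sub>v r"
  shows "0 < (\<Sum>i<n. \<Sum>k<n. (A_comb Z \<Psi> w \<psi> $$ (i, k))\<^sup>2)"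
    and "x \<in> carrier_vec n \<Longrightarrow> (A_comb Z \<Psi> w \<psi> *\<^sub>v x) \<bullet> (A_comb Z \<Psi> w \<psi> *\<^sub>v x) \<le>
      \<epsilon>\<^sup>2 * (\<Sum>i<n. \<Sum>k<n. (A_comb Z \<Psi> w \<psi> $$ (i, k))\<^sup>2) * (x \<bullet> x)"
proof -
  obtain s y where s: "0 < s" "y \<in> unit_sphere r" "w = s \<cdot>\<^sub>v y"
    using normalize_vec[OF w nz] by metis
  have yc: "y \<in> carrier_vec r" using s by (simp add: unit_sphere_def)
  let ?A = "A_comb Z \<Psi> y \<psi>"
  have Ac: "?A \<in> carrier_mat n n" by (rule A_comb_carrier)
  have scale: "A_comb Z \<Psi> w \<psi> = s \<cdot>\<^sub>m ?A"
    using s yc Z by (intro eq_matI) (simp_all add: A_comb_def sum_distrib_left mult.assoc)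
  have le: "a_ratio Z \<Psi> y \<psi> \<le> \<epsilon>" by (rule a_ratio_le_bound[OF n sup s(2)])
  then have F: "0 < frobenius_norm ?A" using \<epsilon> by (auto simp: a_ratio_def split: if_splits)
  then have spec: "spectral_norm ?A \<le> \<epsilon> * frobenius_norm ?A"
    using le by (simp add: a_ratio_def pos_divide_le_eq)
  have sq: "(\<Sum>i<n. \<Sum>k<n. (A_comb Z \<Psi> w \<psi> $$ (i, k))\<^sup>2) = s\<^sup>2 * (frobenius_norm ?A)\<^sup>2"
    unfolding frobenius_square[OF Ac] scale using Ac by (simp add: sum_distrib_left power_mult_distrib)
  show "0 < (\<Sum>i<n. \<Sum>k<n. (A_comb Z \<Psi> w \<psi> $$ (i, k))\<^sup>2)" unfolding sq using s F by simp
  assume x: "x \<in> carrier_vec n"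
  have "(?A *\<^sub>v x) \<bullet> (?A *\<^sub>v x) \<le> (spectral_norm ?A)\<^sup>2 * (x \<bullet> x)"
    by (rule spectral_norm_bound[OF Ac x])
  also have "\<dots> \<le> (\<epsilon> * frobenius_norm ?A)\<^sup>2 * (x \<bullet> x)"
    using spec spectral_norm_nonneg[OF Ac n] real_scalar_prod_self_nonneg[of x]
    by (intro mult_right_mono power_mono)
  finally have le': "s\<^sup>2 * ((?A *\<^sub>v x) \<bullet> (?A *\<^sub>v x)) \<le> s\<^sup>2 * ((\<epsilon> * frobenius_norm ?A)\<^sup>2 * (x \<bullet> x))"
    by (intro mult_left_mono) auto
  have "(s \<cdot>\<^sub>m ?A) *\<^sub>v x = s \<cdot>\<^sub>v (?A *\<^sub>v x)" using Ac x by (intro eq_vecI) auto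
  then have "(A_comb Z \<Psi> w \<psi> *\<^sub>v x) \<bullet> (A_comb Z \<Psi> w \<psi> *\<^sub>v x) = s\<^sup>2 * ((?A *\<^sub>v x) \<bullet> (?A *\<^sub>v x))"
    unfolding scale using Ac x by (simp add: power2_eq_square)
  then show "(A_comb Z \<Psi> w \<psi> *\<^sub>v x) \<bullet> (A_comb Z \<Psi> w \<psi> *\<^sub>v x) \<le>
      \<epsilon>\<^sup>2 * (\<Sum>i<n. \<Sum>k<n. (A_comb Z \<Psi> w \<psi> $$ (i, k))\<^sup>2) * (x \<bullet> x)"
    unfolding sq using le' by (simp add: power_mult_distrib ac_simps)
qed

lemma A_comb_op_bound:
  assumes n: "0 < n" and sup: "(SUP v\<in>unit_sphere r. a_ratio Z \<Psi> v \<psi>) \<le> \<epsilon>" and \<epsilon>: "\<epsilon> < 1"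
    and w: "w \<in> carrier_vec r"
  shows "(\<Sum>i<n. (\<Sum>k<n. A_comb Z \<Psi> w \<psi> $$ (i, k) * x k)\<^sup>2) \<le>
      \<epsilon>\<^sup>2 * (\<Sum>i<n. \<Sum>k<n. (A_comb Z \<Psi> w \<psi> $$ (i, k))\<^sup>2) * (\<Sum>k<n. (x k)\<^sup>2)"
proof (cases "w = 0\<^sub>v r")
  case True
  then have "A_comb Z \<Psi> w \<psi> $$ (i, k) = 0" if "i < n" "k < n" for i k
    using that Z by (simp add: A_comb_def)
  then show ?thesis by simp
next
  case False
  have "(A_comb Z \<Psi> w \<psi> *\<^sub>v vec n x) \<bullet> (A_comb Z \<Psi> w \<psi> *\<^sub>v vec n x) =
      (\<Sum>i<n. (\<Sum>k<n. A_comb Z \<Psi> w \<psi> $$ (i, k) * x k)\<^sup>2)"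
    using A_comb_carrier[of w]
    by (simp add: scalar_prod_sum[of _ n] mult_mat_vec_index_sum[of _ n n] power2_eq_square)
  moreover have "vec n x \<bullet> vec n x = (\<Sum>k<n. (x k)\<^sup>2)"
    by (simp add: scalar_prod_sum[of _ n] power2_eq_square)
  ultimately show ?thesis
    using A_comb_bounds(2)[OF n sup \<epsilon> w False, of "vec n x"] by simp
qed

lemma A_comb_entry:
  assumes "w \<in> carrier_vec r" "i < n" "k < n"
  shows "A_comb Z \<Psi> w \<psi> $$ (i, k) = (\<Sum>j<r. w $ j * A_mat Z \<Psi> \<psi> j $$ (i, k))"
  using assms Z by (simp add: A_comb_def)

lemma A_mat_entry_sym: "i < n \<Longrightarrow> k < n \<Longrightarrow> A_mat Z \<Psi> \<psi> j $$ (i, k) = A_mat Z \<Psi> \<psi> j $$ (k, i)"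
  by (rule symmetric_mat_entry[OF A_mat_carrier A_mat_sym])

lemma std_score_psi_close_to_normal:
  assumes n: "0 < n" and sup: "(SUP v\<in>unit_sphere r. a_ratio Z \<Psi> v \<psi>) \<le> \<epsilon>" and \<epsilon>: "\<epsilon> < 1"
    and Y: "normal_vector M Y (X *\<^sub>v 0\<^sub>v p) \<Sigma>" and v: "v \<in> unit_sphere r"
  defines "D \<equiv> distr M borel (\<lambda>\<omega>. v \<bullet> std_score_psi X Z \<Psi> \<psi> (Y \<omega>))"
  shows "real_distribution D" "cmod (char D t - exp (- t\<^sup>2 / 2)) \<le> 3 / 2 * (sqrt 2 * \<epsilon>) * t\<^sup>2"
proof -
  have \<beta>: "0\<^sub>v p \<in> carrier_vec p" by simp
  interpret S: lin_quad_score n r "X *\<^sub>v 0\<^sub>v p" \<Sigma> "score_psi X Z \<Psi> (0\<^sub>v p) \<psi>" "\<lambda>_ _. 0"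
    "\<lambda>j i k. A_mat Z \<Psi> \<psi> j $$ (i, k)"
    using X L_carrier psi_carrier score_psi_measurable[OF \<beta>] score_psi_standardized[OF \<beta>] A_mat_entry_sym
    by unfold_locales (auto simp: score_psi_def Let_def intro!: carrier_vecI)
  have Bc: "S.B_comb w i k = A_comb Z \<Psi> w \<psi> $$ (i, k)" if "w \<in> carrier_vec r" "i < n" "k < n" for w i k
    using that by (simp add: S.B_comb_def A_comb_entry)
  have info: "fisher_info_psi X Z \<Psi> (0\<^sub>v p) \<psi> = S.info"
    using psi_carrier by (simp add: fisher_info_psi_def S.info_def)
  have D: "D = distr M borel (\<lambda>\<omega>. v \<bullet> (inv_msqrt S.info *\<^sub>v score_psi X Z \<Psi> (0\<^sub>v p) \<psi> (Y \<omega>)))"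
    unfolding D_def std_score_psi_def Let_def carrier_matD(2)[OF X] info ..
  have pos: "0 < (\<Sum>i<n. (S.c_comb w i)\<^sup>2) + (\<Sum>i<n. \<Sum>k<n. (S.B_comb w i k)\<^sup>2) / 2"
    if "w \<in> carrier_vec r" "w \<noteq> 0\<^sub>v r" for w
    using A_comb_bounds(1)[OF n sup \<epsilon> that] that by (simp add: S.c_comb_def Bc)
  have op: "(\<Sum>i<n. (\<Sum>k<n. S.B_comb w i k * x k)\<^sup>2) \<le>
      \<epsilon>\<^sup>2 * (\<Sum>i<n. \<Sum>k<n. (S.B_comb w i k)\<^sup>2) * (\<Sum>k<n. (x k)\<^sup>2)" if "w \<in> carrier_vec r" for w x
    using A_comb_op_bound[OF n sup \<epsilon> that, of x] that by (simp add: Bc)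
  show "real_distribution D" "cmod (char D t - exp (- t\<^sup>2 / 2)) \<le> 3 / 2 * (sqrt 2 * \<epsilon>) * t\<^sup>2"
    unfolding D
    using S.standardized_score_close_to_normal[OF pos op bound_nonneg[OF n sup] Y v] by blast+
qed

text \<open>The first \<open>p\<close> entries of the joint score are linear in the standardized residual and the others
  are quadratic, so a direction combines a linear and a quadratic part. If the quadratic part of
  the direction vanishes, its variance is \<open>|\<Sigma>\<^sup>-\<^sup>1\<^sup>/\<^sup>2 X w\<^sub>1|\<^sup>2\<close>, which is positive by the rank
  condition.\<close>

lemma std_score_close_to_normal:
  assumes n: "0 < n" and sup: "(SUP v\<in>unit_sphere r. a_ratio Z \<Psi> v \<psi>) \<le> \<epsilon>" and \<epsilon>: "\<epsilon> < 1"
    and rank: "vec_space.rank n X = p" and \<beta>: "\<beta> \<in> carrier_vec p"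
    and Y: "normal_vector M Y (X *\<^sub>v \<beta>) \<Sigma>" and u: "u \<in> unit_sphere (p + r)"
  defines "D \<equiv> distr M borel (\<lambda>\<omega>. u \<bullet> std_score X Z \<Psi> \<beta> \<psi> (Y \<omega>))"
  shows "real_distribution D" "cmod (char D t - exp (- t\<^sup>2 / 2)) \<le> 3 / 2 * (sqrt 2 * \<epsilon>) * t\<^sup>2"
proof -
  define c where "c a i = (if a < p then (K * X) $$ (i, a) else 0)" for a i
  define B where "B a i k = (if a < p then 0 else A_mat Z \<Psi> \<psi> (a - p) $$ (i, k))" for a i k
  have KX: "K * X \<in> carrier_mat n p" using K_carrier X by simp
  have dims: "dim_vec (score_beta X Z \<Psi> \<beta> \<psi> y) = p" "dim_vec (score_psi X Z \<Psi> \<beta> \<psi> y) = r" for y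
    using X psi_carrier by (simp_all add: score_beta_def score_psi_def Let_def)
  have entry: "score X Z \<Psi> \<beta> \<psi> y $ a = (if a < p then score_beta X Z \<Psi> \<beta> \<psi> y $ a
      else score_psi X Z \<Psi> \<beta> \<psi> y $ (a - p))" if "a < p + r" for a y
    using that by (simp add: score_def dims)
  interpret S: lin_quad_score n "p + r" "X *\<^sub>v \<beta>" \<Sigma> "score X Z \<Psi> \<beta> \<psi>" c B
  proof
    show "X *\<^sub>v \<beta> \<in> carrier_vec n" using X \<beta> by simp
    show "score X Z \<Psi> \<beta> \<psi> y \<in> carrier_vec (p + r)" for y
      by (intro carrier_vecI) (simp add: score_def dims)
    fix a assume a: "a < p + r"
    show "(\<lambda>y. score X Z \<Psi> \<beta> \<psi> y $ a) \<in> borel_measurable (borel_vec n)"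
      unfolding entry[OF a]
      using a score_beta_measurable[OF \<beta>, of a] score_psi_measurable[OF \<beta>, of "a - p"]
      by (cases "a < p") simp_all
    show "score X Z \<Psi> \<beta> \<psi> (X *\<^sub>v \<beta> + L *\<^sub>v vec n g) $ a = lin_quad n (c a) (B a) g" for g
      unfolding entry[OF a] c_def[abs_def] B_def[abs_def]
      using a score_beta_standardized[OF \<beta>] score_psi_standardized[OF \<beta>] by simp
    show "B a i k = B a k i" if "i < n" "k < n" for i k
      using A_mat_entry_sym that by (simp add: B_def)
  qed (rule L_carrier)
  have split: "(\<Sum>a<p + r. h a) = (\<Sum>a<p. h a) + (\<Sum>j<r. h (p + j))" for h :: "nat \<Rightarrow> real"
    by (rule sum_lessThan_add)
  let ?w1 = "\<lambda>w. vec p (\<lambda>a. w $ a)" and ?w2 = "\<lambda>w. vec r (\<lambda>j. w $ (p + j))"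
  have Bc: "S.B_comb w i k = A_comb Z \<Psi> (?w2 w) \<psi> $$ (i, k)" if "i < n" "k < n" for w i k
    using that unfolding S.B_comb_def split by (subst A_comb_entry) (simp_all add: B_def)
  have cc: "S.c_comb w i = ((K * X) *\<^sub>v ?w1 w) $ i" if "i < n" for w i
    unfolding S.c_comb_def split
    using mult_mat_vec_index_sum[OF KX _ that, of "?w1 w"] by (simp add: c_def mult.commute)
  have info: "fisher_info X Z \<Psi> \<beta> \<psi> = S.info"
    using psi_carrier \<beta> by (simp add: fisher_info_def S.info_def)
  have D: "D = distr M borel (\<lambda>\<omega>. u \<bullet> (inv_msqrt S.info *\<^sub>v score X Z \<Psi> \<beta> \<psi> (Y \<omega>)))"
    by (simp add: D_def std_score_def info)
  have pos: "0 < (\<Sum>i<n. (S.c_comb w i)\<^sup>2) + (\<Sum>i<n. \<Sum>k<n. (S.B_comb w i k)\<^sup>2) / 2"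
    if w: "w \<in> carrier_vec (p + r)" "w \<noteq> 0\<^sub>v (p + r)" for w
  proof (cases "?w2 w = 0\<^sub>v r")
    case False
    then have "0 < (\<Sum>i<n. \<Sum>k<n. (S.B_comb w i k)\<^sup>2)"
      using A_comb_bounds(1)[OF n sup \<epsilon> _ False] by (simp add: Bc)
    then show ?thesis by (simp add: add_nonneg_pos sum_nonneg)
  next
    case True
    have "?w1 w \<noteq> 0\<^sub>v p"
    proof
      assume w1: "?w1 w = 0\<^sub>v p"
      have "w $ a = 0" if "a < p + r" for a
      proof (cases "a < p")
        case True
        then show ?thesis using arg_cong[OF w1, of "\<lambda>x. x $ a"] by simp
      next
        case False
        then have "p + (a - p) = a" "a - p < r" using that by simp_all
        then show ?thesis using arg_cong[OF True, of "\<lambda>x. x $ (a - p)"] by simp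
      qed
      then show False using w by (metis carrier_vecD eq_vecI index_zero_vec)
    qed
    then have "X *\<^sub>v ?w1 w \<noteq> 0\<^sub>v n" using full_rank_injective[OF X rank, of "?w1 w"] by auto
    then have "(K * X) *\<^sub>v ?w1 w \<noteq> 0\<^sub>v n"
      using K_injective[of "X *\<^sub>v ?w1 w"] assoc_mult_mat_vec[OF K_carrier X, of "?w1 w"] X by auto
    then have "((K * X) *\<^sub>v ?w1 w) \<bullet> ((K * X) *\<^sub>v ?w1 w) \<noteq> 0"
      using real_scalar_prod_self_eq_0[of "(K * X) *\<^sub>v ?w1 w" n] KX by auto
    then have "0 < ((K * X) *\<^sub>v ?w1 w) \<bullet> ((K * X) *\<^sub>v ?w1 w)"
      using real_scalar_prod_self_nonneg[of "(K * X) *\<^sub>v ?w1 w"] by linarith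
    also have "\<dots> = (\<Sum>i<n. (S.c_comb w i)\<^sup>2)"
      using mult_mat_vec_carrier[OF KX, of "?w1 w"]
      by (subst scalar_prod_sum[of _ n]) (simp_all add: cc power2_eq_square)
    finally show ?thesis by (simp add: add_pos_nonneg sum_nonneg)
  qed
  have op: "(\<Sum>i<n. (\<Sum>k<n. S.B_comb w i k * x k)\<^sup>2) \<le>
      \<epsilon>\<^sup>2 * (\<Sum>i<n. \<Sum>k<n. (S.B_comb w i k)\<^sup>2) * (\<Sum>k<n. (x k)\<^sup>2)" for w x
    using A_comb_op_bound[OF n sup \<epsilon>, of "?w2 w" x] by (simp add: Bc)
  show "real_distribution D" "cmod (char D t - exp (- t\<^sup>2 / 2)) \<le> 3 / 2 * (sqrt 2 * \<epsilon>) * t\<^sup>2"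
    unfolding D
    using S.standardized_score_close_to_normal[OF pos op bound_nonneg[OF n sup] Y u] by blast+
qed

end

section \<open>Asymptotic normality\<close>

text \<open>The bound is needed only from some index on: for small sample sizes the information matrix may
  be singular. Levy's theorem is therefore applied to a shifted sequence.\<close>

lemma weak_conv_std_normal_if_char_bound:
  fixes D :: "nat \<Rightarrow> real measure" and a :: "nat \<Rightarrow> real"
  assumes ev: "\<forall>\<^sub>F n in sequentially. real_distribution (D n) \<and>
      (\<forall>t. cmod (char (D n) t - exp (- t\<^sup>2 / 2)) \<le> C * a n * t\<^sup>2)"
    and a: "a \<longlonglongrightarrow> 0"
  shows "weak_conv_m D std_normal_distribution"
proof -
  obtain N where N: "\<And>n. N \<le> n \<Longrightarrow> real_distribution (D n)"
    "\<And>n t. N \<le> n \<Longrightarrow> cmod (char (D n) t - exp (- t\<^sup>2 / 2)) \<le> C * a n * t\<^sup>2"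
    using ev unfolding eventually_sequentially by blast
  have "weak_conv_m (\<lambda>n. D (n + N)) std_normal_distribution"
  proof (rule levy_continuity)
    fix t
    have "(\<lambda>n. C * a (n + N) * t\<^sup>2) \<longlonglongrightarrow> 0"
      by (intro tendsto_mult_left_zero tendsto_mult_right_zero LIMSEQ_ignore_initial_segment a)
    then have "(\<lambda>n. char (D (n + N)) t - exp (- t\<^sup>2 / 2)) \<longlonglongrightarrow> 0"
      by (rule Lim_null_comparison[rotated]) (use N(2) in auto)
    then show "(\<lambda>n. char (D (n + N)) t) \<longlonglongrightarrow> char std_normal_distribution t"
      unfolding char_std_normal_distribution using LIM_zero_cancel by fastforce
  qed (use N(1) in \<open>auto intro: real_dist_normal_dist\<close>)
  then show ?thesis
    unfolding weak_conv_m_def weak_conv_def using LIMSEQ_offset[of "\<lambda>n. cdf (D n) x" N for x] by blast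
qed

theorem theorem2:
  fixes p q r :: "nat \<Rightarrow> nat"
    and X Z :: "nat \<Rightarrow> real mat"
    and \<Psi> :: "nat \<Rightarrow> real vec \<Rightarrow> real mat"
    and \<psi> :: "nat \<Rightarrow> real vec"
    and abar :: "nat \<Rightarrow> real"
  assumes X: "\<And>n. 1 \<le> n \<Longrightarrow> X n \<in> carrier_mat n (p n)"
    and Z: "\<And>n. 1 \<le> n \<Longrightarrow> Z n \<in> carrier_mat n (q n)"
    and Psi: "\<And>n. 1 \<le> n \<Longrightarrow> covariance_pattern (q n) (r n) (\<Psi> n)"
    and psi: "\<And>n. 1 \<le> n \<Longrightarrow> \<psi> n \<in> parameter_set (r n) (\<Psi> n)"
    and abar: "\<And>n. 1 \<le> n \<Longrightarrow> (SUP v\<in>unit_sphere (r n). a_ratio (Z n) (\<Psi> n) v (\<psi> n)) \<le> abar n"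
    and abar_lim: "abar \<longlonglongrightarrow> 0"
  shows
    "(\<forall>(M :: nat \<Rightarrow> 'a measure) Y v.
        (\<forall>n\<ge>1. normal_vector (M n) (Y n) (X n *\<^sub>v 0\<^sub>v (p n)) (Sigma_mat (Z n) (\<Psi> n) (\<psi> n))) \<longrightarrow>
        (\<forall>n\<ge>1. v n \<in> unit_sphere (r n)) \<longrightarrow>
        weak_conv_m
          (\<lambda>n. distr (M n) borel (\<lambda>\<omega>. v n \<bullet> std_score_psi (X n) (Z n) (\<Psi> n) (\<psi> n) (Y n \<omega>)))
          std_normal_distribution) \<and>
     ((\<forall>n\<ge>1. vec_space.rank n (X n) = p n) \<longrightarrow>
      (\<forall>(M :: nat \<Rightarrow> 'a measure) Y \<beta> u.
        (\<forall>n\<ge>1. \<beta> n \<in> carrier_vec (p n)) \<longrightarrow>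
        (\<forall>n\<ge>1. normal_vector (M n) (Y n) (X n *\<^sub>v \<beta> n) (Sigma_mat (Z n) (\<Psi> n) (\<psi> n))) \<longrightarrow>
        (\<forall>n\<ge>1. u n \<in> unit_sphere (p n + r n)) \<longrightarrow>
        weak_conv_m
          (\<lambda>n. distr (M n) borel (\<lambda>\<omega>. u n \<bullet> std_score (X n) (Z n) (\<Psi> n) (\<beta> n) (\<psi> n) (Y n \<omega>)))
          std_normal_distribution))"
proof -
  have model: "covariance_model n (p n) (q n) (r n) (X n) (Z n) (\<Psi> n) (\<psi> n)" if "1 \<le> n" for n
    by standard (fact X[OF that] Z[OF that] Psi[OF that] psi[OF that])+
  have small: "\<forall>\<^sub>F n in sequentially. 1 \<le> n \<and> abar n < 1"
    using order_tendstoD(2)[OF abar_lim, of 1] by (intro eventually_conj eventually_ge_at_top) simp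
  show ?thesis
  proof (intro conjI impI allI)
    fix M :: "nat \<Rightarrow> 'a measure" and Y v
    assume Y: "\<forall>n\<ge>1. normal_vector (M n) (Y n) (X n *\<^sub>v 0\<^sub>v (p n)) (Sigma_mat (Z n) (\<Psi> n) (\<psi> n))"
      and v: "\<forall>n\<ge>1. v n \<in> unit_sphere (r n)"
    show "weak_conv_m
          (\<lambda>n. distr (M n) borel (\<lambda>\<omega>. v n \<bullet> std_score_psi (X n) (Z n) (\<Psi> n) (\<psi> n) (Y n \<omega>)))
          std_normal_distribution"
    proof (rule weak_conv_std_normal_if_char_bound[OF _ abar_lim, of _ "3 / 2 * sqrt 2"],
        rule eventually_mono[OF small])
      fix n assume n: "1 \<le> n \<and> abar n < 1"
      then have n1: "1 \<le> n" and n0: "0 < n" and a: "abar n < 1" by auto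
      from covariance_model.std_score_psi_close_to_normal[OF model[OF n1] n0 abar[OF n1] a
          Y[rule_format, OF n1] v[rule_format, OF n1]]
      show "real_distribution (distr (M n) borel (\<lambda>\<omega>. v n \<bullet> std_score_psi (X n) (Z n) (\<Psi> n) (\<psi> n) (Y n \<omega>))) \<and>
        (\<forall>t. cmod (char (distr (M n) borel (\<lambda>\<omega>. v n \<bullet> std_score_psi (X n) (Z n) (\<Psi> n) (\<psi> n) (Y n \<omega>))) t
           - exp (- t\<^sup>2 / 2)) \<le> 3 / 2 * sqrt 2 * abar n * t\<^sup>2)"
        by (simp add: mult.assoc)
    qed
  next
    fix M :: "nat \<Rightarrow> 'a measure" and Y \<beta> u
    assume rank: "\<forall>n\<ge>1. vec_space.rank n (X n) = p n" and \<beta>: "\<forall>n\<ge>1. \<beta> n \<in> carrier_vec (p n)"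
      and Y: "\<forall>n\<ge>1. normal_vector (M n) (Y n) (X n *\<^sub>v \<beta> n) (Sigma_mat (Z n) (\<Psi> n) (\<psi> n))"
      and u: "\<forall>n\<ge>1. u n \<in> unit_sphere (p n + r n)"
    show "weak_conv_m
          (\<lambda>n. distr (M n) borel (\<lambda>\<omega>. u n \<bullet> std_score (X n) (Z n) (\<Psi> n) (\<beta> n) (\<psi> n) (Y n \<omega>)))
          std_normal_distribution"
    proof (rule weak_conv_std_normal_if_char_bound[OF _ abar_lim, of _ "3 / 2 * sqrt 2"],
        rule eventually_mono[OF small])
      fix n assume n: "1 \<le> n \<and> abar n < 1"
      then have n1: "1 \<le> n" and n0: "0 < n" and a: "abar n < 1" by auto
      from covariance_model.std_score_close_to_normal[OF model[OF n1] n0 abar[OF n1] a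
          rank[rule_format, OF n1] \<beta>[rule_format, OF n1] Y[rule_format, OF n1] u[rule_format, OF n1]]
      show "real_distribution (distr (M n) borel (\<lambda>\<omega>. u n \<bullet> std_score (X n) (Z n) (\<Psi> n) (\<beta> n) (\<psi> n) (Y n \<omega>))) \<and>
        (\<forall>t. cmod (char (distr (M n) borel (\<lambda>\<omega>. u n \<bullet> std_score (X n) (Z n) (\<Psi> n) (\<beta> n) (\<psi> n) (Y n \<omega>))) t
           - exp (- t\<^sup>2 / 2)) \<le> 3 / 2 * sqrt 2 * abar n * t\<^sup>2)"
        by (simp add: mult.assoc)
    qed
  qed
qed

end
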